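(* Let $(\mathbf u_h^{rt},\overline p_h^{rt},\lambda_h^a,\lambda_h^b)\in\mathcal{RT}^0(\mathcal T_h)\times\mathcal L^0(\mathcal T_h)\times(\mathcal L^0(\mathcal S_h^C))^2$ satisfy the discrete KKT conditions: for every $(\mathbf v_h,\overline q_h)\in\mathcal{RT}^0(\mathcal T_h)\times\mathcal L^0(\mathcal T_h)$, $$(\mathbf K_h^{-1}\Pi_h\mathbf u_h^{rt},\Pi_h\mathbf v_h)_\Omega-(\overline p_h^{rt},\mathrm{div}\,\mathbf v_h)_\Omega+\langle\lambda_h^a-\lambda_h^b,\mathbf v_h\cdot\mathbf n\rangle_{\Gamma_C}=-\langle p_D^h,\mathbf v_h\cdot\mathbf n\rangle_{\Gamma_D},$$ $$(\mathrm{div}\,\mathbf u_h^{rt},\overline q_h)_\Omega=(f_h,\overline q_h)_\Omega,$$ and, on $\mathcal S_h^C$, $$\alpha_h\le\mathbf u_h^{rt}\cdot\mathbf n\le\beta_h,\quad\lambda_h^a,\lambda_h^b\le0,\quad\lambda_h^a(\mathbf u_h^{rt}\cdot\mathbf n-\alpha_h)=\lambda_h^b(\beta_h-\mathbf u_h^{rt}\cdot\mathbf n)=0.$$ Then the function $$\widehat p_h:=\overline p_h^{rt}-\mathbf K_h^{-1}\Pi_h\mathbf u_h^{rt}\cdot(\mathrm{id}_{\mathbb R^d}-\Pi_h\mathrm{id}_{\mathbb R^d})$$ is a discrete primal solution, i.e. $\widehat p_h\in K_h$ (in particular $\widehat p_h\in\mathcal S^{1,cr}(\mathcal T_h)$)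 and $\widehat p_h$ minimizes $I_h^{cr}$ over $K_h$.
   Context: Setting. $\Omega\subset\mathbb R^d$, $d\in\{2,3\}$, is an open, bounded, polyhedral Lipschitz domain with outward unit normal $\mathbf n$; $\partial\Omega=\overline{\Gamma_D}\cup\overline{\Gamma_C}$ with $\Gamma_D,\Gamma_C$ relatively open and disjoint. Data: $f\in L^2(\Omega)$; $p_D\in H^{1/2}(\Gamma_D)$ (restrictions to $\Gamma_D$ of traces of $H^1(\Omega)$ functions); $\mathbf K:\Omega\to\mathbb R^{d\times d}$ measurable, symmetric, with $k_0|\xi|^2\le\xi^T\mathbf K(x)\xi\le k_1|\xi|^2$ for all $x,\xi$ and some $0<k_0<k_1$; $\alpha,\beta\in L^2(\Gamma_C)$ with $\alpha\le\beta$ a.e.; if $\Gamma_D=\emptyset$, then $\int_{\Gamma_C}\alpha\,ds\le\int_\Omega f\,dx\le\int_{\Gamma_C}\beta\,ds$. $(\cdot,\cdot)_\Omega$ and $\langle\cdot,\cdot\rangle_\omega$ denote $L^2$ inner products; $q^+=\max(0,q)$, $q^-=\max(0,-q)$. Mesh. $\mathcal T_h$ is a conforming simplicial triangulation of $\Omega$ with facets $\mathcal S_h$; every boundary facet is contained in exactly one of $\overline{\Gamma_D},\overline{\Gamma_C}$, and $\mathcal S_h^D,\mathcal S_h^C$ are the corresponding sets of boundary facets. $x_S$ is the barycenter of $S$. $\mathcal L^0(\mathcal T_h)$, $\mathcal L^0(\mathcal S_h^C)$ are the elementwise/facetwise constant functions; $\Pi_h$ and $\pi_h$ are the elementwise and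 facetwise $L^2$-projections onto constants (componentwise for vectors and matrices); $\nabla_h$ is the elementwise gradient; $\mathrm{id}_{\mathbb R^d}(x)=x$, so $\Pi_h\mathrm{id}_{\mathbb R^d}$ equals the barycenter of $T$ on each $T\in\mathcal T_h$. Spaces. $\mathcal{RT}^0(\mathcal T_h)=\{\mathbf v_h\in H(\mathrm{div};\Omega):\mathbf v_h|_T\in\mathbb P^0(T)^d\oplus\mathbf x\,\mathbb P^0(T)\ \forall T\in\mathcal T_h\}$ (lowest-order Raviart–Thomas). $\mathcal S^{1,cr}(\mathcal T_h)$ is the Crouzeix–Raviart space of elementwise affine functions continuous at barycenters of interior facets, with basis $\varphi_S$, $\varphi_S(x_{S'})=\delta_{S,S'}$; $\Pi_h^{cr}q=\sum_{S\in\mathcal S_h}\big(\tfrac1{|S|}\int_Sq\,ds\big)\varphi_S$ for $q\in H^1(\Omega)$. Discrete data. $\mathbf K_h=\Pi_h\mathbf K$, $f_h=\Pi_hf$, $\alpha_h=\pi_h\alpha$, $\beta_h=\pi_h\beta$, $p_D^h=\Pi_h^{cr}\widehat p_D$ with $\widehat p_D\in H^1(\Omega)$ any fixed function whose trace on $\Gamma_D$ is $p_D$. Discrete primal problem. Minimize over $K_h=\{q_h\in\mathcal S^{1,cr}(\mathcal T_h):q_h(x_S)=p_D^h(x_S)\ \forall S\in\mathcal S_h^D\}$ the energy $$I_h^{cr}(q_h)=\tfrac12\|\mathbf K_h^{1/2}\nabla_hq_h\|_{L^2(\Omega)}^2-(f_h,\Pi_hq_h)_\Omega+\langle\beta_h,(\pi_hq_h)^+\rangle_{\Gamma_C}-\langle\alpha_h,(\pi_hq_h)^-\rangle_{\Gamma_C}.$$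 *)

theory Defs
  imports "HOL-Analysis.Analysis"
begin

section \<open>Function spaces on an open set\<close>

definition grad :: "('a::real_inner \<Rightarrow> real) \<Rightarrow> 'a \<Rightarrow> 'a" where
  "grad f x = (THE D. GDERIV f x :> D)"

primrec C_k :: "nat \<Rightarrow> (real^'n \<Rightarrow> real) \<Rightarrow> bool" where
  "C_k 0 f = continuous_on UNIV f"
| "C_k (Suc k) f = ((\<forall>x. f differentiable (at x)) \<and> (\<forall>i. C_k k (\<lambda>x. grad f x $ i)))"

definition smooth :: "(real^'n \<Rightarrow> real) \<Rightarrow> bool" where
  "smooth f \<longleftrightarrow> (\<forall>k. C_k k f)"

definition test_fun :: "(real^'n) set \<Rightarrow> (real^'n \<Rightarrow> real) \<Rightarrow> bool" where
  "test_fun \<Omega> \<phi> \<longleftrightarrow> smooth \<phi> \<and> compact (closure {x. \<phi> x \<noteq> 0}) \<and> closure {x. \<phi> x \<noteq> 0} \<subseteq> \<Omega>"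

definition L2 :: "'a measure \<Rightarrow> ('a \<Rightarrow> 'b::euclidean_space) set" where
  "L2 M = {w. w \<in> borel_measurable M \<and> integrable M (\<lambda>x. (norm (w x))\<^sup>2)}"

definition L2_inner :: "'a::euclidean_space set \<Rightarrow> ('a \<Rightarrow> 'b::euclidean_space) \<Rightarrow> ('a \<Rightarrow> 'b) \<Rightarrow> real" where
  "L2_inner \<Omega> w z = (LINT x|lebesgue_on \<Omega>. w x \<bullet> z x)"

definition L2_norm :: "'a::euclidean_space set \<Rightarrow> ('a \<Rightarrow> 'b::euclidean_space) \<Rightarrow> real" where
  "L2_norm \<Omega> w = sqrt (L2_inner \<Omega> w w)"

definition has_weak_grad :: "(real^'n) set \<Rightarrow> (real^'n \<Rightarrow> real) \<Rightarrow> (real^'n \<Rightarrow> real^'n) \<Rightarrow> bool" where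
  "has_weak_grad \<Omega> q G \<longleftrightarrow>
     (\<forall>\<phi>. test_fun \<Omega> \<phi> \<longrightarrow>
        (LINT x|lebesgue_on \<Omega>. q x *\<^sub>R grad \<phi> x) = - (LINT x|lebesgue_on \<Omega>. \<phi> x *\<^sub>R G x))"

definition H1 :: "(real^'n) set \<Rightarrow> (real^'n \<Rightarrow> real) set" where
  "H1 \<Omega> = {q \<in> L2 (lebesgue_on \<Omega>). \<exists>G \<in> L2 (lebesgue_on \<Omega>). has_weak_grad \<Omega> q G}"

definition has_weak_div :: "(real^'n) set \<Rightarrow> (real^'n \<Rightarrow> real^'n) \<Rightarrow> (real^'n \<Rightarrow> real) \<Rightarrow> bool" where
  "has_weak_div \<Omega> v g \<longleftrightarrow>
     (\<forall>\<phi>. test_fun \<Omega> \<phi> \<longrightarrow> L2_inner \<Omega> v (grad \<phi>) = - L2_inner \<Omega> g \<phi>)"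

definition H_div :: "(real^'n) set \<Rightarrow> (real^'n \<Rightarrow> real^'n) set" where
  "H_div \<Omega> = {v \<in> L2 (lebesgue_on \<Omega>). \<exists>g \<in> L2 (lebesgue_on \<Omega>). has_weak_div \<Omega> v g}"

definition weak_div :: "(real^'n) set \<Rightarrow> (real^'n \<Rightarrow> real^'n) \<Rightarrow> real^'n \<Rightarrow> real" where
  "weak_div \<Omega> v = (SOME g. g \<in> L2 (lebesgue_on \<Omega>) \<and> has_weak_div \<Omega> v g)"


section \<open>The domain and its mesh\<close>

text \<open>Near each boundary point, in a suitable direction \<open>e\<close>, the set is the strict epigraph
  of a Lipschitz function of the component orthogonal to \<open>e\<close>.\<close>
definition lipschitz_boundary :: "'a::euclidean_space set \<Rightarrow> bool" where
  "lipschitz_boundary \<Omega> \<longleftrightarrow>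
     (\<forall>x \<in> frontier \<Omega>. \<exists>U e \<gamma> L. open U \<and> x \<in> U \<and> norm e = 1 \<and> L-lipschitz_on UNIV \<gamma> \<and>
        \<Omega> \<inter> U = {y \<in> U. \<gamma> (y - (y \<bullet> e) *\<^sub>R e) < y \<bullet> e})"

definition polyhedral_lipschitz_domain :: "'a::euclidean_space set \<Rightarrow> bool" where
  "polyhedral_lipschitz_domain \<Omega> \<longleftrightarrow>
     open \<Omega> \<and> connected \<Omega> \<and> \<Omega> \<noteq> {} \<and> bounded \<Omega> \<and> lipschitz_boundary \<Omega> \<and>
     (\<exists>\<P>. finite \<P> \<and> (\<forall>P \<in> \<P>. polytope P) \<and> closure \<Omega> = \<Union>\<P>)"

text \<open>Meaningful at the points near which the boundary is flat, i.e. almost everywhere on the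
  boundary of a polyhedral domain.\<close>
definition outward_normal :: "'a::euclidean_space set \<Rightarrow> 'a \<Rightarrow> 'a" where
  "outward_normal \<Omega> x =
     (THE n. norm n = 1 \<and> (\<exists>r>0. \<Omega> \<inter> ball x r = {y \<in> ball x r. (y - x) \<bullet> n < 0}))"

text \<open>Elements are closed simplices; \<^const>\<open>triangulation\<close> provides finiteness and conformity.\<close>
definition conforming_mesh :: "(real^'n) set \<Rightarrow> (real^'n) set set \<Rightarrow> bool" where
  "conforming_mesh \<Omega> \<T> \<longleftrightarrow>
     triangulation \<T> \<and> (\<forall>T \<in> \<T>. int CARD('n) simplex T) \<and> \<Union>\<T> = closure \<Omega>"

definition facets :: "'a::euclidean_space set set \<Rightarrow> 'a set set" where
  "facets \<T> = {S. \<exists>T \<in> \<T>. S facet_of T}"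

definition bd_facets :: "'a::euclidean_space set \<Rightarrow> 'a set set \<Rightarrow> 'a set set" where
  "bd_facets \<Omega> \<T> = {S \<in> facets \<T>. S \<subseteq> frontier \<Omega>}"

text \<open>The facets tessellating the closure of \<open>\<Gamma>\<close>. Integrals over \<open>\<Gamma>\<close> are taken as sums over them:
  the relative boundary of \<open>\<Gamma>\<close> is understood to be a surface null set.\<close>
definition facets_on :: "'a::euclidean_space set \<Rightarrow> 'a set set \<Rightarrow> 'a set \<Rightarrow> 'a set set" where
  "facets_on \<Omega> \<T> \<Gamma> = {S \<in> bd_facets \<Omega> \<T>. S \<subseteq> closure \<Gamma>}"

definition barycenter :: "'a::euclidean_space set \<Rightarrow> 'a" where
  "barycenter S = (\<Sum>v | v extreme_point_of S. v) /\<^sub>R real (card {v. v extreme_point_of S})"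


section \<open>Integration over facets, traces\<close>

text \<open>The Lebesgue measure of codimension one on a flat facet \<open>S\<close>: the measure of \<open>A\<close> is the
  volume of the prism of height one over \<open>A \<inter> S\<close>.\<close>
definition facet_measure :: "'a::euclidean_space set \<Rightarrow> 'a measure" where
  "facet_measure S =
     (let n = (SOME n. norm n = 1 \<and> (\<forall>x \<in> S. \<forall>y \<in> S. (x - y) \<bullet> n = 0));
          Q = {x + t *\<^sub>R n | x t. x \<in> S \<and> 0 \<le> t \<and> t \<le> 1}
      in completion (distr (restrict_space lborel Q) borel
           (\<lambda>y. y - ((y - barycenter S) \<bullet> n) *\<^sub>R n)))"

definition facet_mean :: "'a::euclidean_space set \<Rightarrow> ('a \<Rightarrow> real) \<Rightarrow> real" where
  "facet_mean S g = (LINT x|facet_measure S. g x) / measure (facet_measure S) S"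

definition elem_mean :: "'a::euclidean_space set \<Rightarrow> ('a \<Rightarrow> 'b::euclidean_space) \<Rightarrow> 'b" where
  "elem_mean T w = (LINT x|lebesgue_on T. w x) /\<^sub>R measure lebesgue T"

text \<open>\<open>g\<close> is the trace of \<open>q\<close> on the union of the facets in \<open>\<S>\<close>: the continuous extension to
  \<open>H\<^sup>1\<close> of the restriction of functions smooth up to the boundary.\<close>
definition has_trace ::
    "(real^'n) set \<Rightarrow> (real^'n) set set \<Rightarrow> (real^'n \<Rightarrow> real) \<Rightarrow> (real^'n \<Rightarrow> real) \<Rightarrow> bool" where
  "has_trace \<Omega> \<S> q g \<longleftrightarrow>
     (\<forall>S \<in> \<S>. g \<in> L2 (facet_measure S)) \<and>
     (\<exists>G \<in> L2 (lebesgue_on \<Omega>). has_weak_grad \<Omega> q G \<and>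
       (\<exists>\<phi>. (\<forall>k. smooth (\<phi> k)) \<and>
          (\<lambda>k. L2_norm \<Omega> (\<lambda>x. \<phi> k x - q x)) \<longlonglongrightarrow> 0 \<and>
          (\<lambda>k. L2_norm \<Omega> (\<lambda>x. grad (\<phi> k) x - G x)) \<longlonglongrightarrow> 0 \<and>
          (\<forall>S \<in> \<S>. (\<lambda>k. LINT x|facet_measure S. (\<phi> k x - g x)\<^sup>2) \<longlonglongrightarrow> 0)))"

definition H_half :: "(real^'n) set \<Rightarrow> (real^'n) set set \<Rightarrow> (real^'n \<Rightarrow> real) set" where
  "H_half \<Omega> \<S> = {g. \<exists>q \<in> H1 \<Omega>. has_trace \<Omega> \<S> q g}"

definition facet_trace :: "(real^'n) set \<Rightarrow> (real^'n) set \<Rightarrow> (real^'n \<Rightarrow> real) \<Rightarrow> real^'n \<Rightarrow> real" where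
  "facet_trace \<Omega> S q = (SOME g. has_trace \<Omega> {S} q g)"


section \<open>Discrete spaces\<close>

text \<open>A piecewise function is the family \<open>w\<close> of its restrictions: \<open>w T x\<close>, with \<open>x\<close> in the
  closed element \<open>T\<close>, is the value at \<open>x\<close> seen from \<open>T\<close>; the values off \<open>T\<close> are irrelevant.
  Thus one-sided values on facets need no limits. Elementwise (facetwise) constants are
  functions of the element (facet). \<open>glue\<close> is the function on the domain, up to the null set
  of element boundaries.\<close>
definition glue :: "'a::euclidean_space set set \<Rightarrow> ('a set \<Rightarrow> 'a \<Rightarrow> 'b::zero) \<Rightarrow> 'a \<Rightarrow> 'b" where
  "glue \<T> w x = (if \<exists>T \<in> \<T>. x \<in> interior T then w (THE T. T \<in> \<T> \<and> x \<in> interior T) x else 0)"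

abbreviation glue0 :: "'a::euclidean_space set set \<Rightarrow> ('a set \<Rightarrow> 'b::zero) \<Rightarrow> 'a \<Rightarrow> 'b" where
  "glue0 \<T> c \<equiv> glue \<T> (\<lambda>T x. c T)"

definition RT0 :: "(real^'n) set \<Rightarrow> (real^'n) set set \<Rightarrow> ((real^'n) set \<Rightarrow> real^'n \<Rightarrow> real^'n) set" where
  "RT0 \<Omega> \<T> = {v. glue \<T> v \<in> H_div \<Omega> \<and> (\<forall>T \<in> \<T>. \<exists>a b. \<forall>x \<in> T. v T x = a + b *\<^sub>R x)}"

definition CR :: "(real^'n) set \<Rightarrow> (real^'n) set set \<Rightarrow> ((real^'n) set \<Rightarrow> real^'n \<Rightarrow> real) set" where
  "CR \<Omega> \<T> = {q. (\<forall>T \<in> \<T>. \<exists>a b. \<forall>x \<in> T. q T x = a + b \<bullet> x) \<and>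
     (\<forall>S \<in> facets \<T> - bd_facets \<Omega> \<T>. \<forall>T \<in> \<T>. \<forall>T' \<in> \<T>. S facet_of T \<and> S facet_of T' \<longrightarrow>
        q T (barycenter S) = q T' (barycenter S))}"

definition cr_basis ::
    "(real^'n) set \<Rightarrow> (real^'n) set set \<Rightarrow> (real^'n) set \<Rightarrow> (real^'n) set \<Rightarrow> real^'n \<Rightarrow> real" where
  "cr_basis \<Omega> \<T> S = (SOME \<phi>. \<phi> \<in> CR \<Omega> \<T> \<and>
     (\<forall>T \<in> \<T>. \<forall>S'. S' facet_of T \<longrightarrow> \<phi> T (barycenter S') = (if S' = S then 1 else 0)))"

definition cr_interp ::
    "(real^'n) set \<Rightarrow> (real^'n) set set \<Rightarrow> (real^'n \<Rightarrow> real) \<Rightarrow> (real^'n) set \<Rightarrow> real^'n \<Rightarrow> real" where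
  "cr_interp \<Omega> \<T> q T x = (\<Sum>S \<in> facets \<T>. facet_mean S (facet_trace \<Omega> S q) * cr_basis \<Omega> \<T> S T x)"

text \<open>Boundary values of a piecewise function, read off the element adjacent to a boundary
  facet; that element is unique.\<close>
definition bd_value :: "'a::euclidean_space set set \<Rightarrow> ('a set \<Rightarrow> 'a \<Rightarrow> 'b) \<Rightarrow> 'a set \<Rightarrow> 'a \<Rightarrow> 'b" where
  "bd_value \<T> w S = w (SOME T. T \<in> \<T> \<and> S facet_of T)"

definition normal_trace ::
    "'a::euclidean_space set \<Rightarrow> 'a set set \<Rightarrow> ('a set \<Rightarrow> 'a \<Rightarrow> 'a) \<Rightarrow> 'a set \<Rightarrow> 'a \<Rightarrow> real" where
  "normal_trace \<Omega> \<T> v S x = bd_value \<T> v S x \<bullet> outward_normal \<Omega> x"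

definition bd_inner ::
    "'a::euclidean_space set set \<Rightarrow> ('a set \<Rightarrow> 'a \<Rightarrow> real) \<Rightarrow> ('a set \<Rightarrow> 'a \<Rightarrow> real) \<Rightarrow> real" where
  "bd_inner \<S> g h = (\<Sum>S \<in> \<S>. LINT x|facet_measure S. g S x * h S x)"


section \<open>The discrete primal problem\<close>

text \<open>The positive semidefinite square root.\<close>
definition mat_sqrt :: "real^'n^'n \<Rightarrow> real^'n^'n" where
  "mat_sqrt A = (SOME R. transpose R = R \<and> (\<forall>\<xi>. 0 \<le> \<xi> \<bullet> (R *v \<xi>)) \<and> R ** R = A)"

definition pos_part :: "real \<Rightarrow> real" where "pos_part r = max 0 r"
definition neg_part :: "real \<Rightarrow> real" where "neg_part r = max 0 (- r)"

definition K_adm ::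
    "(real^'n) set \<Rightarrow> (real^'n) set set \<Rightarrow> (real^'n) set \<Rightarrow> ((real^'n) set \<Rightarrow> real^'n \<Rightarrow> real) \<Rightarrow>
     ((real^'n) set \<Rightarrow> real^'n \<Rightarrow> real) set" where
  "K_adm \<Omega> \<T> \<Gamma>D pDh = {q \<in> CR \<Omega> \<T>. \<forall>S \<in> facets_on \<Omega> \<T> \<Gamma>D.
     bd_value \<T> q S (barycenter S) = bd_value \<T> pDh S (barycenter S)}"

definition I_cr ::
    "(real^'n) set \<Rightarrow> (real^'n) set set \<Rightarrow> (real^'n) set \<Rightarrow> ((real^'n) set \<Rightarrow> real^'n^'n) \<Rightarrow>
     ((real^'n) set \<Rightarrow> real) \<Rightarrow> ((real^'n) set \<Rightarrow> real) \<Rightarrow> ((real^'n) set \<Rightarrow> real) \<Rightarrow>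
     ((real^'n) set \<Rightarrow> real^'n \<Rightarrow> real) \<Rightarrow> real" where
  "I_cr \<Omega> \<T> \<Gamma>C Kh fh \<alpha>h \<beta>h q =
     1/2 * (L2_norm \<Omega> (glue \<T> (\<lambda>T x. mat_sqrt (Kh T) *v grad (q T) x)))\<^sup>2
     - L2_inner \<Omega> (glue0 \<T> fh) (glue0 \<T> (\<lambda>T. elem_mean T (q T)))
     + bd_inner (facets_on \<Omega> \<T> \<Gamma>C) (\<lambda>S x. \<beta>h S)
         (\<lambda>S x. pos_part (facet_mean S (bd_value \<T> q S)))
     - bd_inner (facets_on \<Omega> \<T> \<Gamma>C) (\<lambda>S x. \<alpha>h S)
         (\<lambda>S x. neg_part (facet_mean S (bd_value \<T> q S)))"

end

theory Submission
  imports Defs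
begin

text \<open>
  The reconstructed function has elementwise gradient \<open>- w\<close>, where \<open>w\<close> is the
  elementwise constant \<open>K\<^sup>-\<^sup>1 u\<close>, and elementwise mean \<open>p\<close>. Integration by parts on a single element
  between a Raviart-Thomas field \<open>v\<close>, whose normal component is constant on each facet, and an affine
  function \<open>q\<close> leaves only products of fluxes through the facets and values of \<open>q\<close> at their barycenters.
  Inserting the reconstruction for \<open>q\<close>, the flux equation therefore says: the sum over all facets and
  adjacent elements of flux of \<open>v\<close> times barycenter value equals the boundary terms
  (\<open>flux_balance\<close>). The field that carries a unit flux from one element through a single interior
  facet into a neighbour shows that the two barycenter values agree, so the reconstruction is a
  Crouzeix-Raviart function; the shape functions of boundary facets show that its boundary values are
  the prescribed ones on the Dirichlet facets and the differences of the multipliers on the contact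
  facets.

  Minimality is convexity. For an admissible \<open>q\<close> with difference \<open>e\<close> to the reconstruction, the
  quadratic part of the energy grows at least by its linearisation, minus the elementwise integral
  of \<open>u \<bullet> grad e\<close>. Integration by parts (\<open>discrete_parts\<close>) rewrites this with the divergence of \<open>u\<close>,
  which is the source term, and the boundary fluxes of \<open>u\<close>; on interior facets the fluxes of \<open>u\<close>
  cancel while \<open>e\<close> is single-valued, and on Dirichlet facets \<open>e\<close> vanishes. What remains on a contact
  facet is nonnegative because complementarity makes the flux a subgradient of the contact energy
  (\<open>contact_subgradient\<close>).

  The analysis behind this is a concrete divergence theorem. The facet measure is defined by prisms of
  height one, so translation invariance of the Lebesgue measure yields Fubini's theorem for layers
  parallel to a facet (\<open>nn_integral_slices\<close>), and with scaling the divergence theorem on a cone for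
  the field \<open>\<lambda>x. x - z\<close> with \<open>z\<close> the apex (\<open>cone_divergence\<close>). Such fields span the Raviart-Thomas
  fields of an element; applied to barycentric coordinates, the same identity gives all centroids.
  Together with smooth bumps and the fundamental lemma of the calculus of variations it shows that a
  piecewise Raviart-Thomas field has square integrable divergence if and only if its fluxes cancel on
  every interior facet (\<open>RT0I\<close>, \<open>RT0_jump\<close>), the weak divergence then being the elementwise one
  (\<open>weak_div_AE\<close>). On the boundary, the Lipschitz condition excludes cracks, so a boundary facet has a
  unique adjacent element whose outer normal is the outward normal of the domain.
\<close>

section \<open>Gradients and smooth bump functions\<close>

lemma GDERIV_unique: "GDERIV f x :> D \<Longrightarrow> GDERIV f x :> E \<Longrightarrow> D = E"
  unfolding gderiv_def
proof -
  assume "(f has_derivative (\<lambda>h. h \<bullet> D)) (at x)" "(f has_derivative (\<lambda>h. h \<bullet> E)) (at x)"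
  then have "(\<lambda>h. h \<bullet> D) = (\<lambda>h. h \<bullet> E)" by (rule has_derivative_unique)
  then have "(D - E) \<bullet> D = (D - E) \<bullet> E" by (rule fun_cong)
  then have "(D - E) \<bullet> (D - E) = 0" by (simp add: inner_diff_right)
  then show "D = E" by simp
qed

lemma grad_eqI: "GDERIV f x :> D \<Longrightarrow> grad f x = D"
  unfolding grad_def by (rule the_equality) (auto intro: GDERIV_unique)

lemma grad_transform:
  assumes "GDERIV f x :> D" "open U" "x \<in> U" "\<And>y. y \<in> U \<Longrightarrow> g y = f y"
  shows "grad g x = D"
proof -
  have "GDERIV g x :> D"
    using assms has_derivative_transform_within_open[of f "\<lambda>h. h \<bullet> D" x UNIV U g]
    unfolding gderiv_def by auto
  then show ?thesis by (rule grad_eqI)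
qed

text \<open>A linear functional is the inner product with the value of its adjoint at \<open>1\<close>.\<close>
lemma differentiable_GDERIV:
  assumes "f differentiable (at (x::real^'n))"
  shows "GDERIV f x :> grad f x"
proof -
  obtain f' where f': "(f has_derivative f') (at x)" using assms differentiable_def by blast
  then have lin: "linear f'" using has_derivative_linear by blast
  have "f' h = h \<bullet> adjoint f' 1" for h
    using adjoint_works[OF lin, of h 1] by simp
  then have "f' = (\<lambda>h. h \<bullet> adjoint f' 1)" by (rule ext)
  then have "GDERIV f x :> adjoint f' 1" using f' unfolding gderiv_def by simp
  then show ?thesis using grad_eqI by metis
qed

text \<open>The functions \<open>s ^ - m * exp (- 1 / s)\<close>, extended by zero to \<open>s \<le> 0\<close>. The span of this
  family is closed under differentiation, which makes smoothness of compositions an induction.\<close>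
definition eta :: "nat \<Rightarrow> real \<Rightarrow> real" where
  "eta m s = (if s \<le> 0 then 0 else exp (- inverse s) * inverse s ^ m)"

lemma eta_tendsto_0: "(eta m \<longlongrightarrow> 0) (at 0)"
proof -
  have "((\<lambda>y::real. y ^ m / exp y) \<longlongrightarrow> 0) at_top" by (rule tendsto_power_div_exp_0)
  then have "((\<lambda>s::real. inverse s ^ m / exp (inverse s)) \<longlongrightarrow> 0) (at_right 0)"
    using filterlim_inverse_at_top_right by (rule filterlim_compose)
  moreover have "eventually (\<lambda>s::real. inverse s ^ m / exp (inverse s) = eta m s) (at_right 0)"
    by (auto simp: eventually_at_filter eta_def exp_minus field_simps)
  ultimately have r: "(eta m \<longlongrightarrow> 0) (at_right 0)" by (rule Lim_transform_eventually)
  have "eventually (\<lambda>s::real. 0 = eta m s) (at_left 0)"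
    by (auto simp: eventually_at_filter eta_def)
  then have l: "(eta m \<longlongrightarrow> 0) (at_left 0)"
    by (rule Lim_transform_eventually[OF tendsto_const])
  show ?thesis using l r by (simp add: filterlim_split_at)
qed

lemma eta_deriv: "DERIV (eta m) s :> eta (m + 2) s - real m * eta (Suc m) s"
proof -
  consider "s < 0" | "s = 0" | "s > 0" by linarith
  then show ?thesis
  proof cases
    case 1
    have "DERIV (\<lambda>_. 0::real) s :> 0" by simp
    then have "DERIV (eta m) s :> 0"
      by (rule DERIV_cong_ev[THEN iffD1, rotated -1])
         (use 1 in \<open>auto simp: eta_def intro!: eventually_mono[OF eventually_nhds_in_open[of "{..<0}"]]\<close>)
    then show ?thesis using 1 by (simp add: eta_def)
  next
    case 2
    have "((\<lambda>h. (eta m (0 + h) - eta m 0) / h) \<longlongrightarrow> 0) (at 0)"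
      by (rule Lim_transform_eventually[OF eta_tendsto_0[of "Suc m"]])
         (auto simp: eventually_at_filter eta_def field_simps)
    then have "DERIV (eta m) 0 :> 0" unfolding DERIV_def .
    then show ?thesis using 2 by (simp add: eta_def)
  next
    case 3
    have "DERIV (\<lambda>s. exp (- inverse s) * inverse s ^ m) s :>
        eta (m + 2) s - real m * eta (Suc m) s"
      using 3
      by (auto intro!: derivative_eq_intros simp: eta_def power2_eq_square)
         (cases m; simp add: algebra_simps power2_eq_square)
    then show ?thesis
      by (rule DERIV_cong_ev[THEN iffD1, rotated -1])
         (use 3 in \<open>auto simp: eta_def intro!: eventually_mono[OF eventually_nhds_in_open[of "{0<..}"]]\<close>)
  qed
qed

text \<open>Smoothness asks for all iterated partial derivatives. This class contains the bump functions
  used below and the partial derivatives of each of its members, so its members are smooth.\<close>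
inductive elem_smooth :: "(real^'n \<Rightarrow> real) \<Rightarrow> bool" where
  const: "elem_smooth (\<lambda>x. c)"
| coord: "elem_smooth (\<lambda>x. x $ i)"
| add: "elem_smooth f \<Longrightarrow> elem_smooth g \<Longrightarrow> elem_smooth (\<lambda>x. f x + g x)"
| mult: "elem_smooth f \<Longrightarrow> elem_smooth g \<Longrightarrow> elem_smooth (\<lambda>x. f x * g x)"
| eta: "elem_smooth f \<Longrightarrow> elem_smooth (\<lambda>x. eta m (f x))"

lemma elem_smooth_grad:
  "elem_smooth f \<Longrightarrow> \<exists>G. (\<forall>x. GDERIV f x :> G x) \<and> (\<forall>i. elem_smooth (\<lambda>x. G x $ i))"
proof (induction rule: elem_smooth.induct)
  case (const c)
  show ?case by (intro exI[of _ "\<lambda>_. 0"]) (auto intro: GDERIV_const elem_smooth.const)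
next
  case (coord i)
  have "GDERIV (\<lambda>x. x $ i :: real) x :> axis i 1" for x
    unfolding gderiv_def inner_axis
    using bounded_linear_imp_has_derivative[OF bounded_linear_vec_nth] by simp
  then show ?case
    by (intro exI[of _ "\<lambda>_. axis i 1"]) (auto simp: axis_def intro: elem_smooth.const)
next
  case (add f g)
  then obtain F G where "\<forall>x. GDERIV f x :> F x" "\<forall>i. elem_smooth (\<lambda>x. F x $ i)"
    "\<forall>x. GDERIV g x :> G x" "\<forall>i. elem_smooth (\<lambda>x. G x $ i)" by blast
  then show ?case
    by (intro exI[of _ "\<lambda>x. F x + G x"]) (auto intro: GDERIV_add elem_smooth.add)
next
  case (mult f g)
  then obtain F G where "\<forall>x. GDERIV f x :> F x" "\<forall>i. elem_smooth (\<lambda>x. F x $ i)"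
    "\<forall>x. GDERIV g x :> G x" "\<forall>i. elem_smooth (\<lambda>x. G x $ i)" by blast
  then show ?case using mult.hyps
    by (intro exI[of _ "\<lambda>x. f x *\<^sub>R G x + g x *\<^sub>R F x"])
       (auto intro!: GDERIV_mult elem_smooth.add elem_smooth.mult)
next
  case (eta f m)
  then obtain F where F: "\<forall>x. GDERIV f x :> F x" "\<forall>i. elem_smooth (\<lambda>x. F x $ i)" by blast
  have "elem_smooth (\<lambda>x. (eta (m + 2) (f x) + (- real m) * eta (Suc m) (f x)) * F x $ i)" for i
    using eta.hyps F by (intro elem_smooth.intros) auto
  moreover have "GDERIV (\<lambda>x. eta m (f x)) x :>
      (eta (m + 2) (f x) - real m * eta (Suc m) (f x)) *\<^sub>R F x" for x
    using F(1) by (intro GDERIV_DERIV_compose eta_deriv) blast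
  ultimately show ?case
    by (intro exI[of _ "\<lambda>x. (eta (m + 2) (f x) - real m * eta (Suc m) (f x)) *\<^sub>R F x"])
       (simp add: algebra_simps)
qed

lemma elem_smooth_C_k: "elem_smooth f \<Longrightarrow> C_k k f"
proof (induction k arbitrary: f)
  case 0
  then obtain G where "\<forall>x. GDERIV f x :> G x" using elem_smooth_grad by blast
  then show ?case
    by (auto simp: continuous_on_eq_continuous_at gderiv_def intro: has_derivative_continuous)
next
  case (Suc k)
  then obtain G where G: "\<forall>x. GDERIV f x :> G x" "\<forall>i. elem_smooth (\<lambda>x. G x $ i)"
    using elem_smooth_grad by blast
  then have "grad f = G" using grad_eqI by blast
  then show ?case using G Suc.IH by (auto simp: gderiv_def differentiable_def)
qed

lemma elem_smooth_prod: "finite I \<Longrightarrow> (\<And>i. i \<in> I \<Longrightarrow> elem_smooth (f i)) \<Longrightarrow> elem_smooth (\<lambda>x. \<Prod>i\<in>I. f i x)"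
  by (induction I rule: finite_induct) (auto intro: elem_smooth.intros)

lemma smooth_GDERIV:
  assumes "smooth \<phi>"
  shows "GDERIV \<phi> x :> grad \<phi> x" and "continuous_on UNIV (grad \<phi>)" and "continuous_on UNIV \<phi>"
proof -
  have "C_k (Suc 0) \<phi>" using assms unfolding smooth_def by blast
  then have d: "\<forall>x. \<phi> differentiable (at x)" and c: "\<And>i. continuous_on UNIV (\<lambda>x. grad \<phi> x $ i)"
    by simp_all
  show "GDERIV \<phi> x :> grad \<phi> x" using d differentiable_GDERIV by blast
  have "continuous_on UNIV (\<lambda>x. \<chi> i. grad \<phi> x $ i)" by (intro continuous_on_vec_lambda c)
  then show "continuous_on UNIV (grad \<phi>)" by simp
  show "continuous_on UNIV \<phi>"
    using d by (simp add: continuous_on_eq_continuous_at differentiable_imp_continuous_within)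
qed

text \<open>Smooth approximations from below of the indicator function of a box: for positive \<open>s\<close>,
  \<open>exp (- 1 / (k s))\<close> tends to one, and the product of the coordinate distances to the two
  faces is positive exactly inside the box.\<close>
definition box_bump :: "real^'n \<Rightarrow> real^'n \<Rightarrow> nat \<Rightarrow> real^'n \<Rightarrow> real" where
  "box_bump a b k x = (\<Prod>i\<in>UNIV. eta 0 (real (Suc k) * ((x $ i - a $ i) * (b $ i - x $ i))))"

lemma smooth_box_bump: "smooth (box_bump a b k)"
proof -
  have "elem_smooth (\<lambda>x. \<Prod>i\<in>UNIV. eta 0 (real (Suc k) * ((x $ i + (- a $ i)) * (b $ i + (- 1) * x $ i))))"
    by (intro elem_smooth_prod elem_smooth.intros) auto
  then have "elem_smooth (box_bump a b k)" unfolding box_bump_def by simp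
  then show ?thesis using elem_smooth_C_k smooth_def by blast
qed

lemma eta_bounds: "0 \<le> eta 0 s" "eta 0 s \<le> 1"
  by (auto simp: eta_def)

lemma box_bump_bounds: "0 \<le> box_bump a b k x" "box_bump a b k x \<le> 1"
  unfolding box_bump_def by (auto intro: prod_nonneg prod_le_1 eta_bounds)

lemma box_bump_pos: "x \<in> box a b \<Longrightarrow> 0 < box_bump a b k x"
  unfolding box_bump_def by (intro prod_pos) (simp add: eta_def mem_box_cart not_le)

lemma box_bump_zero:
  assumes "x \<notin> box a b" shows "box_bump a b k x = 0 \<or> box a b = {}"
proof (cases "box a b = {}")
  case False
  then have ab: "a $ i < b $ i" for i by (metis interval_eq_empty_cart(1) not_less)
  obtain i where "x $ i \<le> a $ i \<or> b $ i \<le> x $ i" using assms by (auto simp: mem_box_cart not_less)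
  then have "(x $ i - a $ i) * (b $ i - x $ i) \<le> 0"
    using ab[of i] by (auto simp: mult_le_0_iff)
  then have "real (Suc k) * ((x $ i - a $ i) * (b $ i - x $ i)) \<le> 0"
    by (simp add: mult_nonneg_nonpos)
  then have "eta 0 (real (Suc k) * ((x $ i - a $ i) * (b $ i - x $ i))) = 0"
    unfolding eta_def by simp
  then show ?thesis unfolding box_bump_def by (auto intro!: prod_zero)
qed auto

lemma box_bump_tendsto:
  assumes "box a b \<noteq> {}"
  shows "(\<lambda>k. box_bump a b k x) \<longlonglongrightarrow> indicator (box a b) x"
proof (cases "x \<in> box a b")
  case True
  have "(\<lambda>k. eta 0 (real (Suc k) * s)) \<longlonglongrightarrow> 1" if "0 < s" for s
  proof -
    have "(\<lambda>k. exp (- (inverse (real (Suc k)) * inverse s))) \<longlonglongrightarrow> exp (- (0 * inverse s))"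
      by (intro tendsto_intros LIMSEQ_inverse_real_of_nat)
    moreover have "eta 0 (real (Suc k) * s) = exp (- (inverse (real (Suc k)) * inverse s))" for k
      using that by (auto simp: eta_def mult_le_0_iff)
    ultimately show ?thesis by simp
  qed
  then have "(\<lambda>k. box_bump a b k x) \<longlonglongrightarrow> (\<Prod>i\<in>(UNIV::'a set). 1)"
    unfolding box_bump_def using True by (intro tendsto_prod) (auto simp: mem_box_cart)
  then show ?thesis using True by simp
next
  case False
  then show ?thesis using box_bump_zero[OF False] assms by simp
qed

lemma box_bump_test_fun:
  assumes "cbox a b \<subseteq> U" "box a b \<noteq> {}"
  shows "test_fun U (box_bump a b k)"
proof -
  have "{x. box_bump a b k x \<noteq> 0} \<subseteq> box a b" using box_bump_zero assms(2) by blast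
  then have "closure {x. box_bump a b k x \<noteq> 0} \<subseteq> cbox a b"
    by (meson box_subset_cbox closed_cbox closure_minimal order_trans)
  moreover then have "compact (closure {x. box_bump a b k x \<noteq> 0})"
    using bounded_subset[OF bounded_cbox] by (simp add: compact_eq_bounded_closed)
  ultimately show ?thesis unfolding test_fun_def
    using smooth_box_bump assms(1) by blast
qed

section \<open>The fundamental lemma of the calculus of variations\<close>

text \<open>The positive and the negative part of \<open>g\<close> are densities of two finite measures. These agree on
  the closed boxes in \<open>U\<close> and, both being zero there, on the Borel sets disjoint from \<open>U\<close>; the two
  kinds of sets form an intersection-stable generator of the Borel sets.\<close>
lemma cbox_integral_zero_imp_AE_zero:
  fixes g :: "'a::euclidean_space \<Rightarrow> real"
  assumes U: "open U" and g: "integrable lborel g" and out: "\<And>x. x \<notin> U \<Longrightarrow> g x = 0"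
    and zero: "\<And>a b. cbox a b \<subseteq> U \<Longrightarrow> (LINT x|lborel. indicator (cbox a b) x * g x) = 0"
  shows "AE x in lborel. g x = 0"
proof -
  define E where "E = {cbox a b |a b. cbox a b \<subseteq> U} \<union> {A. A \<in> sets borel \<and> A \<inter> U = {}}"
  define M where "M = density lborel (\<lambda>x. ennreal (g x))"
  define N where "N = density lborel (\<lambda>x. ennreal (- g x))"
  have [measurable]: "g \<in> borel_measurable borel" using g by auto
  have "Int_stable E"
  proof (rule Int_stableI)
    fix A B assume AB: "A \<in> E" "B \<in> E"
    show "A \<inter> B \<in> E"
    proof (cases "A \<inter> U = {} \<or> B \<inter> U = {}")
      case True
      moreover have "A \<in> sets borel" "B \<in> sets borel" using AB unfolding E_def by auto
      ultimately show ?thesis unfolding E_def by blast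
    next
      case False
      then obtain a b c d where "A = cbox a b" "B = cbox c d" "cbox a b \<subseteq> U"
        using AB unfolding E_def by auto
      moreover obtain p q where "cbox a b \<inter> cbox c d = cbox p q" using Int_interval by blast
      moreover have "cbox a b \<inter> cbox c d \<subseteq> U" using \<open>cbox a b \<subseteq> U\<close> by blast
      ultimately show ?thesis unfolding E_def by blast
    qed
  qed
  moreover have sets: "sigma_sets UNIV E = sets (borel::'a measure)"
  proof -
    have "sigma_sets UNIV {S::'a set. open S} = sigma_sets UNIV E"
    proof (rule sigma_sets_eqI)
      fix S :: "'a set" assume "S \<in> {S. open S}"
      then have S: "open S" by simp
      then have "open (S \<inter> U)" using U by blast
      then obtain D where D: "countable D" "D \<subseteq> Pow (S \<inter> U)" "\<And>X. X \<in> D \<Longrightarrow> \<exists>a b. X = cbox a b" "\<Union>D = S \<inter> U"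
        using open_countable_Union_open_cbox by metis
      have "D \<subseteq> E"
      proof
        fix X assume X: "X \<in> D"
        obtain a b where "X = cbox a b" using D(3) X by blast
        moreover have "X \<subseteq> U" using D(2) X by auto
        ultimately show "X \<in> E" unfolding E_def by auto
      qed
      then have "S \<inter> U \<in> sigma_sets UNIV E"
        unfolding D(4)[symmetric] by (intro sigma_sets_UNION[OF D(1)]) (auto intro: sigma_sets.Basic)
      moreover have "S - U \<in> E" unfolding E_def using S U by auto
      ultimately have "(S \<inter> U) \<union> (S - U) \<in> sigma_sets UNIV E"
        by (intro sigma_sets_Un) (auto intro: sigma_sets.Basic)
      then show "S \<in> sigma_sets UNIV E" by (simp add: Int_Diff_Un)
    next
      fix A assume "A \<in> E"
      then have "A \<in> sets borel" unfolding E_def by auto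
      then show "A \<in> sigma_sets UNIV {S. open S}" unfolding borel_def by simp
    qed
    then show ?thesis unfolding borel_def by simp
  qed
  moreover obtain D where D: "countable D" "D \<subseteq> Pow U" "\<And>X. X \<in> D \<Longrightarrow> \<exists>a b. X = cbox a b" "\<Union>D = U"
    using open_countable_Union_open_cbox[OF U] by metis
  have "insert (- U) D \<subseteq> E"
  proof
    fix X assume X: "X \<in> insert (- U) D"
    show "X \<in> E"
    proof (cases "X = - U")
      case True then show ?thesis using U by (auto simp: E_def)
    next
      case False
      then obtain a b where "X = cbox a b" "X \<subseteq> U" using D X by blast
      then show ?thesis unfolding E_def by auto
    qed
  qed
  moreover have fin: "emeasure M X \<noteq> \<infinity>" for X
  proof -
    have "emeasure M X \<le> emeasure M (space M)" by (rule emeasure_space)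
    also have "\<dots> = (\<integral>\<^sup>+x. ennreal (g x) \<partial>lborel)" by (simp add: M_def emeasure_density)
    also have "\<dots> < \<infinity>"
    proof -
      have "(\<integral>\<^sup>+x. ennreal (g x) \<partial>lborel) \<le> (\<integral>\<^sup>+x. ennreal (norm (g x)) \<partial>lborel)"
        by (intro nn_integral_mono) (auto intro: ennreal_leI)
      also have "\<dots> < \<infinity>" using g by (simp add: integrable_iff_bounded)
      finally show ?thesis .
    qed
    finally show ?thesis by simp
  qed
  moreover have "emeasure M X = emeasure N X" if XE: "X \<in> E" for X
  proof (cases "X \<inter> U = {}")
    case True
    have [measurable]: "X \<in> sets borel" using XE unfolding E_def by auto
    have "ennreal (g x) * indicator X x = 0" "ennreal (- g x) * indicator X x = 0" for x
    proof -
      have "x \<in> X \<Longrightarrow> g x = 0" using True out by blast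
      then show "ennreal (g x) * indicator X x = 0" "ennreal (- g x) * indicator X x = 0"
        by (auto simp: indicator_def)
    qed
    then show ?thesis unfolding M_def N_def by (subst (1 2) emeasure_density) (auto simp del: mult_eq_0_iff)
  next
    case False
    then obtain a b where X: "X = cbox a b" "cbox a b \<subseteq> U" using XE unfolding E_def by blast
    let ?P = "\<lambda>x. max 0 (indicator X x * g x)" and ?N = "\<lambda>x. max 0 (- (indicator X x * g x))"
    have i: "integrable lborel (\<lambda>x. indicator X x * g x)"
      using integrable_real_mult_indicator[of X lborel g] g X by (simp add: mult.commute)
    have iP: "integrable lborel ?P" and iN: "integrable lborel ?N" using i by (auto intro!: integrable_max)
    have "(LINT x|lborel. ?P x) - (LINT x|lborel. ?N x) = (LINT x|lborel. indicator X x * g x)"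
      unfolding Bochner_Integration.integral_diff[OF iP iN, symmetric]
      by (intro Bochner_Integration.integral_cong) auto
    also have "\<dots> = 0" using zero X by simp
    finally have eq: "(LINT x|lborel. ?P x) = (LINT x|lborel. ?N x)" by simp
    have "emeasure M X = (\<integral>\<^sup>+x. ennreal (?P x) \<partial>lborel)"
      unfolding M_def using X by (subst emeasure_density) (auto intro!: nn_integral_cong simp: indicator_def max_def ennreal_neg)
    also have "\<dots> = ennreal (LINT x|lborel. ?P x)" using iP by (intro nn_integral_eq_integral) auto
    also have "\<dots> = (\<integral>\<^sup>+x. ennreal (?N x) \<partial>lborel)"
      unfolding eq using iN by (intro nn_integral_eq_integral[symmetric]) auto
    also have "\<dots> = emeasure N X"
      unfolding N_def using X by (subst emeasure_density) (auto intro!: nn_integral_cong simp: indicator_def max_def ennreal_neg)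
    finally show ?thesis .
  qed
  ultimately have "M = N"
    using D by (intro measure_eqI_generator_eq_countable[where E=E and \<Omega>=UNIV and A="insert (- U) D"])
       (auto simp: M_def N_def)
  then have "AE x in lborel. ennreal (g x) = ennreal (- g x)"
    unfolding M_def N_def by (subst (asm) sigma_finite_measure.density_unique_iff[OF sigma_finite_lborel]) auto
  moreover have "g x = 0" if "ennreal (g x) = ennreal (- g x)" for x
    using that by (cases "0 \<le> g x") (auto simp: ennreal_neg ennreal_eq_0_iff dest: sym)
  ultimately show ?thesis by (auto elim: eventually_mono)
qed

text \<open>Testing with the approximate indicators of boxes shows that the integral over every closed
  box in \<open>U\<close> vanishes.\<close>
lemma fundamental_lemma:
  fixes g :: "real^'n \<Rightarrow> real"
  assumes U: "open U" and g: "integrable (lebesgue_on U) g"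
    and test: "\<And>\<phi>. test_fun U \<phi> \<Longrightarrow> (LINT x|lebesgue_on U. g x * \<phi> x) = 0"
  shows "AE x in lebesgue_on U. g x = 0"
proof -
  have U': "U \<inter> space lebesgue \<in> sets lebesgue" "U \<in> sets lborel" using U by auto
  have i1: "integrable lebesgue (\<lambda>x. indicator U x *\<^sub>R g x)"
    using g integrable_restrict_space[OF U'(1), of g] by simp
  (* A Borel representative of g, extended by zero, makes lborel available. *)
  then have "(\<lambda>x. indicator U x *\<^sub>R g x) \<in> borel_measurable (completion lborel)" by auto
  then obtain h0 where h0: "h0 \<in> borel_measurable lborel" "AE x in lborel. indicator U x *\<^sub>R g x = h0 x"
    using completion_ex_borel_measurable_real by blast
  define h where "h x = indicator U x * h0 x" for x
  have hm [measurable]: "h \<in> borel_measurable borel" unfolding h_def using h0(1) U by auto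
  have eq: "AE x in lebesgue. indicator U x *\<^sub>R g x = h x"
    using AE_completion[OF h0(2)] by eventually_elim (auto simp: h_def indicator_def split: if_splits)
  have "integrable lebesgue h"
    using i1 integrable_cong_AE[of "\<lambda>x. indicator U x *\<^sub>R g x" lebesgue h] eq hm
    by (auto simp: measurable_completion)
  then have hi: "integrable lborel h" using hm by (simp add: integrable_completion)
  have test': "(LINT x|lborel. h x * \<phi> x) = 0" if \<phi>: "test_fun U \<phi>" for \<phi>
  proof -
    have [measurable]: "\<phi> \<in> borel_measurable borel"
      using \<phi> smooth_GDERIV(3) by (auto simp: test_fun_def intro: borel_measurable_continuous_onI)
    have "0 = (LINT x|lebesgue_on U. g x * \<phi> x)" using test[OF \<phi>] by simp
    also have "\<dots> = (LINT x|lebesgue. indicator U x *\<^sub>R (g x * \<phi> x))"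
      using U' by (subst integral_restrict_space) auto
    also have "\<dots> = (LINT x|lebesgue. h x * \<phi> x)"
    proof (rule integral_cong_AE)
      have "(\<lambda>x. (indicator U x *\<^sub>R g x) * \<phi> x) \<in> borel_measurable lebesgue"
        using i1 by (intro borel_measurable_times) (auto intro!: measurable_completion)
      then show "(\<lambda>x. indicator U x *\<^sub>R (g x * \<phi> x)) \<in> borel_measurable lebesgue" by (simp add: mult.assoc)
      show "(\<lambda>x. h x * \<phi> x) \<in> borel_measurable lebesgue" by (intro measurable_completion) auto
      show "AE x in lebesgue. indicator U x *\<^sub>R (g x * \<phi> x) = h x * \<phi> x"
        using eq by eventually_elim (auto simp: indicator_def split: if_splits)
    qed
    also have "\<dots> = (LINT x|lborel. h x * \<phi> x)" by (rule integral_completion) auto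
    finally show ?thesis by simp
  qed
  have "(LINT x|lborel. indicator (cbox a b) x * h x) = 0" if ab: "cbox a b \<subseteq> U" for a b
  proof (cases "box a b = {}")
    case True
    then have "negligible (cbox a b)" using negligible_interval(1) by blast
    then have "cbox a b \<in> null_sets lborel"
      by (auto simp: negligible_iff_null_sets null_sets_completion_iff)
    then have "AE x in lborel. indicator (cbox a b) x * h x = 0"
      by (auto simp: AE_iff_null_sets[symmetric] indicator_def dest: AE_not_in elim!: eventually_mono)
    then show ?thesis by (rule integral_eq_zero_AE)
  next
    case False
    have "(\<lambda>k. LINT x|lborel. h x * box_bump a b k x) \<longlonglongrightarrow> (LINT x|lborel. h x * indicator (box a b) x)"
    proof (rule integral_dominated_convergence[where w="\<lambda>x. norm (h x)"])
      show "AE x in lborel. (\<lambda>k. h x * box_bump a b k x) \<longlonglongrightarrow> h x * indicator (box a b) x"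
        by (auto intro!: tendsto_intros box_bump_tendsto False)
      show "AE x in lborel. norm (h x * box_bump a b k x) \<le> norm (h x)" for k
        by (auto simp: abs_mult box_bump_bounds intro!: mult_left_le)
      show "(\<lambda>x. h x * box_bump a b k x) \<in> borel_measurable lborel" for k
        using borel_measurable_continuous_onI[OF smooth_GDERIV(3)[OF smooth_box_bump[of a b k]]] hm
        by (auto intro!: borel_measurable_times)
    qed (use hi in auto)
    then have "(LINT x|lborel. h x * indicator (box a b) x) = 0"
      using test'[OF box_bump_test_fun[OF ab False]] by (simp add: LIMSEQ_const_iff)
    moreover have "(LINT x|lborel. indicator (cbox a b) x * h x) = (LINT x|lborel. h x * indicator (box a b) x)"
    proof (rule integral_cong_AE)
      have "negligible (cbox a b - box a b)" by (rule negligible_frontier_interval)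
      then have "cbox a b - box a b \<in> null_sets lborel"
        by (auto simp: negligible_iff_null_sets null_sets_completion_iff)
      then have "AE x in lborel. x \<notin> cbox a b - box a b" by (rule AE_not_in)
      then show "AE x in lborel. indicator (cbox a b) x * h x = h x * indicator (box a b) x"
        by eventually_elim (use box_subset_cbox[of a b] in \<open>auto simp: indicator_def\<close>)
    qed auto
    ultimately show ?thesis by simp
  qed
  then have "AE x in lborel. h x = 0"
    by (intro cbox_integral_zero_imp_AE_zero[OF U hi]) (auto simp: h_def)
  then have "AE x in lebesgue. h x = 0" by (rule AE_completion)
  then have "AE x in lebesgue. x \<in> U \<longrightarrow> g x = 0"
    using eq by eventually_elim (auto simp: indicator_def split: if_splits)
  then show ?thesis using U'(1) by (simp add: AE_restrict_space_iff)
qed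

section \<open>Full-dimensional simplices and their facets\<close>

abbreviation vol :: "'a::euclidean_space set \<Rightarrow> real" where
  "vol \<equiv> measure lebesgue"

definition verts :: "'a::euclidean_space set \<Rightarrow> 'a set" where
  "verts T = {v. v extreme_point_of T}"

text \<open>The gradient of the barycentric coordinate of the vertex \<open>v\<close>. In a full-dimensional simplex it is
  determined by the drop from one at \<open>v\<close> to zero at the other vertices.\<close>
definition bgrad :: "'a::euclidean_space set \<Rightarrow> 'a \<Rightarrow> 'a" where
  "bgrad T v = (SOME g. \<forall>w \<in> verts T - {v}. g \<bullet> (w - v) = - 1)"

definition bcoord :: "'a::euclidean_space set \<Rightarrow> 'a \<Rightarrow> 'a \<Rightarrow> real" where
  "bcoord T v y = 1 + bgrad T v \<bullet> (y - v)"

definition opp :: "'a::euclidean_space set \<Rightarrow> 'a set \<Rightarrow> 'a" where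
  "opp T S = (SOME v. v \<in> verts T \<and> S = convex hull (verts T - {v}))"

text \<open>The gradient of the coordinate of the opposite vertex is orthogonal to the facet, points into the
  simplex, and its norm is the reciprocal of the distance between vertex and facet.\<close>
definition outer_normal :: "'a::euclidean_space set \<Rightarrow> 'a set \<Rightarrow> 'a" where
  "outer_normal T S = - sgn (bgrad T (opp T S))"

definition height :: "'a::euclidean_space set \<Rightarrow> 'a set \<Rightarrow> real" where
  "height T S = 1 / norm (bgrad T (opp T S))"

lemma continuous_on_bcoord: "continuous_on A (bcoord T v)"
  unfolding bcoord_def by (intro continuous_intros)

lemma bcoord_shift: "bcoord T v y = bcoord T v x + bgrad T v \<bullet> (y - x)"
  by (simp add: bcoord_def inner_diff_right)

lemma bcoord_affine_sum:
  assumes "finite A" "sum u A = 1"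
  shows "bcoord T v (\<Sum>w\<in>A. u w *\<^sub>R w) = (\<Sum>w\<in>A. u w * bcoord T v w)"
proof -
  have "(\<Sum>w\<in>A. u w * bcoord T v w) = (\<Sum>w\<in>A. u w * (1 - bgrad T v \<bullet> v) + bgrad T v \<bullet> (u w *\<^sub>R w))"
    by (intro sum.cong) (auto simp: bcoord_def algebra_simps)
  also have "\<dots> = sum u A * (1 - bgrad T v \<bullet> v) + bgrad T v \<bullet> (\<Sum>w\<in>A. u w *\<^sub>R w)"
    by (simp add: sum.distrib inner_sum_right sum_distrib_right)
  finally show ?thesis using assms(2) by (simp add: bcoord_def algebra_simps)
qed

locale full_simplex =
  fixes T :: "'a::euclidean_space set"
  assumes simplex: "int DIM('a) simplex T"
begin

lemma verts: "\<not> affine_dependent (verts T)" "card (verts T) = Suc DIM('a)" "T = convex hull (verts T)"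
  and finite_verts: "finite (verts T)"
proof -
  obtain C where C: "\<not> affine_dependent C" "int (card C) = int DIM('a) + 1" "T = convex hull C"
    using simplex unfolding simplex_def by blast
  then have "verts T = C"
    unfolding verts_def using extreme_point_of_convex_hull_affine_independent[OF C(1)] by auto
  then show "\<not> affine_dependent (verts T)" "card (verts T) = Suc DIM('a)" "T = convex hull (verts T)"
    using C by auto
  then show "finite (verts T)" using aff_independent_finite by blast
qed

lemma compact: "compact T" and convex: "convex T" and ne: "T \<noteq> {}" and closed: "closed T"
proof -
  show "compact T"
    by (subst verts(3)) (rule finite_imp_compact_convex_hull[OF finite_verts])
  then show "closed T" by (rule compact_imp_closed)
  show "convex T" by (subst verts(3)) (rule convex_convex_hull)
  have "verts T \<noteq> {}" using verts(2) by auto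
  then show "T \<noteq> {}" by (subst verts(3)) simp
qed

lemma verts_in: "v \<in> verts T \<Longrightarrow> v \<in> T"
  using hull_inc[of v "verts T" convex] by (simp flip: verts(3))

lemma aff_dim: "aff_dim T = int DIM('a)"
  using simplex by (rule aff_dim_simplex)

lemma interior_ne: "interior T \<noteq> {}"
proof
  assume "interior T = {}"
  then obtain a b where "a \<noteq> 0" "T \<subseteq> {x. a \<bullet> x = b}"
    using empty_interior_subset_hyperplane[OF convex] by blast
  then have "aff_dim T \<le> int DIM('a) - 1"
    using aff_dim_subset[of T "{x. a \<bullet> x = b}"] aff_dim_hyperplane[of a b] by simp
  then show False using aff_dim by simp
qed

text \<open>The other vertices span a hyperplane that misses \<open>v\<close>; the gradient is a multiple of its normal.\<close>
lemma bgrad: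
  assumes v: "v \<in> verts T" and w: "w \<in> verts T - {v}"
  shows "bgrad T v \<bullet> (w - v) = - 1"
proof -
  let ?F = "verts T - {v}"
  have indF: "\<not> affine_dependent ?F" using verts(1) affine_independent_Diff by blast
  have "aff_dim ?F = int DIM('a) - 1"
    using aff_dim_affine_independent[OF indF] verts(2) finite_verts v by simp
  then obtain a b where ab: "a \<noteq> 0" "affine hull ?F = {x. a \<bullet> x = b}"
    using aff_dim_eq_hyperplane[of ?F] by auto
  have "v \<notin> affine hull ?F" using verts(1) v unfolding affine_dependent_def by blast
  then have nz: "b - a \<bullet> v \<noteq> 0" using ab(2) by auto
  have "\<forall>w \<in> ?F. ((- 1 / (b - a \<bullet> v)) *\<^sub>R a) \<bullet> (w - v) = - 1"
  proof
    fix w assume "w \<in> ?F"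
    then have "a \<bullet> w = b" using ab(2) hull_inc[of w ?F] by auto
    then have "a \<bullet> (w - v) = b - a \<bullet> v" by (simp add: inner_diff_right)
    then show "((- 1 / (b - a \<bullet> v)) *\<^sub>R a) \<bullet> (w - v) = - 1"
      using nz by simp
  qed
  then have "\<forall>w \<in> ?F. bgrad T v \<bullet> (w - v) = - 1"
    unfolding bgrad_def by (rule someI)
  then show ?thesis using w by blast
qed

lemma bcoord_vertex:
  "v \<in> verts T \<Longrightarrow> w \<in> verts T \<Longrightarrow> bcoord T v w = (if w = v then 1 else 0)"
  using bgrad[of v w] by (simp add: bcoord_def)

lemma bcoord_combination:
  assumes "v \<in> verts T" "sum u (verts T) = 1"
  shows "bcoord T v (\<Sum>w\<in>verts T. u w *\<^sub>R w) = u v"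
proof -
  have "bcoord T v (\<Sum>w\<in>verts T. u w *\<^sub>R w) = (\<Sum>w\<in>verts T. u w * bcoord T v w)"
    by (rule bcoord_affine_sum[OF finite_verts assms(2)])
  also have "\<dots> = (\<Sum>w\<in>verts T. if w = v then u v else 0)"
    using assms(1) by (intro sum.cong) (auto simp: bcoord_vertex)
  finally show ?thesis using assms(1) finite_verts by simp
qed

lemma sum_bcoord: "(\<Sum>v\<in>verts T. bcoord T v y) = 1" (is ?A)
  and bcoord_reconstruct: "(\<Sum>v\<in>verts T. bcoord T v y *\<^sub>R v) = y" (is ?B)
proof -
  have "affine hull (verts T) = UNIV"
    using affine_independent_span_eq verts by blast
  then have "y \<in> affine hull (verts T)" by simp
  then obtain u where u: "sum u (verts T) = 1" "(\<Sum>w\<in>verts T. u w *\<^sub>R w) = y"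
    unfolding affine_hull_finite[OF finite_verts] by blast
  then have "bcoord T v y = u v" if "v \<in> verts T" for v using bcoord_combination[OF that u(1)] by simp
  then show ?A ?B using u by (simp_all cong: sum.cong)
qed

lemma mem_iff: "y \<in> T \<longleftrightarrow> (\<forall>v\<in>verts T. 0 \<le> bcoord T v y)"
proof
  assume "y \<in> T"
  then have "y \<in> convex hull (verts T)" using verts(3) by simp
  then obtain u where u: "\<forall>v\<in>verts T. 0 \<le> u v" "sum u (verts T) = 1" "(\<Sum>w\<in>verts T. u w *\<^sub>R w) = y"
    unfolding convex_hull_finite[OF finite_verts] by blast
  then show "\<forall>v\<in>verts T. 0 \<le> bcoord T v y" using bcoord_combination by fastforce
next
  assume "\<forall>v\<in>verts T. 0 \<le> bcoord T v y"
  then have "y \<in> convex hull (verts T)"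
    unfolding convex_hull_finite[OF finite_verts] mem_Collect_eq
    using sum_bcoord[of y] bcoord_reconstruct[of y] by (intro exI[of _ "\<lambda>v. bcoord T v y"]) auto
  then show "y \<in> T" using verts(3) by simp
qed

lemma bcoord_sum_face:
  assumes "F \<subseteq> verts T" "\<forall>v \<in> verts T - F. bcoord T v y = 0"
  shows "(\<Sum>v\<in>F. bcoord T v y) = 1" "(\<Sum>v\<in>F. bcoord T v y *\<^sub>R v) = y"
  using sum.mono_neutral_right[OF finite_verts assms(1), of "\<lambda>v. bcoord T v y"]
    sum.mono_neutral_right[OF finite_verts assms(1), of "\<lambda>v. bcoord T v y *\<^sub>R v"]
    assms(2) sum_bcoord[of y] bcoord_reconstruct[of y] by auto

lemma bcoord_face_combination:
  assumes F: "F \<subseteq> verts T" and u: "sum u F = 1" "(\<Sum>w\<in>F. u w *\<^sub>R w) = y" and v: "v \<in> verts T"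
  shows "bcoord T v y = (if v \<in> F then u v else 0)"
proof -
  let ?u = "\<lambda>w. if w \<in> F then u w else 0"
  have "sum ?u (verts T) = sum u F"
    by (rule sum.mono_neutral_cong_right[OF finite_verts F]) auto
  moreover have "(\<Sum>w\<in>verts T. ?u w *\<^sub>R w) = (\<Sum>w\<in>F. u w *\<^sub>R w)"
    by (rule sum.mono_neutral_cong_right[OF finite_verts F]) auto
  ultimately show ?thesis using bcoord_combination[OF v, of ?u] u by simp
qed

lemma face_mem_iff:
  assumes "F \<subseteq> verts T"
  shows "y \<in> convex hull F \<longleftrightarrow> y \<in> T \<and> (\<forall>v\<in>verts T - F. bcoord T v y = 0)"
proof
  assume y: "y \<in> convex hull F"
  then obtain u where "sum u F = 1" "(\<Sum>w\<in>F. u w *\<^sub>R w) = y"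
    using convex_hull_finite[OF finite_subset[OF assms finite_verts]] by auto
  then have "\<forall>v\<in>verts T - F. bcoord T v y = 0"
    using bcoord_face_combination[OF assms] by auto
  moreover have "y \<in> T" using y hull_mono[OF assms, of convex] verts(3) by auto
  ultimately show "y \<in> T \<and> (\<forall>v\<in>verts T - F. bcoord T v y = 0)" by blast
next
  assume "y \<in> T \<and> (\<forall>v\<in>verts T - F. bcoord T v y = 0)"
  then show "y \<in> convex hull F"
    unfolding convex_hull_finite[OF finite_subset[OF assms finite_verts]] mem_Collect_eq
    using bcoord_sum_face[OF assms, of y] mem_iff assms by (intro exI[of _ "\<lambda>v. bcoord T v y"]) auto
qed

text \<open>By uniqueness, the barycentric coordinates of a point are the coefficients in the explicit
  description of the relative interior of a convex hull.\<close>
lemma face_rel_interior_iff: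
  assumes "F \<subseteq> verts T"
  shows "y \<in> rel_interior (convex hull F) \<longleftrightarrow>
    (\<forall>v\<in>F. 0 < bcoord T v y) \<and> (\<forall>v\<in>verts T - F. bcoord T v y = 0)"
proof -
  have ind: "\<not> affine_dependent F" using verts(1) affine_independent_subset assms by blast
  show ?thesis
  proof
    assume "y \<in> rel_interior (convex hull F)"
    then obtain u where "\<forall>v\<in>F. 0 < u v" "sum u F = 1" "(\<Sum>w\<in>F. u w *\<^sub>R w) = y"
      using rel_interior_convex_hull_explicit[OF ind] by auto
    then show "(\<forall>v\<in>F. 0 < bcoord T v y) \<and> (\<forall>v\<in>verts T - F. bcoord T v y = 0)"
      using bcoord_face_combination[OF assms, of u y] assms by auto
  next
    assume "(\<forall>v\<in>F. 0 < bcoord T v y) \<and> (\<forall>v\<in>verts T - F. bcoord T v y = 0)"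
    then show "y \<in> rel_interior (convex hull F)"
      unfolding rel_interior_convex_hull_explicit[OF ind] mem_Collect_eq
      using bcoord_sum_face[OF assms, of y] by (intro exI[of _ "\<lambda>v. bcoord T v y"]) auto
  qed
qed

lemma rel_interior_eq: "rel_interior T = interior T"
  using interior_ne rel_interior_nonempty_interior by blast

lemma interior_iff: "y \<in> interior T \<longleftrightarrow> (\<forall>v\<in>verts T. 0 < bcoord T v y)"
  using face_rel_interior_iff[OF order_refl, of y] rel_interior_eq verts(3) by simp

lemma sum_bgrad: "(\<Sum>v\<in>verts T. bgrad T v \<bullet> w) = 0"
  and bgrad_reconstruct: "(\<Sum>v\<in>verts T. (bgrad T v \<bullet> w) *\<^sub>R v) = w"
proof -
  have g: "bgrad T v \<bullet> w = bcoord T v w - bcoord T v 0" for v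
    using bcoord_shift[of T v w 0] by simp
  show "(\<Sum>v\<in>verts T. bgrad T v \<bullet> w) = 0" by (simp add: g sum_subtractf sum_bcoord)
  show "(\<Sum>v\<in>verts T. (bgrad T v \<bullet> w) *\<^sub>R v) = w"
    by (simp add: g sum_subtractf bcoord_reconstruct algebra_simps)
qed

text \<open>The fields \<open>\<lambda>x. x - v\<close>, with \<open>v\<close> a vertex, span the fields \<open>\<lambda>x. a + b *\<^sub>R x\<close>: compare
  coefficients in the barycentric representations of the vector \<open>a\<close> and of the origin.\<close>
lemma RT_field_decomposition:
  "a + b *\<^sub>R x = (\<Sum>v\<in>verts T. (b * bcoord T v 0 - bgrad T v \<bullet> a) *\<^sub>R (x - v))"
proof -
  have "(\<Sum>v\<in>verts T. (b * bcoord T v 0 - bgrad T v \<bullet> a) *\<^sub>R (x - v)) =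
     (\<Sum>v\<in>verts T. b * bcoord T v 0 - bgrad T v \<bullet> a) *\<^sub>R x
     - (\<Sum>v\<in>verts T. b *\<^sub>R (bcoord T v 0 *\<^sub>R v) - (bgrad T v \<bullet> a) *\<^sub>R v)"
    by (simp add: scaleR_diff_right sum_subtractf scaleR_sum_left scaleR_diff_left)
  also have "\<dots> = b *\<^sub>R x - (b *\<^sub>R 0 - a)"
    unfolding sum_subtractf scaleR_sum_right[symmetric] sum_distrib_left[symmetric]
      bcoord_reconstruct sum_bcoord sum_bgrad bgrad_reconstruct by simp
  finally show ?thesis by simp
qed

lemma opp:
  assumes "S facet_of T"
  shows "opp T S \<in> verts T" "S = convex hull (verts T - {opp T S})"
proof -
  have "\<exists>v. v \<in> verts T \<and> S = convex hull (verts T - {v})"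
    using assms facet_of_convex_hull_affine_independent[OF verts(1)] verts(3) by metis
  then have "opp T S \<in> verts T \<and> S = convex hull (verts T - {opp T S})"
    unfolding opp_def by (rule someI_ex)
  then show "opp T S \<in> verts T" "S = convex hull (verts T - {opp T S})" by auto
qed

lemma facet_mem_iff:
  "S facet_of T \<Longrightarrow> y \<in> S \<longleftrightarrow> y \<in> T \<and> bcoord T (opp T S) y = 0"
  using face_mem_iff[of "verts T - {opp T S}" y] opp[of S] by auto

lemma facet_rel_interior_iff:
  "S facet_of T \<Longrightarrow> y \<in> rel_interior S \<longleftrightarrow>
     bcoord T (opp T S) y = 0 \<and> (\<forall>v\<in>verts T - {opp T S}. 0 < bcoord T v y)"
  using face_rel_interior_iff[of "verts T - {opp T S}" y] opp[of S] by auto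

lemma verts_facet: "S facet_of T \<Longrightarrow> verts S = verts T - {opp T S}"
proof -
  assume S: "S facet_of T"
  have "\<not> affine_dependent (verts T - {opp T S})" using verts(1) affine_independent_Diff by blast
  from extreme_point_of_convex_hull_affine_independent[OF this] show ?thesis
    unfolding verts_def[of S] using opp(2)[OF S] by auto
qed

lemma opp_convex_hull:
  assumes "v \<in> verts T" "S = convex hull (verts T - {v})" "S facet_of T"
  shows "opp T S = v"
proof -
  have "\<not> affine_dependent (verts T - {v})" using verts(1) affine_independent_Diff by blast
  from extreme_point_of_convex_hull_affine_independent[OF this]
  have "x extreme_point_of S \<longleftrightarrow> x \<in> verts T - {v}" for x by (simp only: assms(2))
  then have "verts S = verts T - {v}" unfolding verts_def[of S] by blast
  then have "verts T - {v} = verts T - {opp T S}" using verts_facet[OF assms(3)] by simp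
  then show ?thesis using opp(1)[OF assms(3)] assms(1) by blast
qed

lemma facet_of_vertex: "v \<in> verts T \<Longrightarrow> convex hull (verts T - {v}) facet_of T"
proof -
  assume v: "v \<in> verts T"
  have "card (verts T - {v}) = DIM('a)" using v verts(2) finite_verts by simp
  then have "verts T - {v} \<noteq> {}" using DIM_positive[where 'a='a] by (metis card.empty less_irrefl)
  then have "convex hull (verts T - {v}) \<noteq> {}" by simp
  then have "convex hull (verts T - {v}) facet_of convex hull (verts T)"
    using facet_of_convex_hull_affine_independent[OF verts(1)] v by blast
  then show ?thesis using verts(3) by simp
qed

lemma bij_opp: "bij_betw (opp T) {S. S facet_of T} (verts T)"
proof (rule bij_betwI[where g="\<lambda>v. convex hull (verts T - {v})"])
  show "opp T \<in> {S. S facet_of T} \<rightarrow> verts T" using opp(1) by auto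
  show "(\<lambda>v. convex hull (verts T - {v})) \<in> verts T \<rightarrow> {S. S facet_of T}" using facet_of_vertex by auto
  show "\<And>x. x \<in> {S. S facet_of T} \<Longrightarrow> convex hull (verts T - {opp T x}) = x" using opp(2) by auto
  show "\<And>y. y \<in> verts T \<Longrightarrow> opp T (convex hull (verts T - {y})) = y"
    using opp_convex_hull facet_of_vertex by blast
qed

lemma finite_facets: "finite {S. S facet_of T}"
  using bij_betw_finite[OF bij_opp] finite_verts by simp

lemma bgrad_nz: "v \<in> verts T \<Longrightarrow> bgrad T v \<noteq> 0"
proof
  assume v: "v \<in> verts T" and 0: "bgrad T v = 0"
  have "card (verts T - {v}) = DIM('a)" using v verts(2) finite_verts by simp
  then obtain w where "w \<in> verts T - {v}" using DIM_positive[where 'a='a] by (metis card.empty less_irrefl ex_in_conv)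
  then show False using bgrad[OF v] 0 by fastforce
qed

lemma
  assumes "S facet_of T"
  shows height_pos: "0 < height T S" and norm_outer_normal: "norm (outer_normal T S) = 1"
    and bgrad_outer: "bgrad T (opp T S) = - (1 / height T S) *\<^sub>R outer_normal T S"
    and opp_in: "opp T S \<in> T"
  using bgrad_nz[OF opp(1)[OF assms]] opp(1)[OF assms] verts_in
  by (auto simp: height_def outer_normal_def norm_sgn sgn_div_norm)

lemma bcoord_opp:
  assumes "S facet_of T" "x \<in> S"
  shows "bcoord T (opp T S) y = - ((y - x) \<bullet> outer_normal T S) / height T S"
  using bcoord_shift[of T "opp T S" y x] facet_mem_iff[OF assms(1), of x] assms(2)
  by (simp add: bgrad_outer[OF assms(1)] inner_commute)

lemma outer_normal_opp:
  assumes "S facet_of T" "x \<in> S"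
  shows "(x - opp T S) \<bullet> outer_normal T S = height T S"
  using bcoord_opp[OF assms, of "opp T S"] bcoord_vertex[of "opp T S" "opp T S"] opp(1)[OF assms(1)]
    height_pos[OF assms(1)] by (simp add: field_simps inner_diff_left)

lemma outer_normal_facet:
  "S facet_of T \<Longrightarrow> x \<in> S \<Longrightarrow> y \<in> S \<Longrightarrow> (y - x) \<bullet> outer_normal T S = 0"
  using bcoord_opp[of S x y] facet_mem_iff[of S y] height_pos[of S] by simp

lemma opp_in_other_facet:
  assumes "S facet_of T" "S' facet_of T" "S' \<noteq> S"
  shows "opp T S \<in> S'"
proof -
  have "opp T S \<noteq> opp T S'" using assms bij_opp by (metis opp(2))
  then have "opp T S \<in> verts T - {opp T S'}" using opp(1)[OF assms(1)] by auto
  then show ?thesis using opp(2)[OF assms(2)] hull_inc by metis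
qed

text \<open>Near a relative interior point of a facet only the coordinate of the opposite vertex can
  change sign.\<close>
lemma local_half_ball:
  assumes S: "S facet_of T" and x: "x \<in> rel_interior S"
  shows "\<exists>r>0. T \<inter> ball x r = {y \<in> ball x r. (y - x) \<bullet> outer_normal T S \<le> 0}"
proof -
  let ?z = "opp T S"
  have xS: "x \<in> S" using x rel_interior_subset by blast
  let ?U = "\<Inter>v\<in>verts T - {?z}. {y. 0 < bcoord T v y}"
  have "open ?U"
    using finite_verts by (intro open_INT ballI open_Collect_less continuous_on_const continuous_on_bcoord) auto
  moreover have "x \<in> ?U" using facet_rel_interior_iff[OF S] x by auto
  ultimately obtain r where r: "r > 0" "ball x r \<subseteq> ?U" using open_contains_ball by metis
  have "y \<in> T \<longleftrightarrow> (y - x) \<bullet> outer_normal T S \<le> 0" if y: "y \<in> ball x r" for y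
  proof -
    have "0 \<le> bcoord T v y" if "v \<in> verts T - {?z}" for v
      using subsetD[OF r(2) y] that by (auto intro: less_imp_le)
    then have "y \<in> T \<longleftrightarrow> 0 \<le> bcoord T ?z y" using mem_iff[of y] opp(1)[OF S] by auto
    then show ?thesis unfolding bcoord_opp[OF S xS] using height_pos[OF S]
      by (simp add: zero_le_divide_iff divide_le_0_iff)
  qed
  then show ?thesis using r(1) by blast
qed

lemma rel_interior_facet_ne: "S facet_of T \<Longrightarrow> rel_interior S \<noteq> {}"
  using rel_interior_eq_empty[OF face_of_imp_convex[of S T]] by (auto simp: facet_of_def)

lemma facet_subset: "S facet_of T \<Longrightarrow> S \<subseteq> T"
  by (rule facet_of_imp_subset)

lemma facet_compact_convex: assumes "S facet_of T" shows "compact S" "convex S" "S \<noteq> {}"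
  using assms opp(2)[OF assms] finite_verts finite_imp_compact_convex_hull convex_convex_hull
  by (metis finite_Diff, metis, simp add: facet_of_def)

lemma lmeasurable: "T \<in> lmeasurable" and measure_pos: "0 < vol T"
proof -
  show l: "T \<in> lmeasurable" using compact by (rule lmeasurable_compact)
  have "\<not> negligible T" using interior_ne negligible_convex_interior[OF convex] by simp
  then show "0 < vol T"
    using l negligible_iff_measure[of T] by (simp add: zero_less_measure_iff less_le)
qed

end

section \<open>Integration over a simplex in layers parallel to a facet\<close>

text \<open>Fubini's theorem for the splitting of the space into a line and its orthogonal hyperplane,
  where the hyperplane measure is the volume of slabs of height one. It follows from translation
  invariance: sliding the slab along \<open>n\<close>, every point is covered during a time of total length
  one.\<close>
lemma nn_integral_slices:
  fixes n b :: "'a::euclidean_space" and G :: "'a \<Rightarrow> ennreal"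
  assumes n: "norm n = 1" and G [measurable]: "G \<in> borel_measurable borel"
  shows "(\<integral>\<^sup>+y. G y \<partial>lborel) =
    (\<integral>\<^sup>+t. (\<integral>\<^sup>+y. indicator {y. 0 \<le> (y - b) \<bullet> n \<and> (y - b) \<bullet> n \<le> 1} y
        * G (y - ((y - b) \<bullet> n) *\<^sub>R n + t *\<^sub>R n) \<partial>lborel) \<partial>lborel)"
proof -
  define l where "l y = (y - b) \<bullet> n" for y
  define D where "D y = (indicator {0..1} (l y) :: ennreal)" for y
  have l_meas [measurable]: "l \<in> borel_measurable borel" unfolding l_def by measurable
  have D_meas [measurable]: "D \<in> borel_measurable borel" unfolding D_def by measurable
  have nn: "n \<bullet> n = 1" using n by (simp add: dot_square_norm)
  have ll: "l (y - t *\<^sub>R n) = l y - t" for y t by (simp add: l_def inner_diff_left nn)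
  have line: "(\<integral>\<^sup>+t. G (y - l y *\<^sub>R n + t *\<^sub>R n) \<partial>lborel) = (\<integral>\<^sup>+t. G (y + t *\<^sub>R n) \<partial>lborel)" for y
    by (subst nn_integral_real_affine[where c=1 and t="l y"]) (auto simp: algebra_simps)
  have shift: "(\<integral>\<^sup>+y. D y * G (y + t *\<^sub>R n) \<partial>lborel) = (\<integral>\<^sup>+y. D (y - t *\<^sub>R n) * G y \<partial>lborel)" for t
  proof -
    have "(\<integral>\<^sup>+y. D y * G (y + t *\<^sub>R n) \<partial>lborel)
        = (\<integral>\<^sup>+y. D y * G (y + t *\<^sub>R n) \<partial>(distr lborel borel ((+) (- t *\<^sub>R n))))"
      by (simp only: lborel_distr_plus)
    also have "\<dots> = (\<integral>\<^sup>+y. D (y - t *\<^sub>R n) * G y \<partial>lborel)"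
      by (subst nn_integral_distr) (auto simp: algebra_simps)
    finally show ?thesis .
  qed
  have unit: "(\<integral>\<^sup>+t. D (y - t *\<^sub>R n) \<partial>lborel) = 1" for y
  proof -
    have "(\<integral>\<^sup>+t. D (y - t *\<^sub>R n) \<partial>lborel) = (\<integral>\<^sup>+t. indicator {l y - 1..l y} t \<partial>lborel)"
      by (intro nn_integral_cong) (auto simp: D_def ll indicator_def)
    then show ?thesis by simp
  qed
  have "(\<integral>\<^sup>+t. (\<integral>\<^sup>+y. D y * G (y - l y *\<^sub>R n + t *\<^sub>R n) \<partial>lborel) \<partial>lborel)
      = (\<integral>\<^sup>+y. (\<integral>\<^sup>+t. D y * G (y - l y *\<^sub>R n + t *\<^sub>R n) \<partial>lborel) \<partial>lborel)"
    by (rule lborel_pair.Fubini') measurable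
  also have "\<dots> = (\<integral>\<^sup>+y. (\<integral>\<^sup>+t. D y * G (y + t *\<^sub>R n) \<partial>lborel) \<partial>lborel)"
    by (simp add: nn_integral_cmult line)
  also have "\<dots> = (\<integral>\<^sup>+t. (\<integral>\<^sup>+y. D y * G (y + t *\<^sub>R n) \<partial>lborel) \<partial>lborel)"
    by (rule lborel_pair.Fubini'[symmetric]) measurable
  also have "\<dots> = (\<integral>\<^sup>+t. (\<integral>\<^sup>+y. D (y - t *\<^sub>R n) * G y \<partial>lborel) \<partial>lborel)"
    by (simp only: shift)
  also have "\<dots> = (\<integral>\<^sup>+y. (\<integral>\<^sup>+t. D (y - t *\<^sub>R n) * G y \<partial>lborel) \<partial>lborel)"
    by (rule lborel_pair.Fubini') measurable
  also have "\<dots> = (\<integral>\<^sup>+y. G y \<partial>lborel)"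
    by (simp add: nn_integral_multc unit)
  finally show ?thesis
    by (simp add: D_def l_def indicator_def of_bool_def)
qed

text \<open>The slab measure on a hyperplane scales with one power less than the volume, because a dilation
  by \<open>t\<close> also multiplies the thickness of the slab by \<open>t\<close>. The centre \<open>p\<close> of the dilation lies in
  the hyperplane.\<close>
lemma nn_integral_slab_scale:
  fixes n p :: "'a::euclidean_space" and g :: "'a \<Rightarrow> ennreal"
  assumes n: "norm n = 1" and g [measurable]: "g \<in> borel_measurable borel" and t: "0 < t"
    and p: "(p - b) \<bullet> n = 0"
  shows "(\<integral>\<^sup>+y. indicator {y. 0 \<le> (y - b) \<bullet> n \<and> (y - b) \<bullet> n \<le> 1} y
       * g (p + (1 / t) *\<^sub>R (y - ((y - b) \<bullet> n) *\<^sub>R n - p)) \<partial>lborel) =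
     ennreal (t ^ (DIM('a) - 1)) *
     (\<integral>\<^sup>+y. indicator {y. 0 \<le> (y - b) \<bullet> n \<and> (y - b) \<bullet> n \<le> 1} y
       * g (y - ((y - b) \<bullet> n) *\<^sub>R n) \<partial>lborel)"
proof -
  define l where "l y = (y - b) \<bullet> n" for y
  define D where "D y = (indicator {0..1} (l y) :: ennreal)" for y
  define s where "s y = y - l y *\<^sub>R n" for y
  have l_meas [measurable]: "l \<in> borel_measurable borel" unfolding l_def by measurable
  have D_meas [measurable]: "D \<in> borel_measurable borel" unfolding D_def by measurable
  have s_meas [measurable]: "s \<in> borel_measurable borel" unfolding s_def by measurable
  have nn: "n \<bullet> n = 1" using n by (simp add: dot_square_norm)
  have lp: "l p = 0" using p by (simp add: l_def)
  have l_scale: "l (p - t *\<^sub>R p + t *\<^sub>R y) = t * l y" for y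
    using p unfolding l_def by (simp add: inner_diff_left inner_add_left algebra_simps)
  have s_scale: "s (p - t *\<^sub>R p + t *\<^sub>R y) = p + t *\<^sub>R (s y - p)" for y
    unfolding s_def l_scale by (simp add: algebra_simps)
  have ls: "l (s y + r *\<^sub>R n) = r" for y r
    unfolding s_def l_def by (simp add: inner_diff_left inner_add_left algebra_simps nn)
  have ss: "s (s y + r *\<^sub>R n) = s y" for y r
    unfolding s_def[of "s y + r *\<^sub>R n"] ls by simp
  have "(\<integral>\<^sup>+y. D y * g (p + (1 / t) *\<^sub>R (s y - p)) \<partial>lborel)
      = ennreal (t ^ DIM('a)) * (\<integral>\<^sup>+y. D (p - t *\<^sub>R p + t *\<^sub>R y) * g (s y) \<partial>lborel)"
    using t by (subst lborel_affine[of t "p - t *\<^sub>R p"])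
      (simp_all add: nn_integral_density nn_integral_distr nn_integral_cmult s_scale ennreal_power)
  also have "(\<integral>\<^sup>+y. D (p - t *\<^sub>R p + t *\<^sub>R y) * g (s y) \<partial>lborel)
     = (\<integral>\<^sup>+r. (\<integral>\<^sup>+y. D y * (D (p - t *\<^sub>R p + t *\<^sub>R (s y + r *\<^sub>R n)) * g (s (s y + r *\<^sub>R n))) \<partial>lborel) \<partial>lborel)"
    by (subst nn_integral_slices[OF n, of _ b])
       (auto simp: D_def l_def[symmetric] s_def[symmetric] indicator_def of_bool_def)
  also have "\<dots> = (\<integral>\<^sup>+r. (\<integral>\<^sup>+y. indicator {0..1/t} r * (D y * g (s y)) \<partial>lborel) \<partial>lborel)"
  proof -
    have c: "D (p - t *\<^sub>R p + t *\<^sub>R (s y + r *\<^sub>R n)) = indicator {0..1/t} r" for y r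
      unfolding D_def l_scale ls using t by (auto simp: indicator_def field_simps zero_le_mult_iff)
    show ?thesis unfolding c ss by (simp only: mult.left_commute)
  qed
  also have "\<dots> = (\<integral>\<^sup>+r. indicator {0..1/t} r \<partial>lborel) * (\<integral>\<^sup>+y. D y * g (s y) \<partial>lborel)"
    by (simp add: nn_integral_cmult nn_integral_multc)
  also have "(\<integral>\<^sup>+r. indicator {0..1/t} r \<partial>lborel) = ennreal (1 / t)"
    using t by simp
  finally have "(\<integral>\<^sup>+y. D y * g (p + (1 / t) *\<^sub>R (s y - p)) \<partial>lborel)
     = (ennreal (t ^ DIM('a)) * ennreal (1 / t)) * (\<integral>\<^sup>+y. D y * g (s y) \<partial>lborel)"
    by (simp add: mult.assoc)
  also have "ennreal (t ^ DIM('a)) * ennreal (1 / t) = ennreal (t ^ (DIM('a) - 1))"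
  proof -
    have "t ^ DIM('a) = t ^ (DIM('a) - 1) * t"
      using power_Suc2[of t "DIM('a) - 1"] DIM_positive[where 'a='a] by simp
    then show ?thesis using t by (simp add: ennreal_mult[symmetric])
  qed
  finally show ?thesis
    by (simp add: D_def l_def s_def indicator_def of_bool_def)
qed

locale simplex_facet = full_simplex T for T :: "'a::euclidean_space set" +
  fixes S assumes facet: "S facet_of T"
begin

abbreviation "z \<equiv> opp T S"
abbreviation "b \<equiv> barycenter S"

text \<open>The ingredients of the facet measure of \<open>S\<close>: a unit normal of unspecified sign, the signed
  distance from the hyperplane of \<open>S\<close>, the orthogonal projection onto it, and the prism of height one
  over \<open>S\<close> whose projected volume is the measure.\<close>
definition nrml :: 'a where
  "nrml = (SOME n. norm n = 1 \<and> (\<forall>x \<in> S. \<forall>y \<in> S. (x - y) \<bullet> n = 0))"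

definition level :: "'a \<Rightarrow> real" where "level y = (y - b) \<bullet> nrml"
definition proj :: "'a \<Rightarrow> 'a" where "proj y = y - level y *\<^sub>R nrml"
definition prism :: "'a set" where "prism = {x + t *\<^sub>R nrml | x t. x \<in> S \<and> 0 \<le> t \<and> t \<le> 1}"
definition flat_measure :: "'a measure" where
  "flat_measure = distr (restrict_space lborel prism) borel proj"

lemma facet_measure_eq: "facet_measure S = completion flat_measure"
  unfolding facet_measure_def flat_measure_def nrml_def[symmetric] prism_def proj_def[abs_def] level_def Let_def ..

lemma nrml: "norm nrml = 1" "x \<in> S \<Longrightarrow> y \<in> S \<Longrightarrow> (x - y) \<bullet> nrml = 0"
proof -
  have "\<exists>n. norm n = 1 \<and> (\<forall>x \<in> S. \<forall>y \<in> S. (x - y) \<bullet> n = 0)"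
    using norm_outer_normal[OF facet] outer_normal_facet[OF facet] by blast
  then have "norm nrml = 1 \<and> (\<forall>x \<in> S. \<forall>y \<in> S. (x - y) \<bullet> nrml = 0)"
    unfolding nrml_def by (rule someI_ex)
  then show "norm nrml = 1" "x \<in> S \<Longrightarrow> y \<in> S \<Longrightarrow> (x - y) \<bullet> nrml = 0" by auto
qed

lemma finite_verts_facet: "finite (verts S)" and card_verts_facet: "card (verts S) = DIM('a)"
  using verts_facet[OF facet] finite_verts verts(2) opp(1)[OF facet] by auto

lemma bcoord_barycenter:
  "v \<in> verts T \<Longrightarrow> bcoord T v b = (if v = z then 0 else 1 / DIM('a))"
proof -
  assume v: "v \<in> verts T"
  have "b = (\<Sum>w\<in>verts S. (1 / real DIM('a)) *\<^sub>R w)"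
    unfolding barycenter_def verts_def[symmetric] card_verts_facet by (simp add: scaleR_sum_right divide_inverse)
  moreover have "(\<Sum>w\<in>verts S. 1 / real DIM('a)) = 1" using card_verts_facet by simp
  ultimately have "bcoord T v b = (if v \<in> verts S then 1 / real DIM('a) else 0)"
    using bcoord_face_combination[OF _ _ _ v, of "verts S" "\<lambda>_. 1 / real DIM('a)" b] verts_facet[OF facet]
    by (metis Diff_subset)
  then show ?thesis using verts_facet[OF facet] v by auto
qed

lemma barycenter_rel_interior: "b \<in> rel_interior S"
  using facet_rel_interior_iff[OF facet, of b] bcoord_barycenter opp(1)[OF facet] by auto

lemma barycenter_in: "b \<in> S"
  using barycenter_rel_interior rel_interior_subset by blast

text \<open>The height of \<open>S\<close>, with the sign that depends on which of the two normals was chosen.\<close>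
definition h :: real where "h = - level z"

text \<open>A linear functional that is constant on \<open>S\<close> is a multiple of the barycentric coordinate of
  the opposite vertex.\<close>
lemma nrml_bgrad: "nrml = - h *\<^sub>R bgrad T z"
proof -
  have "nrml \<bullet> w = (- h *\<^sub>R bgrad T z) \<bullet> w" for w
  proof -
    have S: "v \<bullet> nrml = b \<bullet> nrml" if "v \<in> verts T - {z}" for v
    proof -
      have "v \<in> S" using that verts_facet[OF facet] opp(2)[OF facet] hull_inc by metis
      from nrml(2)[OF this barycenter_in] show ?thesis by (simp add: inner_diff_left)
    qed
    have "nrml \<bullet> w = (\<Sum>v\<in>verts T. (bgrad T v \<bullet> w) * (v \<bullet> nrml))"
      by (subst bgrad_reconstruct[of w, symmetric]) (simp add: inner_sum_right inner_commute)
    also have "\<dots> = (\<Sum>v\<in>verts T. (bgrad T v \<bullet> w) * (b \<bullet> nrml) - (if v = z then h * (bgrad T z \<bullet> w) else 0))"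
    proof (intro sum.cong refl)
      fix v assume "v \<in> verts T"
      show "(bgrad T v \<bullet> w) * (v \<bullet> nrml) = (bgrad T v \<bullet> w) * (b \<bullet> nrml) - (if v = z then h * (bgrad T z \<bullet> w) else 0)"
        using S[of v] \<open>v \<in> verts T\<close> by (cases "v = z") (auto simp: h_def level_def algebra_simps)
    qed
    also have "\<dots> = (\<Sum>v\<in>verts T. bgrad T v \<bullet> w) * (b \<bullet> nrml) - h * (bgrad T z \<bullet> w)"
      using opp(1)[OF facet] finite_verts by (simp add: sum_subtractf sum_distrib_right)
    finally show ?thesis by (simp add: sum_bgrad)
  qed
  then show ?thesis by (metis vector_eq_rdot)
qed

lemma h_nz: "h \<noteq> 0" using nrml_bgrad nrml(1) by auto

lemma abs_h: "\<bar>h\<bar> = height T S"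
proof -
  have "\<bar>h\<bar> * norm (bgrad T z) = 1" using nrml(1) by (subst (asm) nrml_bgrad) simp
  then show ?thesis using bgrad_nz[OF opp(1)[OF facet]] by (simp add: height_def field_simps)
qed

lemma bcoord_level: "bcoord T z y = - level y / h"
proof -
  have "bcoord T z y = bgrad T z \<bullet> (y - b)"
    using bcoord_shift[of T z y b] bcoord_barycenter[of z] opp(1)[OF facet] by simp
  moreover have "level y = - h * (bgrad T z \<bullet> (y - b))"
    unfolding level_def by (subst nrml_bgrad) (simp add: inner_commute)
  ultimately show ?thesis using h_nz by simp
qed

lemma level_facet: "x \<in> S \<Longrightarrow> level x = 0"
  unfolding level_def using nrml(2) barycenter_in by simp

lemma nrml_self: "nrml \<bullet> nrml = 1" using nrml(1) by (simp add: dot_square_norm)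

lemma level_add: "level (y + t *\<^sub>R nrml) = level y + t"
  by (simp add: level_def inner_diff_left inner_add_left nrml_self)

lemma level_proj: "level (proj y) = 0"
  using level_add[of y "- level y"] by (simp add: proj_def)

lemma prism_iff: "y \<in> prism \<longleftrightarrow> proj y \<in> S \<and> 0 \<le> level y \<and> level y \<le> 1"
proof
  assume "y \<in> prism"
  then obtain x t where xt: "y = x + t *\<^sub>R nrml" "x \<in> S" "0 \<le> t" "t \<le> 1" unfolding prism_def by blast
  then have "level y = t" using level_add level_facet by simp
  then show "proj y \<in> S \<and> 0 \<le> level y \<and> level y \<le> 1" using xt by (simp add: proj_def)
next
  assume "proj y \<in> S \<and> 0 \<le> level y \<and> level y \<le> 1"
  moreover have "y = proj y + level y *\<^sub>R nrml" by (simp add: proj_def)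
  ultimately show "y \<in> prism" unfolding prism_def by blast
qed

lemma level_meas [measurable]: "level \<in> borel_measurable borel" unfolding level_def[abs_def] by measurable
lemma proj_meas [measurable]: "proj \<in> borel_measurable borel" unfolding proj_def[abs_def] by measurable

lemma S_borel [measurable]: "S \<in> sets borel"
  using facet_compact_convex(1)[OF facet] borel_compact by blast

lemma T_borel [measurable]: "T \<in> sets borel"
  using compact borel_compact by blast

lemma prism_compact: "compact prism" and prism_convex: "convex prism"
proof -
  let ?I = "(\<lambda>t. t *\<^sub>R nrml) ` {0..1}"
  have eq: "prism = {x + y | x y. x \<in> S \<and> y \<in> ?I}"
    unfolding prism_def by fastforce
  have eq': "prism = (\<Union>x\<in>S. \<Union>y\<in>?I. {x + y})"
    unfolding eq by blast
  show "compact prism"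
    unfolding eq by (intro compact_sums facet_compact_convex(1)[OF facet] compact_continuous_image continuous_intros) simp
  have "linear (\<lambda>t. t *\<^sub>R nrml)" by (intro linearI) (auto simp: algebra_simps)
  then show "convex prism" unfolding eq'
    by (intro convex_sums facet_compact_convex(2)[OF facet] convex_linear_image) auto
qed

lemma prism_borel [measurable]: "prism \<in> sets borel"
  using prism_compact borel_compact by blast

lemma space_flat [simp]: "space flat_measure = UNIV" and sets_flat [simp, measurable_cong]: "sets flat_measure = sets borel"
  by (simp_all add: flat_measure_def)

lemma nn_integral_flat:
  assumes [measurable]: "g \<in> borel_measurable borel"
  shows "(\<integral>\<^sup>+x. g x \<partial>flat_measure) = (\<integral>\<^sup>+y. indicator prism y * g (proj y) \<partial>lborel)"
  unfolding flat_measure_def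
  by (subst nn_integral_distr) (auto simp: nn_integral_restrict_space measurable_restrict_space1 mult.commute)

lemma finite_flat: "finite_measure flat_measure"
proof
  have "emeasure flat_measure (space flat_measure) = (\<integral>\<^sup>+y. indicator prism y \<partial>lborel)"
    using nn_integral_flat[of "\<lambda>_. 1"] by simp
  also have "\<dots> = emeasure lborel prism" by simp
  finally show "emeasure flat_measure (space flat_measure) \<noteq> \<infinity>"
    using emeasure_lborel_cbox_finite emeasure_bounded_finite[OF compact_imp_bounded[OF prism_compact]] by auto
qed

lemma AE_flat:
  assumes "Measurable.pred borel P" "AE y in lborel. y \<in> prism \<longrightarrow> P (proj y)"
  shows "AE x in flat_measure. P x"
proof -
  have "proj \<in> restrict_space lborel prism \<rightarrow>\<^sub>M borel" by (intro measurable_restrict_space1) simp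
  moreover have "AE y in restrict_space lborel prism. P (proj y)"
    using assms(2) by (subst AE_restrict_space_iff) auto
  ultimately show ?thesis
    unfolding flat_measure_def using assms(1) by (subst AE_distr_iff) auto
qed

lemma AE_flat_in: "AE x in flat_measure. x \<in> S"
  by (rule AE_flat) (auto simp: prism_iff)

text \<open>A point of the open prism projects into the relative interior, and the frontier of the convex
  prism is a null set.\<close>
lemma AE_facet_rel_interior: "AE x in facet_measure S. x \<in> rel_interior S"
proof -
  have rS: "rel_interior S \<in> sets borel"
  proof -
    have "rel_interior S = S - rel_frontier S"
      using rel_interior_subset closure_subset closed_closure facet_compact_convex(1)[OF facet]
      by (auto simp: rel_frontier_def compact_imp_closed)
    moreover have "closed (rel_frontier S)"
      using facet_compact_convex(1)[OF facet] compact_rel_frontier_bounded compact_imp_bounded compact_imp_closed by blast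
    ultimately show ?thesis by auto
  qed
  have "negligible (frontier prism)" by (rule negligible_convex_frontier[OF prism_convex])
  then have "frontier prism \<in> null_sets lborel"
    by (auto simp: negligible_iff_null_sets null_sets_completion_iff frontier_def)
  then have "AE y in lborel. y \<notin> frontier prism" by (rule AE_not_in)
  moreover have "proj y \<in> rel_interior S" if y: "y \<in> interior prism" for y
  proof -
    have yS: "proj y \<in> S" using y interior_subset prism_iff by blast
    obtain e where e: "e > 0" "ball y e \<subseteq> prism" using y mem_interior by blast
    have "ball (proj y) e \<inter> affine hull S \<subseteq> S"
    proof
      fix w assume w: "w \<in> ball (proj y) e \<inter> affine hull S"
      have "S \<subseteq> {x. level x = 0}" using level_facet by blast
      moreover have "affine {x. level x = 0}"
      proof -
        have "{x. level x = 0} = {x. nrml \<bullet> x = nrml \<bullet> b}"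
          by (auto simp: level_def inner_diff_right inner_commute[of _ nrml])
        then show ?thesis by (simp add: affine_hyperplane)
      qed
      ultimately have "level w = 0" using hull_minimal[of S _ affine] w by auto
      moreover have "w + level y *\<^sub>R nrml \<in> ball y e"
        using w by (simp add: proj_def dist_norm algebra_simps)
      then have "w + level y *\<^sub>R nrml \<in> prism" using e(2) by blast
      ultimately show "w \<in> S" using prism_iff level_add[of w "level y"] by (auto simp: proj_def)
    qed
    then show ?thesis unfolding rel_interior_ball using yS e(1) by blast
  qed
  ultimately have "AE y in lborel. y \<in> prism \<longrightarrow> proj y \<in> rel_interior S"
    by (elim eventually_mono) (auto simp: frontier_def closure_closed compact_imp_closed[OF prism_compact])
  then have "AE x in flat_measure. x \<in> rel_interior S"
    using rS by (intro AE_flat) (auto simp: pred_def)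
  then show ?thesis unfolding facet_measure_eq by (rule AE_completion)
qed

text \<open>Contraction towards \<open>z\<close> multiplies the barycentric coordinates of all other vertices by \<open>t\<close>, so
  the layers of the cone over \<open>S\<close> are the sets \<open>z + t *\<^sub>R (S - z)\<close>.\<close>
lemma cone_point:
  assumes t: "0 < t" and t1: "t \<le> 1" and s: "level s = 0"
  shows "z + t *\<^sub>R (s - z) \<in> T \<longleftrightarrow> s \<in> S"
proof -
  have shift: "bcoord T v (z + t *\<^sub>R (s - z)) = (1 - t) * bcoord T v z + t * bcoord T v s" for v
    by (simp add: bcoord_def algebra_simps)
  have "bcoord T z s = 0" using s by (simp add: bcoord_level)
  then have iff: "0 \<le> bcoord T v (z + t *\<^sub>R (s - z)) \<longleftrightarrow> 0 \<le> bcoord T v s" if "v \<in> verts T" for v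
    unfolding shift using bcoord_vertex[OF that opp(1)[OF facet]] t t1
    by (auto simp: zero_le_mult_iff)
  show ?thesis using mem_iff facet_mem_iff[OF facet, of s] \<open>bcoord T z s = 0\<close> iff by auto
qed

lemma level_simplex: "x \<in> T \<Longrightarrow> 0 \<le> - level x / h \<and> - level x / h \<le> 1"
proof -
  assume x: "x \<in> T"
  have "(\<Sum>v\<in>verts T - {z}. bcoord T v x) + bcoord T z x = 1"
    using sum_bcoord[of x] sum.remove[OF finite_verts opp(1)[OF facet], of "\<lambda>v. bcoord T v x"] by simp
  moreover have "0 \<le> (\<Sum>v\<in>verts T - {z}. bcoord T v x)" using x mem_iff by (intro sum_nonneg) auto
  ultimately show ?thesis using x mem_iff opp(1)[OF facet] bcoord_level[of x] by auto
qed

text \<open>Integration over \<open>T\<close> in polar coordinates around the vertex \<open>z\<close>: slice parallel to \<open>S\<close>, then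
  scale each layer back to \<open>S\<close>.\<close>
lemma nn_integral_cone:
  assumes \<psi> [measurable]: "\<psi> \<in> borel_measurable borel"
  shows "(\<integral>\<^sup>+x. indicator T x * \<psi> x \<partial>lborel) = ennreal (height T S) *
    (\<integral>\<^sup>+s. (\<integral>\<^sup>+t. indicator {0..1} t * (ennreal (t ^ (DIM('a) - 1)) * \<psi> (z + t *\<^sub>R (s - z))) \<partial>lborel) \<partial>flat_measure)"
proof -
  let ?D = "indicator {y. 0 \<le> (y - b) \<bullet> nrml \<and> (y - b) \<bullet> nrml \<le> 1} :: 'a \<Rightarrow> ennreal"
  define J where "J r = (\<integral>\<^sup>+y. ?D y * (indicator T (proj y + r *\<^sub>R nrml) * \<psi> (proj y + r *\<^sub>R nrml)) \<partial>lborel)" for r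
  (* p is the foot of the perpendicular from z; the layer at level - h + h * t is the image of S
     under the dilation by t with centre z. *)
  define p where "p = z + h *\<^sub>R nrml"
  have lp: "level p = 0" unfolding p_def level_add by (simp add: h_def)
  have J_meas [measurable]: "J \<in> borel_measurable borel"
    unfolding J_def by measurable
  have J: "J (- h + h * t) = ennreal (t ^ (DIM('a) - 1)) * (\<integral>\<^sup>+s. \<psi> (z + t *\<^sub>R (s - z)) \<partial>flat_measure)"
    if t: "0 < t" "t \<le> 1" for t
  proof -
    define g where "g s = (indicator S s * \<psi> (z + t *\<^sub>R (s - z)) :: ennreal)" for s
    have [measurable]: "g \<in> borel_measurable borel" unfolding g_def by measurable
    have "indicator T (proj y + (- h + h * t) *\<^sub>R nrml) * \<psi> (proj y + (- h + h * t) *\<^sub>R nrml)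
        = g (p + (1 / t) *\<^sub>R (y - ((y - b) \<bullet> nrml) *\<^sub>R nrml - p))" for y
    proof -
      define s where "s = p + (1 / t) *\<^sub>R (proj y - p)"
      have "t *\<^sub>R (s - z) = t *\<^sub>R (h *\<^sub>R nrml) + (proj y - p)"
        using t unfolding s_def p_def by (simp add: algebra_simps)
      then have e: "proj y + (- h + h * t) *\<^sub>R nrml = z + t *\<^sub>R (s - z)"
        unfolding p_def by (simp add: algebra_simps)
      have "level s = 0"
        using lp level_proj[of y] unfolding s_def level_def
        by (simp add: inner_diff_left inner_add_left)
      then show ?thesis
        using cone_point[OF t, of s] unfolding e g_def s_def[unfolded proj_def level_def, symmetric]
        by (auto simp: indicator_def)
    qed
    then have "J (- h + h * t) = (\<integral>\<^sup>+y. ?D y * g (p + (1 / t) *\<^sub>R (y - ((y - b) \<bullet> nrml) *\<^sub>R nrml - p)) \<partial>lborel)"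
      unfolding J_def by simp
    also have "\<dots> = ennreal (t ^ (DIM('a) - 1)) * (\<integral>\<^sup>+y. ?D y * g (y - ((y - b) \<bullet> nrml) *\<^sub>R nrml) \<partial>lborel)"
      using lp by (intro nn_integral_slab_scale nrml(1) t(1)) (auto simp: level_def)
    also have "(\<integral>\<^sup>+y. ?D y * g (y - ((y - b) \<bullet> nrml) *\<^sub>R nrml) \<partial>lborel) = (\<integral>\<^sup>+s. \<psi> (z + t *\<^sub>R (s - z)) \<partial>flat_measure)"
      unfolding level_def[symmetric] proj_def[symmetric]
      by (subst nn_integral_flat) (auto intro!: nn_integral_cong simp: g_def indicator_def prism_iff)
    finally show ?thesis .
  qed
  have J0: "J (- h + h * t) = 0" if t: "t < 0 \<or> 1 < t" for t
  proof -
    have "proj y + (- h + h * t) *\<^sub>R nrml \<notin> T" for y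
    proof
      assume "proj y + (- h + h * t) *\<^sub>R nrml \<in> T"
      from level_simplex[OF this] show False
        using t h_nz by (simp add: level_add level_proj diff_divide_distrib)
    qed
    then show ?thesis unfolding J_def by simp
  qed
  have "(\<integral>\<^sup>+x. indicator T x * \<psi> x \<partial>lborel) = (\<integral>\<^sup>+r. J r \<partial>lborel)"
    by (subst nn_integral_slices[OF nrml(1), of _ b]) (simp_all add: J_def[abs_def] proj_def level_def)
  also have "\<dots> = ennreal \<bar>h\<bar> * (\<integral>\<^sup>+t. J (- h + h * t) \<partial>lborel)"
    using h_nz by (intro nn_integral_real_affine) auto
  also have "(\<integral>\<^sup>+t. J (- h + h * t) \<partial>lborel) = (\<integral>\<^sup>+t. (\<integral>\<^sup>+s. indicator {0..1} t * (ennreal (t ^ (DIM('a) - 1)) * \<psi> (z + t *\<^sub>R (s - z))) \<partial>flat_measure) \<partial>lborel)"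
  proof (rule nn_integral_cong_AE)
    have "AE t in lborel. t \<noteq> (0::real)" by (rule AE_lborel_singleton)
    then show "AE t in lborel. J (- h + h * t) = (\<integral>\<^sup>+s. indicator {0..1} t * (ennreal (t ^ (DIM('a) - 1)) * \<psi> (z + t *\<^sub>R (s - z))) \<partial>flat_measure)"
    proof eventually_elim
      fix t :: real assume "t \<noteq> 0"
      then consider "t < 0 \<or> 1 < t" | "0 < t" "t \<le> 1" by linarith
      then show "J (- h + h * t) = (\<integral>\<^sup>+s. indicator {0..1} t * (ennreal (t ^ (DIM('a) - 1)) * \<psi> (z + t *\<^sub>R (s - z))) \<partial>flat_measure)"
        using J0 J by cases (auto simp: nn_integral_cmult)
    qed
  qed
  also have "\<dots> = (\<integral>\<^sup>+s. (\<integral>\<^sup>+t. indicator {0..1} t * (ennreal (t ^ (DIM('a) - 1)) * \<psi> (z + t *\<^sub>R (s - z))) \<partial>lborel) \<partial>flat_measure)"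
  proof -
    interpret f: finite_measure flat_measure by (rule finite_flat)
    interpret pair_sigma_finite flat_measure lborel ..
    show ?thesis by (rule Fubini') measurable
  qed
  finally show ?thesis by (simp add: abs_h)
qed

end

section \<open>The divergence theorem on a cone and centroids\<close>

text \<open>In a complete measure space the values on a null set do not affect measurability.\<close>
lemma borel_measurable_AE_completion:
  fixes f g :: "'a \<Rightarrow> 'b::topological_space"
  assumes ae: "AE x in completion M. f x = g x" and g: "g \<in> borel_measurable (completion M)"
  shows "f \<in> borel_measurable (completion M)"
proof (rule measurableI)
  fix A :: "'b set" assume A: "A \<in> sets borel"
  have "AE x in completion M. x \<in> g -` A \<inter> space M \<longleftrightarrow> x \<in> f -` A \<inter> space M"
    using ae by eventually_elim auto
  moreover have "g -` A \<inter> space M \<in> sets (completion M)"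
    using measurable_sets[OF g A] by simp
  ultimately have "f -` A \<inter> space M \<in> sets (completion M)"
    by (rule completion.in_sets_AE) simp
  then show "f -` A \<inter> space (completion M) \<in> sets (completion M)" by simp
qed simp

lemma lebesgue_on_integral_compact:
  fixes \<psi> :: "'a::euclidean_space \<Rightarrow> 'b::euclidean_space"
  assumes T: "compact T" and \<psi>: "continuous_on T \<psi>"
  shows "integrable (lebesgue_on T) \<psi>"
    and "(LINT x|lebesgue_on T. \<psi> x) = (LINT x|lborel. indicator T x *\<^sub>R \<psi> x)"
proof -
  have "integrable lborel (\<lambda>x. indicator T x *\<^sub>R \<psi> x)"
    by (rule borel_integrable_compact[OF T \<psi>])
  moreover have TL: "T \<inter> space lebesgue \<in> sets lebesgue"
    using lmeasurable_compact[OF T] by (simp add: fmeasurable_def)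
  ultimately show "integrable (lebesgue_on T) \<psi>"
    by (subst integrable_restrict_space) (auto simp: integrable_completion)
  have "(\<lambda>x. indicator T x *\<^sub>R \<psi> x) \<in> borel_measurable lborel"
    using borel_integrable_compact[OF T \<psi>] by auto
  then show "(LINT x|lebesgue_on T. \<psi> x) = (LINT x|lborel. indicator T x *\<^sub>R \<psi> x)"
    using TL by (subst integral_restrict_space) (auto simp: integral_completion)
qed

definition area :: "'a::euclidean_space set \<Rightarrow> real" where
  "area S = measure (facet_measure S) S"

context simplex_facet
begin

lemma facet_integral_flat:
  fixes \<phi> :: "'a \<Rightarrow> real"
  assumes "\<phi> \<in> borel_measurable borel"
  shows "(LINT x|facet_measure S. \<phi> x) = (LINT x|flat_measure. \<phi> x)"
proof -
  have "\<phi> \<in> borel_measurable flat_measure" using assms by simp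
  then show ?thesis unfolding facet_measure_eq by (rule integral_completion)
qed

lemma area_flat: "area S = measure flat_measure UNIV"
proof -
  interpret f: finite_measure flat_measure by (rule finite_flat)
  have "area S = measure flat_measure S"
    unfolding area_def facet_measure_eq by (intro measure_completion) simp
  also have "\<dots> = measure flat_measure UNIV"
    using AE_flat_in by (intro f.finite_measure_eq_AE) auto
  finally show ?thesis .
qed

lemma flat_integrable:
  fixes \<phi> :: "'a \<Rightarrow> real"
  assumes "continuous_on UNIV \<phi>"
  shows "integrable flat_measure \<phi>"
proof -
  interpret f: finite_measure flat_measure by (rule finite_flat)
  have "bounded (\<phi> ` S)"
    using compact_continuous_image[OF continuous_on_subset[OF assms] facet_compact_convex(1)[OF facet]]
    by (simp add: compact_imp_bounded)
  then obtain B where "\<forall>x\<in>S. norm (\<phi> x) \<le> B" by (auto simp: bounded_iff)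
  then have "AE x in flat_measure. norm (\<phi> x) \<le> B"
    using AE_flat_in by (auto elim: eventually_mono)
  then show ?thesis
    using borel_measurable_continuous_onI[OF assms] by (intro f.integrable_const_bound) auto
qed

text \<open>Along each ray from the apex, \<open>t ^ (d - 1)\<close> times the integrand is the derivative of
  \<open>t ^ d * \<phi>\<close>. The constant \<open>C\<close> makes the integrand nonnegative, so that the layer formula for
  nonnegative functions applies.\<close>
lemma cone_divergence_shifted:
  fixes \<phi> :: "'a \<Rightarrow> real"
  assumes G: "\<And>x. GDERIV \<phi> x :> G x" and cG: "continuous_on UNIV G"
    and C: "\<And>x. x \<in> T \<Longrightarrow> norm (G x \<bullet> (x - z) + DIM('a) * \<phi> x) \<le> C"
  shows "(LINT x|lebesgue_on T. G x \<bullet> (x - z) + DIM('a) * \<phi> x) + C * vol T =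
    height T S * (LINT x|facet_measure S. \<phi> x) + height T S * area S * C / DIM('a)"
proof -
  let ?d = "DIM('a)"
  define \<psi> where "\<psi> x = G x \<bullet> (x - z) + ?d * \<phi> x" for x
  interpret f: finite_measure flat_measure by (rule finite_flat)
  have c\<phi>: "continuous_on UNIV \<phi>"
    using G by (auto simp: continuous_on_eq_continuous_at gderiv_def intro: has_derivative_continuous)
  have c\<psi>: "continuous_on UNIV \<psi>" unfolding \<psi>_def by (intro continuous_intros cG c\<phi>)
  have [measurable]: "\<phi> \<in> borel_measurable borel" "\<psi> \<in> borel_measurable borel"
    using c\<phi> c\<psi> by (auto intro: borel_measurable_continuous_onI)
  have C': "0 \<le> \<psi> x + C" if "x \<in> T" for x using C[OF that] unfolding \<psi>_def by auto
  have ray: "(\<integral>\<^sup>+t. indicator {0..1} t * (ennreal (t ^ (?d - 1)) * ennreal (\<psi> (z + t *\<^sub>R (s - z)) + C)) \<partial>lborel)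
      = ennreal (\<phi> s + C / ?d) \<and> 0 \<le> \<phi> s + C / ?d" if s: "s \<in> S" for s
  proof -
    define f where "f t = t ^ (?d - 1) * (\<psi> (z + t *\<^sub>R (s - z)) + C)" for t
    define F where "F t = t ^ ?d * (\<phi> (z + t *\<^sub>R (s - z)) + C / ?d)" for t
    have inT: "z + t *\<^sub>R (s - z) \<in> T" if "0 \<le> t" "t \<le> 1" for t
    proof -
      have "(1 - t) *\<^sub>R z + t *\<^sub>R s \<in> T"
        using that s facet_subset[OF facet] opp_in[OF facet] convex by (intro convexD) auto
      then show ?thesis by (simp add: algebra_simps)
    qed
    have pos: "0 \<le> f t" if "0 \<le> t" "t \<le> 1" for t
      unfolding f_def using C'[OF inT[OF that]] that by simp
    have der: "DERIV F t :> f t" for t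
    proof -
      have "((\<lambda>t. z + t *\<^sub>R (s - z)) has_derivative (\<lambda>r. r *\<^sub>R (s - z))) (at t)"
        by (auto intro!: derivative_eq_intros)
      from has_derivative_compose[OF this G[unfolded gderiv_def]]
      have "((\<lambda>t. \<phi> (z + t *\<^sub>R (s - z))) has_derivative (\<lambda>r. (r *\<^sub>R (s - z)) \<bullet> G (z + t *\<^sub>R (s - z)))) (at t)" .
      then have "DERIV (\<lambda>t. \<phi> (z + t *\<^sub>R (s - z))) t :> (s - z) \<bullet> G (z + t *\<^sub>R (s - z))"
        by (simp add: has_field_derivative_def mult.commute[of _ "(s - z) \<bullet> _"])
      then have "DERIV F t :> t ^ ?d * ((s - z) \<bullet> G (z + t *\<^sub>R (s - z)))
          + (?d * t ^ (?d - 1)) * (\<phi> (z + t *\<^sub>R (s - z)) + C / ?d)"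
        unfolding F_def by (auto intro!: derivative_eq_intros)
      moreover have "t ^ ?d = t ^ (?d - 1) * t"
        using power_Suc2[of t "?d - 1"] DIM_positive[where 'a='a] by simp
      ultimately show ?thesis
        unfolding f_def \<psi>_def using DIM_positive[where 'a='a]
        by (simp add: algebra_simps inner_commute)
    qed
    have "(\<integral>\<^sup>+t. indicator {0..1} t * (ennreal (t ^ (?d - 1)) * ennreal (\<psi> (z + t *\<^sub>R (s - z)) + C)) \<partial>lborel)
        = (\<integral>\<^sup>+t. ennreal (f t) * indicator {0..1} t \<partial>lborel)"
      by (intro nn_integral_cong) (auto simp: indicator_def f_def ennreal_mult' C' inT)
    also have "\<dots> = ennreal (F 1 - F 0)"
    proof (rule nn_integral_FTC_Icc)
      show "f \<in> borel_measurable borel" unfolding f_def by measurable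
      show "DERIV F x :> f x" for x by (rule der)
    qed (auto simp: pos)
    also have "F 1 - F 0 = \<phi> s + C / ?d" using DIM_positive[where 'a='a] by (simp add: F_def)
    finally have "(\<integral>\<^sup>+t. indicator {0..1} t * (ennreal (t ^ (?d - 1)) * ennreal (\<psi> (z + t *\<^sub>R (s - z)) + C)) \<partial>lborel)
        = ennreal (\<phi> s + C / ?d)" .
    moreover have "F 0 \<le> F 1"
      using der pos by (intro DERIV_nonneg_imp_nondecreasing[of 0 1 F]) auto
    moreover have "F 0 = 0" "F 1 = \<phi> s + C / ?d"
      unfolding F_def zero_power[OF DIM_positive] by simp_all
    ultimately show ?thesis by simp
  qed
  have iT: "integrable lborel (\<lambda>x. indicator T x *\<^sub>R (\<psi> x + C))"
    by (intro borel_integrable_compact compact continuous_intros continuous_on_subset[OF c\<psi>]) auto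
  have "ennreal (LINT x|lborel. indicator T x *\<^sub>R (\<psi> x + C)) = (\<integral>\<^sup>+x. ennreal (indicator T x *\<^sub>R (\<psi> x + C)) \<partial>lborel)"
    by (intro nn_integral_eq_integral[symmetric] iT) (auto simp: indicator_def C')
  also have "\<dots> = (\<integral>\<^sup>+x. indicator T x * ennreal (\<psi> x + C) \<partial>lborel)"
    by (intro nn_integral_cong) (auto simp: indicator_def)
  also have "\<dots> = ennreal (height T S) * (\<integral>\<^sup>+s. ennreal (\<phi> s + C / ?d) \<partial>flat_measure)"
    using ray AE_flat_in
    by (subst nn_integral_cone) (auto intro!: arg_cong2[where f="(*)"] nn_integral_cong_AE elim!: eventually_mono)
  also have "(\<integral>\<^sup>+s. ennreal (\<phi> s + C / ?d) \<partial>flat_measure) = ennreal (LINT s|flat_measure. \<phi> s + C / ?d)"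
    using ray AE_flat_in flat_integrable[OF c\<phi>]
    by (intro nn_integral_eq_integral) (auto elim!: eventually_mono)
  also have "ennreal (height T S) * \<dots> = ennreal (height T S * (LINT s|flat_measure. \<phi> s + C / ?d))"
    using height_pos[OF facet] by (simp add: ennreal_mult')
  finally have eq: "ennreal (LINT x|lborel. indicator T x *\<^sub>R (\<psi> x + C)) = ennreal (height T S * (LINT s|flat_measure. \<phi> s + C / ?d))" .
  moreover have "0 \<le> (LINT x|lborel. indicator T x *\<^sub>R (\<psi> x + C))"
    by (intro Bochner_Integration.integral_nonneg) (auto simp: indicator_def C')
  moreover have "0 \<le> (LINT s|flat_measure. \<phi> s + C / ?d)"
    using ray AE_flat_in by (intro integral_nonneg_AE) (auto elim!: eventually_mono)
  ultimately have "(LINT x|lborel. indicator T x *\<^sub>R (\<psi> x + C)) = height T S * (LINT s|flat_measure. \<phi> s + C / ?d)"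
    using height_pos[OF facet] by simp
  also have "(LINT s|flat_measure. \<phi> s + C / ?d) = (LINT s|flat_measure. \<phi> s) + C / ?d * area S"
    using flat_integrable[OF c\<phi>] by (simp add: area_flat)
  also have "(LINT x|lborel. indicator T x *\<^sub>R (\<psi> x + C)) = (LINT x|lebesgue_on T. \<psi> x + C)"
    by (intro lebesgue_on_integral_compact(2)[symmetric] compact continuous_intros continuous_on_subset[OF c\<psi>]) auto
  also have "\<dots> = (LINT x|lebesgue_on T. \<psi> x) + C * vol T"
  proof -
    have "integrable (lebesgue_on T) \<psi>" "integrable (lebesgue_on T) (\<lambda>_. C)"
      by (intro lebesgue_on_integral_compact(1) compact continuous_intros continuous_on_subset[OF c\<psi>]; simp)+
    then show ?thesis using lmeasurable by (simp add: measure_restrict_space fmeasurable_def)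
  qed
  finally have "(LINT x|lebesgue_on T. \<psi> x) + C * vol T
      = height T S * (LINT s|flat_measure. \<phi> s) + height T S * area S * C / ?d"
    by (simp add: algebra_simps)
  then show ?thesis unfolding \<psi>_def by (simp add: facet_integral_flat)
qed

text \<open>The constant \<open>C\<close> is free when \<open>\<phi>\<close> vanishes, which gives the volume of a cone.\<close>
lemma volume: "vol T = height T S * area S / DIM('a)"
  using cone_divergence_shifted[of "\<lambda>_. 0" "\<lambda>_. 0" 1] by (simp add: GDERIV_const)

lemma area_pos: "0 < area S"
  using volume measure_pos height_pos[OF facet] DIM_positive[where 'a='a]
  by (simp add: zero_less_mult_iff zero_less_divide_iff)

lemma cone_divergence:
  fixes \<phi> :: "'a \<Rightarrow> real"
  assumes G: "\<And>x. GDERIV \<phi> x :> G x" and cG: "continuous_on UNIV G"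
  shows "(LINT x|lebesgue_on T. G x \<bullet> (x - z) + DIM('a) * \<phi> x) =
    height T S * (LINT x|facet_measure S. \<phi> x)"
proof -
  let ?\<psi> = "\<lambda>x. G x \<bullet> (x - z) + DIM('a) * \<phi> x"
  have c\<phi>: "continuous_on UNIV \<phi>"
    using G by (auto simp: continuous_on_eq_continuous_at gderiv_def intro: has_derivative_continuous)
  have "continuous_on T ?\<psi>"
    by (intro continuous_intros continuous_on_subset[OF cG] continuous_on_subset[OF c\<phi>]) auto
  then have "bounded (?\<psi> ` T)"
    using compact_continuous_image compact compact_imp_bounded by blast
  then obtain C where C: "\<And>x. x \<in> T \<Longrightarrow> norm (?\<psi> x) \<le> C" by (auto simp: bounded_iff)
  show ?thesis using cone_divergence_shifted[OF G cG C] volume by (simp add: algebra_simps)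
qed

lemma finite_facet_measure: "finite_measure (facet_measure S)"
    and space_facet_measure: "space (facet_measure S) = UNIV"
    and measure_facet_measure: "measure (facet_measure S) UNIV = area S"
proof -
  interpret f: finite_measure flat_measure by (rule finite_flat)
  show "finite_measure (facet_measure S)"
    unfolding facet_measure_eq by (intro finite_measureI) (simp add: f.emeasure_finite)
  show "space (facet_measure S) = UNIV" unfolding facet_measure_eq by simp
  show "measure (facet_measure S) UNIV = area S"
    unfolding facet_measure_eq area_flat by (intro measure_completion) simp
qed

lemma integral_const: "(LINT x|facet_measure S. c) = area S * (c::real)"
  using finite_facet_measure space_facet_measure measure_facet_measure by simp

text \<open>The facet measure is complete, so \<open>f\<close> inherits measurability from \<open>g\<close>.\<close>
lemma integral_AE_cong:
  fixes f :: "'a \<Rightarrow> real"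
  assumes "AE x in facet_measure S. f x = g x" and g: "g \<in> borel_measurable borel"
  shows "(LINT x|facet_measure S. f x) = (LINT x|facet_measure S. g x)"
proof -
  have gm: "g \<in> borel_measurable (facet_measure S)"
    unfolding facet_measure_eq using g by (intro measurable_completion) simp
  have fm: "f \<in> borel_measurable (facet_measure S)"
    using borel_measurable_AE_completion[where M=flat_measure and f=f and g=g] assms(1) gm unfolding facet_measure_eq by blast
  show ?thesis using fm gm assms(1) by (intro integral_cong_AE)
qed

lemma AE_facet_ex:
  assumes "AE x in facet_measure S. P x"
  shows "\<exists>x \<in> rel_interior S. P x"
proof (rule ccontr)
  assume "\<not> (\<exists>x \<in> rel_interior S. P x)"
  then have "AE x in facet_measure S. False"
    by (intro eventually_elim2[OF assms AE_facet_rel_interior]) blast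
  then have "UNIV \<in> null_sets (completion flat_measure)"
    unfolding facet_measure_eq completion.AE_iff_null_sets by simp
  then have "emeasure (facet_measure S) UNIV = 0"
    unfolding facet_measure_eq by blast
  then show False using measure_facet_measure area_pos by (simp add: measure_def)
qed

text \<open>The coordinate \<open>\<lambda>\<close> of \<open>z\<close> vanishes on \<open>S\<close> and satisfies \<open>grad \<lambda> \<bullet> (x - z) = \<lambda> - 1\<close>, so the divergence
  theorem determines its integral. Since all coordinates have the same mean, the centroid of \<open>T\<close> is
  the mean of the vertices.\<close>
lemma integral_bcoord_opp: "(LINT x|lebesgue_on T. bcoord T z x) = vol T / (DIM('a) + 1)"
proof -
  have D: "GDERIV (bcoord T z) x :> bgrad T z" for x
    unfolding bcoord_def[abs_def] gderiv_def
    by (auto intro!: derivative_eq_intros simp: inner_commute)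
  have "(LINT x|facet_measure S. bcoord T z x) = (LINT x|facet_measure S. 0)"
  proof (rule integral_AE_cong)
    show "AE x in facet_measure S. bcoord T z x = 0"
      using AE_facet_rel_interior by eventually_elim (use facet_rel_interior_iff[OF facet] in auto)
  qed simp
  then have "(LINT x|lebesgue_on T. bgrad T z \<bullet> (x - z) + DIM('a) * bcoord T z x) = 0"
    using cone_divergence[OF D] by simp
  also have "(\<lambda>x. bgrad T z \<bullet> (x - z) + DIM('a) * bcoord T z x) = (\<lambda>x. (real DIM('a) + 1) * bcoord T z x - 1)"
    by (auto simp: bcoord_def algebra_simps)
  also have "(LINT x|lebesgue_on T. (real DIM('a) + 1) * bcoord T z x - 1) =
     (real DIM('a) + 1) * (LINT x|lebesgue_on T. bcoord T z x) - vol T"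
  proof -
    have "integrable (lebesgue_on T) (bcoord T z)" "integrable (lebesgue_on T) (\<lambda>_. 1::real)"
      by (intro lebesgue_on_integral_compact(1) compact continuous_on_bcoord continuous_intros)+
    then show ?thesis using lmeasurable by (simp add: measure_restrict_space fmeasurable_def)
  qed
  finally show ?thesis by (simp add: field_simps)
qed

end

context full_simplex
begin

lemma integral_bcoord:
  assumes "v \<in> verts T"
  shows "(LINT x|lebesgue_on T. bcoord T v x) = vol T / (DIM('a) + 1)"
proof -
  interpret s: simplex_facet T "convex hull (verts T - {v})"
    by unfold_locales (rule facet_of_vertex[OF assms])
  show ?thesis using s.integral_bcoord_opp opp_convex_hull[OF assms refl facet_of_vertex[OF assms]] by simp
qed

lemma barycenter_verts: "barycenter T = (1 / (DIM('a) + 1)) *\<^sub>R \<Sum>(verts T)"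
  unfolding barycenter_def verts_def[symmetric] verts(2) by (simp add: divide_inverse)

lemma integral_id: "(LINT x|lebesgue_on T. x) = vol T *\<^sub>R barycenter T"
proof -
  have "(LINT x|lebesgue_on T. x) = (LINT x|lebesgue_on T. (\<Sum>v\<in>verts T. bcoord T v x *\<^sub>R v))"
    by (simp only: bcoord_reconstruct)
  also have "\<dots> = (\<Sum>v\<in>verts T. LINT x|lebesgue_on T. bcoord T v x *\<^sub>R v)"
    by (intro Bochner_Integration.integral_sum lebesgue_on_integral_compact(1) compact continuous_intros continuous_on_bcoord)
  also have "\<dots> = (\<Sum>v\<in>verts T. (vol T / (DIM('a) + 1)) *\<^sub>R v)"
  proof (intro sum.cong refl)
    fix v assume v: "v \<in> verts T"
    have "integrable (lebesgue_on T) (bcoord T v)"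
      by (intro lebesgue_on_integral_compact(1) compact continuous_on_bcoord)
    then show "(LINT x|lebesgue_on T. bcoord T v x *\<^sub>R v) = (vol T / (DIM('a) + 1)) *\<^sub>R v"
      using integral_bcoord[OF v] by simp
  qed
  finally show ?thesis unfolding barycenter_verts scaleR_sum_right[symmetric] by simp
qed

lemma measure_lebesgue_on [simp]: "measure (lebesgue_on T) T = vol T"
  using lmeasurable by (simp add: measure_restrict_space fmeasurable_def)

lemma integral_one: "(LINT x|lebesgue_on T. c) = vol T *\<^sub>R (c :: 'b::euclidean_space)"
  using lmeasurable by (simp add: measure_restrict_space fmeasurable_def)

lemma integrable_affine:
  "integrable (lebesgue_on T) (\<lambda>x. c :: 'b::euclidean_space)"
  "integrable (lebesgue_on T) (\<lambda>x. x)"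
  by (intro lebesgue_on_integral_compact(1) compact continuous_intros)+

lemma integral_affine:
  "(LINT x|lebesgue_on T. a + g \<bullet> x) = vol T * (a + g \<bullet> barycenter T)"
proof -
  have "(LINT x|lebesgue_on T. a + g \<bullet> x) = (LINT x|lebesgue_on T. a) + (LINT x|lebesgue_on T. g \<bullet> x)"
    by (intro Bochner_Integration.integral_add integrable_affine integrable_inner_right)
  also have "(LINT x|lebesgue_on T. g \<bullet> x) = g \<bullet> (LINT x|lebesgue_on T. x)"
    by (intro integral_inner_right) (simp add: integrable_affine)
  finally show ?thesis by (simp add: integral_id integral_one algebra_simps)
qed

lemma elem_mean_cong: "(\<And>x. x \<in> T \<Longrightarrow> w x = w' x) \<Longrightarrow> elem_mean T w = elem_mean T w'"
  unfolding elem_mean_def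
  by (intro arg_cong2[where f="(/\<^sub>R)"] Bochner_Integration.integral_cong refl) simp

lemma elem_mean_affine:
  assumes "\<And>x. x \<in> T \<Longrightarrow> q x = a + g \<bullet> x"
  shows "elem_mean T q = a + g \<bullet> barycenter T"
  using elem_mean_cong[of q "\<lambda>x. a + g \<bullet> x"] assms measure_pos
  by (simp add: elem_mean_def[of T "\<lambda>x. a + g \<bullet> x"] integral_affine)

lemma elem_mean_RT:
  assumes "\<And>x. x \<in> T \<Longrightarrow> w x = a + c *\<^sub>R x"
  shows "elem_mean T w = a + c *\<^sub>R barycenter T"
proof -
  have "(LINT x|lebesgue_on T. a + c *\<^sub>R x) = vol T *\<^sub>R (a + c *\<^sub>R barycenter T)"
  proof -
    have "(LINT x|lebesgue_on T. a + c *\<^sub>R x) = (LINT x|lebesgue_on T. a) + (LINT x|lebesgue_on T. c *\<^sub>R x)"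
      by (intro Bochner_Integration.integral_add integrable_affine integrable_scaleR_right)
    then show ?thesis by (simp add: integral_id algebra_simps)
  qed
  then show ?thesis using elem_mean_cong[of w "\<lambda>x. a + c *\<^sub>R x"] assms measure_pos
    by (simp add: elem_mean_def[of T "\<lambda>x. a + c *\<^sub>R x"])
qed

end

context simplex_facet
begin

lemma barycenter_facet: "b - barycenter T = (1 / DIM('a)) *\<^sub>R (barycenter T - z)"
proof -
  have "\<Sum>(verts T) = \<Sum>(verts S) + z"
    using sum.remove[OF finite_verts opp(1)[OF facet], of "\<lambda>v. v"] verts_facet[OF facet] by (simp add: add.commute)
  moreover have "\<Sum>(verts S) = real DIM('a) *\<^sub>R b"
    unfolding barycenter_def verts_def[symmetric] card_verts_facet by simp
  moreover have "\<Sum>(verts T) = (real DIM('a) + 1) *\<^sub>R barycenter T"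
    unfolding barycenter_verts by (simp add: add_eq_0_iff add.commute)
  ultimately have "(real DIM('a) + 1) *\<^sub>R barycenter T = real DIM('a) *\<^sub>R b + z" by simp
  then have "barycenter T - z = real DIM('a) *\<^sub>R (b - barycenter T)" by (simp add: algebra_simps)
  then show ?thesis by simp
qed

text \<open>Apply the divergence theorem to an affine function: this expresses the centroid of \<open>S\<close> by
  that of \<open>T\<close>.\<close>
lemma facet_integral_affine:
  "(LINT x|facet_measure S. a + g \<bullet> x) = area S * (a + g \<bullet> b)"
proof -
  let ?d = "real DIM('a)"
  have "GDERIV (\<lambda>x. a + g \<bullet> x) x :> g" for x
    unfolding gderiv_def by (auto intro!: derivative_eq_intros simp: inner_commute)
  from cone_divergence[OF this]
  have "height T S * (LINT x|facet_measure S. a + g \<bullet> x) = (LINT x|lebesgue_on T. g \<bullet> (x - z) + ?d * (a + g \<bullet> x))"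
    by simp
  also have "(\<lambda>x. g \<bullet> (x - z) + ?d * (a + g \<bullet> x)) = (\<lambda>x. (?d * a - g \<bullet> z) + ((1 + ?d) *\<^sub>R g) \<bullet> x)"
    by (auto simp: algebra_simps)
  also have "(LINT x|lebesgue_on T. (?d * a - g \<bullet> z) + ((1 + ?d) *\<^sub>R g) \<bullet> x)
      = vol T * (?d * a + g \<bullet> (?d *\<^sub>R barycenter T + (barycenter T - z)))"
    by (subst integral_affine) (simp add: algebra_simps)
  also have "?d *\<^sub>R barycenter T + (barycenter T - z) = ?d *\<^sub>R b"
  proof -
    have "barycenter T - z = ?d *\<^sub>R (b - barycenter T)" unfolding barycenter_facet by simp
    then show ?thesis by (simp add: algebra_simps)
  qed
  also have "vol T * (?d * a + g \<bullet> (?d *\<^sub>R b)) = height T S * (area S * (a + g \<bullet> b))"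
    unfolding volume by (simp add: field_simps)
  finally show ?thesis using height_pos[OF facet] by simp
qed

lemma facet_mean_affine:
  assumes "\<And>x. x \<in> S \<Longrightarrow> q x = a + g \<bullet> x"
  shows "(LINT x|facet_measure S. q x) = area S * q b" and "facet_mean S q = q b"
proof -
  have "(LINT x|facet_measure S. q x) = (LINT x|facet_measure S. a + g \<bullet> x)"
  proof (rule integral_AE_cong)
    show "AE x in facet_measure S. q x = a + g \<bullet> x"
      using AE_facet_rel_interior by eventually_elim (use assms rel_interior_subset in blast)
  qed (intro borel_measurable_continuous_onI continuous_intros)
  then show *: "(LINT x|facet_measure S. q x) = area S * q b"
    using facet_integral_affine assms[OF barycenter_in] by simp
  show "facet_mean S q = q b" unfolding facet_mean_def * area_def[symmetric] using area_pos by simp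
qed

end

section \<open>Meshes of Lipschitz domains\<close>

text \<open>A Lipschitz domain does not lie on both sides of its boundary: directly below the graph
  there are points outside the closure.\<close>
lemma lipschitz_interior_closure:
  assumes "lipschitz_boundary \<Omega>" "open \<Omega>"
  shows "interior (closure \<Omega>) = \<Omega>"
proof
  show "\<Omega> \<subseteq> interior (closure \<Omega>)" using assms(2) closure_subset interior_maximal by blast
  show "interior (closure \<Omega>) \<subseteq> \<Omega>"
  proof (rule ccontr)
    assume "\<not> interior (closure \<Omega>) \<subseteq> \<Omega>"
    then obtain y where y: "y \<in> interior (closure \<Omega>)" "y \<notin> \<Omega>" by blast
    then have "y \<in> frontier \<Omega>"
      using interior_subset[of "closure \<Omega>"] interior_open[OF assms(2)] unfolding frontier_def by blast
    note ex = bspec[OF assms(1)[unfolded lipschitz_boundary_def] this]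
    obtain U e \<gamma> L where U: "open U" "y \<in> U" "norm e = 1" "L-lipschitz_on UNIV \<gamma>"
        "\<Omega> \<inter> U = {y \<in> U. \<gamma> (y - (y \<bullet> e) *\<^sub>R e) < y \<bullet> e}"
      using ex by (elim exE conjE) (rule that)
    have U5: "x \<in> \<Omega> \<and> x \<in> U \<longleftrightarrow> x \<in> U \<and> \<gamma> (x - (x \<bullet> e) *\<^sub>R e) < x \<bullet> e" for x
      using arg_cong[OF U(5), of "\<lambda>A. x \<in> A"] by simp
    have ee: "e \<bullet> e = 1" using U(3) by (simp add: dot_square_norm)
    have c\<gamma>: "continuous_on UNIV \<gamma>" using U(4) by (rule lipschitz_on_continuous_on)
    have "open (U \<inter> interior (closure \<Omega>))" using U(1) by blast
    moreover have "y \<in> U \<inter> interior (closure \<Omega>)" using U(2) y(1) by blast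
    ultimately obtain r where r: "r > 0" "ball y r \<subseteq> U \<inter> interior (closure \<Omega>)"
      by (rule openE)
    define w where "w = y - (r/2) *\<^sub>R e"
    have "dist y w = r / 2" using r(1) U(3) by (simp add: w_def dist_norm)
    then have w: "w \<in> U" "w \<in> interior (closure \<Omega>)" using r by auto
    define W where "W = U \<inter> {x. x \<bullet> e < \<gamma> (x - (x \<bullet> e) *\<^sub>R e)}"
    have "open W" unfolding W_def
      by (intro open_Int U(1) open_Collect_less continuous_intros continuous_on_compose2[OF c\<gamma>]) auto
    moreover have "W \<inter> \<Omega> = {}"
    proof -
      have "\<not> x \<bullet> e < \<gamma> (x - (x \<bullet> e) *\<^sub>R e)" if "x \<in> \<Omega>" "x \<in> U" for x
        using that U5[of x] by simp
      then show ?thesis unfolding W_def by blast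
    qed
    ultimately have "W \<inter> closure \<Omega> = {}" by (simp add: open_Int_closure_eq_empty)
    moreover have "w \<in> W"
    proof -
      have "w - (w \<bullet> e) *\<^sub>R e = y - (y \<bullet> e) *\<^sub>R e" by (simp add: w_def inner_diff_left ee algebra_simps)
      moreover have "y \<bullet> e \<le> \<gamma> (y - (y \<bullet> e) *\<^sub>R e)" using U(2) U5[of y] y(2) by auto
      moreover have "w \<bullet> e = y \<bullet> e - r / 2" by (simp add: w_def inner_diff_left ee)
      ultimately show ?thesis unfolding W_def using r(1) w(1) by simp
    qed
    ultimately show False using w(2) interior_subset by blast
  qed
qed

text \<open>Different unit vectors would be separated by the direction \<open>m - n\<close>, on which \<open>n\<close> is negative and
  \<open>m\<close> is positive.\<close>
lemma half_ball_normal_unique: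
  fixes n m :: "'a::real_inner"
  assumes n: "norm n = 1" and m: "norm m = 1" and r: "0 < r"
    and sub: "\<And>y. y \<in> ball x r \<Longrightarrow> (y - x) \<bullet> n < 0 \<Longrightarrow> (y - x) \<bullet> m < 0"
  shows "n = m"
proof (rule ccontr)
  assume "n \<noteq> m"
  then have "0 < (n - m) \<bullet> (n - m)" by simp
  moreover have "n \<bullet> n = 1" "m \<bullet> m = 1" using n m by (simp_all add: dot_square_norm)
  ultimately have lt: "n \<bullet> m < 1"
    by (simp add: inner_diff_left inner_diff_right inner_commute[of m n])
  define t where "t = r / 3"
  have t: "0 < t" using r by (simp add: t_def)
  have "norm (m - n) \<le> 2" using norm_triangle_ineq4[of m n] n m by simp
  then have "t * norm (m - n) \<le> t * 2" using t by (intro mult_left_mono) auto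
  then have "t * norm (m - n) < r" using r by (simp add: t_def)
  then have "x + t *\<^sub>R (m - n) \<in> ball x r" using t by (simp add: dist_norm)
  moreover have "(x + t *\<^sub>R (m - n) - x) \<bullet> n < 0" using lt t n
    by (simp add: inner_diff_left dot_square_norm inner_commute[of m n] mult_less_0_iff)
  ultimately have "(x + t *\<^sub>R (m - n) - x) \<bullet> m < 0" by (rule sub)
  then show False using lt t m
    by (simp add: inner_diff_left dot_square_norm mult_less_0_iff)
qed

context simplex_facet
begin

text \<open>The normal \<open>nrml\<close> depends on \<open>S\<close> alone, so the outer normals of two elements with the common
  facet \<open>S\<close> are equal or opposite.\<close>
lemma outer_normal_nrml: "outer_normal T S = nrml \<or> outer_normal T S = - nrml"
proof -
  have "sgn nrml = sgn (- h) *\<^sub>R sgn (bgrad T z)"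
    by (subst nrml_bgrad) (rule sgn_scaleR)
  moreover have "sgn nrml = nrml" using nrml(1) by (simp add: sgn_div_norm)
  ultimately have "nrml = sgn h *\<^sub>R outer_normal T S"
    by (simp add: outer_normal_def sgn_minus)
  then show ?thesis using h_nz by (cases "0 < h") (auto simp: sgn_real_def)
qed

end

locale mesh =
  fixes \<Omega> :: "(real^'n) set" and \<T> :: "(real^'n) set set"
  assumes domain: "polyhedral_lipschitz_domain \<Omega>" and mesh: "conforming_mesh \<Omega> \<T>"
begin

lemma open_\<Omega>: "open \<Omega>" and bounded_\<Omega>: "bounded \<Omega>" and lip: "lipschitz_boundary \<Omega>"
  using domain unfolding polyhedral_lipschitz_domain_def by auto

lemma regular: "interior (closure \<Omega>) = \<Omega>"
  by (rule lipschitz_interior_closure[OF lip open_\<Omega>])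

lemma frontier_disjoint: "x \<in> frontier \<Omega> \<Longrightarrow> x \<notin> \<Omega>"
  using open_\<Omega> by (auto simp: frontier_def interior_open)

lemma finite_\<T>: "finite \<T>" and Union_\<T>: "\<Union>\<T> = closure \<Omega>"
  and simplexI: "T \<in> \<T> \<Longrightarrow> full_simplex T"
  and face_Int: "T \<in> \<T> \<Longrightarrow> T' \<in> \<T> \<Longrightarrow> (T \<inter> T') face_of T"
  using mesh unfolding conforming_mesh_def triangulation_def full_simplex_def by auto

lemma face_Int': "T \<in> \<T> \<Longrightarrow> T' \<in> \<T> \<Longrightarrow> (T \<inter> T') face_of T'"
  using face_Int[of T' T] by (simp add: Int_commute)

lemma facetI: "T \<in> \<T> \<Longrightarrow> S facet_of T \<Longrightarrow> simplex_facet T S"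
  using simplexI unfolding simplex_facet_def simplex_facet_axioms_def by auto

lemma aff_dim_T: "T \<in> \<T> \<Longrightarrow> aff_dim T = int CARD('n)"
  using full_simplex.aff_dim[OF simplexI] by simp

lemma aff_dim_facet: "T \<in> \<T> \<Longrightarrow> S facet_of T \<Longrightarrow> aff_dim S = int CARD('n) - 1"
  using aff_dim_T by (simp add: facet_of_def)

text \<open>The intersection of two elements is a face of both, and a face that meets the interior is the
  whole element.\<close>
lemma interior_disjoint:
  assumes "T \<in> \<T>" "T' \<in> \<T>" "T \<noteq> T'"
  shows "interior T \<inter> T' = {}"
proof (rule ccontr)
  interpret t: full_simplex T by (rule simplexI[OF assms(1)])
  interpret t': full_simplex T' by (rule simplexI[OF assms(2)])
  assume "interior T \<inter> T' \<noteq> {}"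
  then have "(T \<inter> T') \<inter> rel_interior T \<noteq> {}" unfolding t.rel_interior_eq using interior_subset by blast
  then have "T \<subseteq> T \<inter> T'" using subset_of_face_of[OF face_Int[OF assms(1,2)] order_refl] by blast
  then have "T face_of T'" using face_Int'[OF assms(1,2)] by (simp add: inf.absorb1)
  then have "aff_dim T < aff_dim T'" using face_of_aff_dim_lt t'.convex assms(3) by blast
  then show False using aff_dim_T assms by simp
qed

lemma interior_subset_\<Omega>: "T \<in> \<T> \<Longrightarrow> interior T \<subseteq> \<Omega>"
  using Union_\<T> interior_mono[of T "closure \<Omega>"] regular by blast

lemma negligible_skeleton: "negligible (\<Union>T\<in>\<T>. T - interior T)"
proof (intro negligible_Union finite_imageI finite_\<T>)
  fix N assume "N \<in> (\<lambda>T. T - interior T) ` \<T>"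
  then obtain T where T: "T \<in> \<T>" "N = T - interior T" by blast
  interpret full_simplex T by (rule simplexI[OF T(1)])
  show "negligible N" unfolding T(2)
    using negligible_convex_frontier[OF convex] closed by (simp add: frontier_def)
qed

lemma glue_interior:
  assumes "T \<in> \<T>" "x \<in> interior T"
  shows "glue \<T> w x = w T x"
proof -
  have "(THE T. T \<in> \<T> \<and> x \<in> interior T) = T"
  proof (rule the_equality)
    show "T \<in> \<T> \<and> x \<in> interior T" using assms by blast
    show "T' = T" if "T' \<in> \<T> \<and> x \<in> interior T'" for T'
      using that assms interior_disjoint[of T T'] interior_subset by blast
  qed
  then show ?thesis unfolding glue_def using assms by auto
qed

text \<open>The interiors of the elements are disjoint and exhaust the domain up to the null set formed by
  the frontiers of the elements.\<close>
lemma integral_pieces: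
  fixes F :: "real^'n \<Rightarrow> 'b::euclidean_space"
  assumes F: "\<And>T x. T \<in> \<T> \<Longrightarrow> x \<in> interior T \<Longrightarrow> F x = w T x"
    and w: "\<And>T. T \<in> \<T> \<Longrightarrow> integrable (lebesgue_on T) (w T)"
  shows "integrable (lebesgue_on \<Omega>) F"
    and "(LINT x|lebesgue_on \<Omega>. F x) = (\<Sum>T\<in>\<T>. LINT x|lebesgue_on T. w T x)"
proof -
  have \<Omega>L: "\<Omega> \<inter> space lebesgue \<in> sets lebesgue" using open_\<Omega> by auto
  have TL: "T \<inter> space lebesgue \<in> sets lebesgue" if "T \<in> \<T>" for T
    using full_simplex.lmeasurable[OF simplexI[OF that]] by (simp add: fmeasurable_def)
  have iT: "integrable lebesgue (\<lambda>x. indicator T x *\<^sub>R w T x)" if "T \<in> \<T>" for T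
    using w[OF that] TL[OF that] by (simp add: integrable_restrict_space)
  define R where "R x = (\<Sum>T\<in>\<T>. indicator T x *\<^sub>R w T x)" for x
  have iR: "integrable lebesgue R" unfolding R_def[abs_def] using iT by auto
  have "(\<Union>T\<in>\<T>. T - interior T) \<in> null_sets lebesgue"
    using negligible_skeleton by (simp add: negligible_iff_null_sets)
  then have "AE x in lebesgue. x \<notin> (\<Union>T\<in>\<T>. T - interior T)" by (rule AE_not_in)
  then have ae: "AE x in lebesgue. indicator \<Omega> x *\<^sub>R F x = R x"
  proof eventually_elim
    fix x assume x: "x \<notin> (\<Union>T\<in>\<T>. T - interior T)"
    show "indicator \<Omega> x *\<^sub>R F x = R x"
    proof (cases "\<exists>T\<in>\<T>. x \<in> T")
      case True
      then obtain T where T: "T \<in> \<T>" "x \<in> interior T" using x by blast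
      then have "R x = (\<Sum>T'\<in>\<T>. if T' = T then w T x else 0)"
        unfolding R_def using interior_disjoint[OF T(1)] interior_subset[of T]
        by (intro sum.cong) (auto simp: indicator_def)
      then have "R x = w T x" using T finite_\<T> by simp
      moreover have "x \<in> \<Omega>" using T interior_subset_\<Omega> by blast
      ultimately show ?thesis using F[OF T] by simp
    next
      case False
      then have "x \<notin> \<Omega>" using Union_\<T> closure_subset by blast
      then show ?thesis using False by (auto simp: R_def intro!: sum.neutral)
    qed
  qed
  have m: "(\<lambda>x. indicator \<Omega> x *\<^sub>R F x) \<in> borel_measurable lebesgue"
    by (rule borel_measurable_AE_completion[OF ae]) (use iR in auto)
  then have "integrable lebesgue (\<lambda>x. indicator \<Omega> x *\<^sub>R F x)"
    by (subst integrable_cong_AE[OF m _ ae]) (use iR in auto)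
  then show "integrable (lebesgue_on \<Omega>) F" using \<Omega>L by (simp add: integrable_restrict_space)
  have "(LINT x|lebesgue_on \<Omega>. F x) = (LINT x|lebesgue. indicator \<Omega> x *\<^sub>R F x)"
    using \<Omega>L by (rule integral_restrict_space)
  also have "\<dots> = (LINT x|lebesgue. R x)" using m ae iR by (intro integral_cong_AE) auto
  also have "\<dots> = (\<Sum>T\<in>\<T>. LINT x|lebesgue. indicator T x *\<^sub>R w T x)"
    unfolding R_def by (intro Bochner_Integration.integral_sum iT)
  also have "\<dots> = (\<Sum>T\<in>\<T>. LINT x|lebesgue_on T. w T x)"
    using TL by (intro sum.cong refl integral_restrict_space[symmetric])
  finally show "(LINT x|lebesgue_on \<Omega>. F x) = (\<Sum>T\<in>\<T>. LINT x|lebesgue_on T. w T x)" .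
qed

lemma L2_inner_pieces:
  fixes v w :: "real^'n \<Rightarrow> 'b::euclidean_space"
  assumes "\<And>T x. T \<in> \<T> \<Longrightarrow> x \<in> interior T \<Longrightarrow> v x = v' T x"
    "\<And>T x. T \<in> \<T> \<Longrightarrow> x \<in> interior T \<Longrightarrow> w x = w' T x"
    "\<And>T. T \<in> \<T> \<Longrightarrow> continuous_on T (v' T)" "\<And>T. T \<in> \<T> \<Longrightarrow> continuous_on T (w' T)"
  shows "L2_inner \<Omega> v w = (\<Sum>T\<in>\<T>. LINT x|lebesgue_on T. v' T x \<bullet> w' T x)"
  unfolding L2_inner_def
  by (rule integral_pieces(2))
     (auto simp: assms intro!: lebesgue_on_integral_compact(1) full_simplex.compact simplexI continuous_intros assms)

lemma L2_inner_glue0: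
  "L2_inner \<Omega> (glue0 \<T> c) (glue0 \<T> d) = (\<Sum>T\<in>\<T>. vol T * (c T \<bullet> (d T :: 'b::euclidean_space)))"
  by (subst L2_inner_pieces[where v'="\<lambda>T x. c T" and w'="\<lambda>T x. d T"])
     (auto simp: glue_interior full_simplex.measure_lebesgue_on[OF simplexI] intro!: sum.cong)

text \<open>By conformity the intersection of two facets is a face of both, and a face that contains a
  relative interior point is the whole facet.\<close>
lemma facet_eq:
  assumes T: "T \<in> \<T>" "S facet_of T" and T': "T' \<in> \<T>" "S' facet_of T'"
    and x: "x \<in> rel_interior S" "x \<in> S'"
  shows "S = S'"
proof -
  have fS: "S face_of T" "S' face_of T'" using assms by (auto simp: facet_of_def)
  have "S \<inter> (T \<inter> T') face_of T" using fS(1) face_Int[OF T(1) T'(1)] by (rule face_of_Int)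
  moreover have "S' \<inter> (T \<inter> T') face_of T'" using fS(2) face_Int'[OF T(1) T'(1)] by (rule face_of_Int)
  ultimately have f1: "S \<inter> (T \<inter> T') face_of (T \<inter> T')" "S' \<inter> (T \<inter> T') face_of (T \<inter> T')"
    by (auto intro: face_of_subset)
  have SS: "S \<inter> S' = (S \<inter> (T \<inter> T')) \<inter> (S' \<inter> (T \<inter> T'))"
    using fS face_of_imp_subset by blast
  have f2: "S \<inter> S' face_of (T \<inter> T')" unfolding SS using f1 by (rule face_of_Int)
  have "S \<inter> S' face_of T" "S \<inter> S' face_of T'"
    using face_of_trans[OF f2] face_Int[OF T(1) T'(1)] face_Int'[OF T(1) T'(1)] by auto
  then have "S \<inter> S' face_of S" "S \<inter> S' face_of S'"
    using fS face_of_imp_subset by (auto intro: face_of_subset)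
  moreover have "S \<subseteq> S \<inter> S'"
    using subset_of_face_of[OF \<open>S \<inter> S' face_of S\<close> order_refl] x rel_interior_subset by blast
  ultimately have "S face_of S'" by (simp add: inf.absorb1)
  then show ?thesis
    using face_of_aff_dim_lt[of S' S] face_of_imp_convex[OF fS(2)] aff_dim_facet[OF T] aff_dim_facet[OF T'] by auto
qed

text \<open>Two elements with a common facet that lie on the same side of it overlap. If they lie on opposite
  sides, they fill a ball around a point of the facet, so that this point is interior to the closure
  of the domain, hence no boundary point.\<close>
lemma bd_facet_unique:
  assumes T: "T \<in> \<T>" "S facet_of T" and T': "T' \<in> \<T>" "S facet_of T'" and bd: "S \<subseteq> frontier \<Omega>"
  shows "T = T'"
proof (rule ccontr)
  assume neq: "T \<noteq> T'"
  interpret t: simplex_facet T S by (rule facetI[OF T])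
  interpret t': simplex_facet T' S by (rule facetI[OF T'])
  obtain x where x: "x \<in> rel_interior S" using t.rel_interior_facet_ne[OF T(2)] by blast
  obtain r1 where r1: "r1 > 0" "T \<inter> ball x r1 = {y \<in> ball x r1. (y - x) \<bullet> outer_normal T S \<le> 0}"
    using t.local_half_ball[OF T(2) x] by blast
  obtain r2 where r2: "r2 > 0" "T' \<inter> ball x r2 = {y \<in> ball x r2. (y - x) \<bullet> outer_normal T' S \<le> 0}"
    using t'.local_half_ball[OF T'(2) x] by blast
  define r where "r = min r1 r2"
  have r: "0 < r" "ball x r \<subseteq> ball x r1" "ball x r \<subseteq> ball x r2" using r1 r2 by (auto simp: r_def)
  have "outer_normal T' S = outer_normal T S \<or> outer_normal T' S = - outer_normal T S"
    using t.outer_normal_nrml t'.outer_normal_nrml by auto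
  then show False
  proof
    assume eq: "outer_normal T' S = outer_normal T S"
    let ?n = "outer_normal T S"
    let ?H = "{y \<in> ball x r. (y - x) \<bullet> ?n < 0}"
    have "?H = ball x r \<inter> {y. (y - x) \<bullet> ?n < 0}" by auto
    then have "open ?H" by (auto intro!: open_Int open_Collect_less continuous_intros)
    moreover have "?H \<subseteq> {y \<in> ball x r1. (y - x) \<bullet> ?n \<le> 0}" "?H \<subseteq> {y \<in> ball x r2. (y - x) \<bullet> ?n \<le> 0}"
      using r(2,3) by auto
    then have "?H \<subseteq> T" "?H \<subseteq> T'" using r1(2) r2(2)[unfolded eq] by blast+
    moreover have "x - (r/2) *\<^sub>R ?n \<in> ?H"
      using r(1) t.norm_outer_normal[OF T(2)] by (simp add: dist_norm dot_square_norm)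
    ultimately have "interior T \<inter> T' \<noteq> {}" using interior_maximal by blast
    then show False using interior_disjoint[OF T(1) T'(1) neq] by blast
  next
    assume eq: "outer_normal T' S = - outer_normal T S"
    have "ball x r \<subseteq> T \<union> T'"
    proof
      fix y assume y: "y \<in> ball x r"
      have "(y - x) \<bullet> outer_normal T S \<le> 0 \<or> (y - x) \<bullet> outer_normal T' S \<le> 0" unfolding eq by auto
      then show "y \<in> T \<union> T'" using y r(2,3) r1(2) r2(2) by blast
    qed
    then have "ball x r \<subseteq> closure \<Omega>" using Union_\<T> T(1) T'(1) by blast
    then have "x \<in> interior (closure \<Omega>)" using r(1) mem_interior by blast
    then have "x \<in> \<Omega>" using regular by simp
    then show False using frontier_disjoint bd x rel_interior_subset by blast
  qed
qed

text \<open>Near a relative interior point of a boundary facet only the adjacent element is present, and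
  there the domain coincides with the interior of that element, a half ball.\<close>
lemma outward_normal_bd_facet:
  assumes T: "T \<in> \<T>" "S facet_of T" and bd: "S \<subseteq> frontier \<Omega>" and x: "x \<in> rel_interior S"
  shows "outward_normal \<Omega> x = outer_normal T S"
proof -
  interpret t: simplex_facet T S by (rule facetI[OF T])
  let ?n = "outer_normal T S"
  have n1: "norm ?n = 1" using t.norm_outer_normal[OF T(2)] .
  have xT: "x \<in> T" using x rel_interior_subset t.facet_subset[OF T(2)] by blast
  have other: "x \<notin> T'" if T': "T' \<in> \<T>" "T' \<noteq> T" for T'
  proof
    assume xT': "x \<in> T'"
    interpret t': full_simplex T' by (rule simplexI[OF T'(1)])
    have f: "T \<inter> T' face_of T" by (rule face_Int[OF T(1) T'(1)])
    have S: "S \<subseteq> T \<inter> T'"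
      using subset_of_face_of[OF f, of S] t.facet_subset[OF T(2)] x xT xT' by blast
    have "T \<inter> T' \<noteq> T"
      using interior_disjoint[OF T(1) T'(1)] T'(2) t.interior_ne interior_subset[of T] by blast
    then have lt: "aff_dim (T \<inter> T') < aff_dim T" by (rule face_of_aff_dim_lt[OF t.convex f])
    have "S face_of T \<inter> T'" using T(2) S by (auto simp: facet_of_def intro: face_of_subset)
    moreover have "convex (T \<inter> T')" using t.convex t'.convex by (rule convex_Int)
    ultimately have "S = T \<inter> T'"
      using face_of_aff_dim_lt[of "T \<inter> T'" S] lt aff_dim_facet[OF T] aff_dim_T[OF T(1)] by fastforce
    then have "S facet_of T'"
      using face_Int'[OF T(1) T'(1)] T(2) aff_dim_T[OF T(1)] aff_dim_T[OF T'(1)] by (simp add: facet_of_def)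
    then show False using bd_facet_unique[OF T T'(1) _ bd] T'(2) by blast
  qed
  have "open (\<Inter>T'\<in>\<T> - {T}. - T')"
    using finite_\<T> full_simplex.closed[OF simplexI] by (intro open_INT) auto
  moreover have "x \<in> (\<Inter>T'\<in>\<T> - {T}. - T')" using other by blast
  ultimately obtain r1 where r1: "r1 > 0" "ball x r1 \<subseteq> (\<Inter>T'\<in>\<T> - {T}. - T')"
    by (rule openE)
  obtain r2 where r2: "r2 > 0" "T \<inter> ball x r2 = {y \<in> ball x r2. (y - x) \<bullet> ?n \<le> 0}"
    using t.local_half_ball[OF T(2) x] by blast
  define r where "r = min r1 r2"
  have r: "0 < r" "ball x r \<subseteq> ball x r1" "ball x r \<subseteq> ball x r2" using r1 r2 by (auto simp: r_def)
  have half: "\<Omega> \<inter> ball x r = {y \<in> ball x r. (y - x) \<bullet> ?n < 0}"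
  proof
    show "\<Omega> \<inter> ball x r \<subseteq> {y \<in> ball x r. (y - x) \<bullet> ?n < 0}"
    proof
      fix y assume y: "y \<in> \<Omega> \<inter> ball x r"
      have inT: "w \<in> T" if "w \<in> \<Omega> \<inter> ball x r" for w
        using that Union_\<T> closure_subset[of \<Omega>] r1(2) r(2) by blast
      have "open (\<Omega> \<inter> ball x r)" using open_\<Omega> by blast
      then obtain e where e: "e > 0" "ball y e \<subseteq> \<Omega> \<inter> ball x r" using y by (rule openE)
      have "y + (e/2) *\<^sub>R ?n \<in> ball y e" using e(1) n1 by (simp add: dist_norm)
      then have "y + (e/2) *\<^sub>R ?n \<in> T \<inter> ball x r2" using inT e(2) r(3) by blast
      then have "(y + (e/2) *\<^sub>R ?n - x) \<bullet> ?n \<le> 0" using r2(2) by blast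
      then have "(y - x) \<bullet> ?n + e / 2 \<le> 0" using n1 by (simp add: inner_diff_left inner_add_left dot_square_norm)
      then show "y \<in> {y \<in> ball x r. (y - x) \<bullet> ?n < 0}" using y e(1) by auto
    qed
    let ?H = "{y \<in> ball x r. (y - x) \<bullet> ?n < 0}"
    have "?H = ball x r \<inter> {y. (y - x) \<bullet> ?n < 0}" by auto
    then have "open ?H" by (auto intro!: open_Int open_Collect_less continuous_intros)
    moreover have "?H \<subseteq> {y \<in> ball x r2. (y - x) \<bullet> ?n \<le> 0}" using r(3) by auto
    then have "?H \<subseteq> T" using r2(2) by blast
    then have "?H \<subseteq> closure \<Omega>" using Union_\<T> T(1) by blast
    ultimately have "?H \<subseteq> \<Omega>" using interior_maximal regular by blast
    then show "?H \<subseteq> \<Omega> \<inter> ball x r" by blast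
  qed
  show ?thesis unfolding outward_normal_def
  proof (rule the_equality)
    show "norm ?n = 1 \<and> (\<exists>r>0. \<Omega> \<inter> ball x r = {y \<in> ball x r. (y - x) \<bullet> ?n < 0})"
      using n1 half r(1) by blast
    fix m assume m: "norm m = 1 \<and> (\<exists>r>0. \<Omega> \<inter> ball x r = {y \<in> ball x r. (y - x) \<bullet> m < 0})"
    then obtain q where q: "q > 0" "\<Omega> \<inter> ball x q = {y \<in> ball x q. (y - x) \<bullet> m < 0}" by blast
    show "m = ?n"
    proof (rule half_ball_normal_unique[where x=x and r="min r q"])
      fix y assume y: "y \<in> ball x (min r q)" "(y - x) \<bullet> m < 0"
      then have "y \<in> \<Omega> \<inter> ball x q" using q(2) by auto
      then have "y \<in> \<Omega> \<inter> ball x r" using y by auto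
      then show "(y - x) \<bullet> ?n < 0" using half by blast
    qed (use m n1 r(1) q(1) in auto)
  qed
qed

lemma bd_value_facet:
  assumes "T \<in> \<T>" "S facet_of T" "S \<subseteq> frontier \<Omega>"
  shows "bd_value \<T> w S = w T"
proof -
  have "(SOME T. T \<in> \<T> \<and> S facet_of T) \<in> \<T> \<and> S facet_of (SOME T. T \<in> \<T> \<and> S facet_of T)"
    using someI[of "\<lambda>T. T \<in> \<T> \<and> S facet_of T" T] assms by blast
  then show ?thesis unfolding bd_value_def using bd_facet_unique assms by metis
qed

lemma interior_facet_point:
  assumes T: "T \<in> \<T>" "S facet_of T" and nb: "\<not> S \<subseteq> frontier \<Omega>"
  obtains x where "x \<in> rel_interior S" "x \<in> \<Omega>"
proof -
  interpret t: simplex_facet T S by (rule facetI[OF T])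
  have "\<not> rel_interior S \<subseteq> frontier \<Omega>"
  proof
    assume "rel_interior S \<subseteq> frontier \<Omega>"
    then have "closure (rel_interior S) \<subseteq> frontier \<Omega>" by (simp add: closure_minimal)
    then show False using nb convex_closure_rel_interior[of S] t.facet_compact_convex[OF T(2)] closure_subset by blast
  qed
  then obtain x where x: "x \<in> rel_interior S" "x \<notin> frontier \<Omega>" by blast
  have "x \<in> closure \<Omega>" using x rel_interior_subset t.facet_subset[OF T(2)] Union_\<T> T(1) by blast
  then have "x \<in> \<Omega>" using x(2) open_\<Omega> by (simp add: frontier_def interior_open)
  then show ?thesis using that x by blast
qed

lemma finite_facets: "finite (facets \<T>)"
proof -
  have "facets \<T> = (\<Union>T\<in>\<T>. {S. S facet_of T})" by (auto simp: facets_def)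
  then show ?thesis using finite_\<T> full_simplex.finite_facets[OF simplexI] by auto
qed

end

section \<open>Raviart-Thomas fields: fluxes and divergence\<close>

text \<open>For a field \<open>\<lambda>x. a + b *\<^sub>R x\<close> the normal component is constant on a facet, so its value at
  the barycenter is the flux density through the facet.\<close>
definition flux :: "'a::euclidean_space set \<Rightarrow> ('a \<Rightarrow> 'a) \<Rightarrow> 'a set \<Rightarrow> real" where
  "flux T w S = w (barycenter S) \<bullet> outer_normal T S"

text \<open>The constant divergence of a Raviart-Thomas field, expressed as outflow per volume, which avoids
  choosing coefficients \<open>a\<close> and \<open>b\<close>.\<close>
definition RT_div :: "'a::euclidean_space set \<Rightarrow> ('a \<Rightarrow> 'a) \<Rightarrow> real" where
  "RT_div T w = (\<Sum>S | S facet_of T. area S * flux T w S) / vol T"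

definition RT_field :: "'a::euclidean_space set \<Rightarrow> ('a \<Rightarrow> 'a) \<Rightarrow> bool" where
  "RT_field T w \<longleftrightarrow> (\<exists>a b. \<forall>x \<in> T. w x = a + b *\<^sub>R x)"

context simplex_facet
begin

text \<open>The integrand of the facet measure is positive on a nonempty open part of the prism, namely near
  the segment above \<open>x\<close>.\<close>
lemma facet_integral_pos:
  fixes \<phi> :: "'a \<Rightarrow> real"
  assumes \<phi>: "continuous_on UNIV \<phi>" and nonneg: "\<And>y. 0 \<le> \<phi> y"
    and x: "x \<in> rel_interior S" and pos: "0 < \<phi> x"
  shows "0 < (LINT y|facet_measure S. \<phi> y)"
proof (rule ccontr)
  assume "\<not> 0 < (LINT y|facet_measure S. \<phi> y)"
  have [measurable]: "\<phi> \<in> borel_measurable borel" by (rule borel_measurable_continuous_onI[OF \<phi>])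
  have "0 \<le> (LINT y|flat_measure. \<phi> y)" by (intro Bochner_Integration.integral_nonneg nonneg)
  then have "(LINT y|flat_measure. \<phi> y) = 0"
    using \<open>\<not> 0 < (LINT y|facet_measure S. \<phi> y)\<close> by (simp add: facet_integral_flat)
  then have "AE y in flat_measure. \<phi> y = 0"
    using integral_nonneg_eq_0_iff_AE[OF flat_integrable[OF \<phi>]] nonneg by simp
  then have "AE y in restrict_space lborel prism. \<phi> (proj y) = 0"
    unfolding flat_measure_def by (subst (asm) AE_distr_iff) (auto intro: measurable_restrict_space1)
  then have ae: "AE y in lborel. y \<in> prism \<longrightarrow> \<phi> (proj y) = 0"
    by (subst (asm) AE_restrict_space_iff) auto
  define P where "P = {y. (\<forall>v\<in>verts T - {z}. 0 < bcoord T v (proj y)) \<and> 0 < \<phi> (proj y) \<and> 0 < level y \<and> level y < 1}"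
  have cl: "continuous_on UNIV level" unfolding level_def[abs_def] by (intro continuous_intros)
  have cp: "continuous_on UNIV proj" unfolding proj_def[abs_def] by (intro continuous_intros cl)
  have "P = (\<Inter>v\<in>verts T - {z}. {y. 0 < bcoord T v (proj y)}) \<inter> {y. 0 < \<phi> (proj y)} \<inter> {y. 0 < level y} \<inter> {y. level y < 1}"
    unfolding P_def by auto
  moreover have "open \<dots>"
    using finite_verts
    by (intro open_Int open_INT ballI open_Collect_less continuous_intros cl
        continuous_on_compose2[OF \<phi> cp] continuous_on_compose2[OF continuous_on_bcoord cp]) auto
  ultimately have "open P" by simp
  moreover have "x + (1/2) *\<^sub>R nrml \<in> P"
  proof -
    have "x \<in> S" using x rel_interior_subset by blast
    then have "level (x + (1/2) *\<^sub>R nrml) = 1/2" by (simp add: level_add level_facet)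
    moreover from this have "proj (x + (1/2) *\<^sub>R nrml) = x" by (simp add: proj_def)
    ultimately show ?thesis unfolding P_def using facet_rel_interior_iff[OF facet] x pos by simp
  qed
  ultimately have nn: "\<not> negligible P" using open_not_negligible by blast
  have "P \<subseteq> prism"
  proof
    fix y assume y: "y \<in> P"
    have "bcoord T z (proj y) = 0" by (simp add: bcoord_level level_proj)
    then have "proj y \<in> rel_interior S" using facet_rel_interior_iff[OF facet] y by (simp add: P_def)
    then show "y \<in> prism" using prism_iff y rel_interior_subset by (auto simp: P_def)
  qed
  then have sub: "y \<in> P \<Longrightarrow> y \<in> prism" for y by blast
  have "AE y in lborel. y \<notin> P"
    using ae by eventually_elim (use sub in \<open>auto simp: P_def\<close>)
  then have "P \<in> null_sets lborel"
    using \<open>open P\<close> by (subst AE_iff_null_sets) auto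
  then have "negligible P" by (simp add: negligible_iff_null_sets null_sets_completionI)
  then show False using nn by blast
qed

end

context full_simplex
begin

lemma flux_const:
  assumes "S facet_of T" "\<And>x. x \<in> T \<Longrightarrow> w x = a + c *\<^sub>R x" "x \<in> S"
  shows "w x \<bullet> outer_normal T S = flux T w S"
proof -
  interpret s: simplex_facet T S by unfold_locales (rule assms(1))
  have T: "x \<in> T" "barycenter S \<in> T" using assms(3) s.barycenter_in facet_subset[OF assms(1)] by auto
  have "(x - barycenter S) \<bullet> outer_normal T S = 0"
    using outer_normal_facet[OF assms(1) s.barycenter_in assms(3)] .
  then show ?thesis unfolding flux_def assms(2)[OF T(1)] assms(2)[OF T(2)]
    by (simp add: inner_add_left inner_diff_left)
qed

text \<open>By linearity it suffices to consider the fields \<open>\<lambda>x. x - v\<close>, for which the identity is the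
  divergence theorem on the cone with apex \<open>v\<close>.\<close>
lemma element_divergence_aux:
  fixes \<phi> :: "'a \<Rightarrow> real" and c :: real
  assumes w: "\<And>x. x \<in> T \<Longrightarrow> w x = a + c *\<^sub>R x"
    and G: "\<And>x. GDERIV \<phi> x :> G x" and cG: "continuous_on UNIV G"
  shows "(LINT x|lebesgue_on T. G x \<bullet> w x) + DIM('a) * c * (LINT x|lebesgue_on T. \<phi> x) =
    (\<Sum>S | S facet_of T. flux T w S * (LINT x|facet_measure S. \<phi> x))"
proof -
  define \<gamma> where "\<gamma> v = c * bcoord T v 0 - bgrad T v \<bullet> a" for v
  have c\<phi>: "continuous_on UNIV \<phi>"
    using G by (auto simp: continuous_on_eq_continuous_at gderiv_def intro: has_derivative_continuous)
  have dec: "a + c *\<^sub>R x = (\<Sum>v\<in>verts T. \<gamma> v *\<^sub>R (x - v))" for x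
    unfolding \<gamma>_def by (rule RT_field_decomposition)
  have sum\<gamma>: "(\<Sum>v\<in>verts T. \<gamma> v) = c"
    by (simp add: \<gamma>_def sum_subtractf sum_distrib_left[symmetric] sum_bcoord sum_bgrad)
  have i1: "integrable (lebesgue_on T) (\<lambda>x. G x \<bullet> (x - v) + DIM('a) * \<phi> x)" for v
    by (intro lebesgue_on_integral_compact(1) compact continuous_intros
        continuous_on_subset[OF cG] continuous_on_subset[OF c\<phi>]) auto
  have "(LINT x|lebesgue_on T. G x \<bullet> w x) + DIM('a) * c * (LINT x|lebesgue_on T. \<phi> x)
      = (LINT x|lebesgue_on T. G x \<bullet> (a + c *\<^sub>R x)) + (LINT x|lebesgue_on T. DIM('a) * c * \<phi> x)"
    using w by (intro arg_cong2[where f="(+)"] Bochner_Integration.integral_cong) auto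
  also have "\<dots> = (LINT x|lebesgue_on T. G x \<bullet> (a + c *\<^sub>R x) + DIM('a) * c * \<phi> x)"
    by (intro Bochner_Integration.integral_add[symmetric] lebesgue_on_integral_compact(1) compact continuous_intros
        continuous_on_subset[OF cG] continuous_on_subset[OF c\<phi>]) auto
  also have "\<dots> = (LINT x|lebesgue_on T. (\<Sum>v\<in>verts T. \<gamma> v * (G x \<bullet> (x - v) + DIM('a) * \<phi> x)))"
  proof -
    have "G x \<bullet> (a + c *\<^sub>R x) + DIM('a) * c * \<phi> x = (\<Sum>v\<in>verts T. \<gamma> v * (G x \<bullet> (x - v) + DIM('a) * \<phi> x))" for x
    proof -
      have "(\<Sum>v\<in>verts T. \<gamma> v * (G x \<bullet> (x - v) + DIM('a) * \<phi> x))
          = (\<Sum>v\<in>verts T. G x \<bullet> (\<gamma> v *\<^sub>R (x - v))) + (\<Sum>v\<in>verts T. \<gamma> v) * (DIM('a) * \<phi> x)"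
        by (simp add: distrib_left sum.distrib sum_distrib_right)
      then show ?thesis unfolding sum\<gamma> inner_sum_right[symmetric] dec[symmetric] by simp
    qed
    then show ?thesis by simp
  qed
  also have "\<dots> = (\<Sum>v\<in>verts T. \<gamma> v * (LINT x|lebesgue_on T. G x \<bullet> (x - v) + DIM('a) * \<phi> x))"
    by (subst Bochner_Integration.integral_sum) (auto intro!: integrable_mult_right i1)
  also have "\<dots> = (\<Sum>S | S facet_of T. \<gamma> (opp T S) * (LINT x|lebesgue_on T. G x \<bullet> (x - opp T S) + DIM('a) * \<phi> x))"
    by (rule sum.reindex_bij_betw[OF bij_opp, symmetric])
  also have "\<dots> = (\<Sum>S | S facet_of T. flux T w S * (LINT x|facet_measure S. \<phi> x))"
  proof (intro sum.cong refl)
    fix S assume "S \<in> {S. S facet_of T}"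
    then have S: "S facet_of T" by simp
    interpret s: simplex_facet T S by unfold_locales (rule S)
    have "flux T w S = (a + c *\<^sub>R barycenter S) \<bullet> outer_normal T S"
      unfolding flux_def using w s.barycenter_in facet_subset[OF S] by auto
    also have "\<dots> = (\<Sum>v\<in>verts T. \<gamma> v * ((barycenter S - v) \<bullet> outer_normal T S))"
      unfolding dec by (simp add: inner_sum_left)
    also have "\<dots> = (\<Sum>v\<in>verts T. if v = opp T S then \<gamma> v * height T S else 0)"
    proof (intro sum.cong refl)
      fix v assume v: "v \<in> verts T"
      show "\<gamma> v * ((barycenter S - v) \<bullet> outer_normal T S) = (if v = opp T S then \<gamma> v * height T S else 0)"
      proof (cases "v = opp T S")
        case True then show ?thesis using outer_normal_opp[OF S s.barycenter_in] by simp
      next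
        case False
        then have "v \<in> S" using v opp(2)[OF S] hull_inc[of v "verts T - {opp T S}"] by auto
        then show ?thesis using False outer_normal_facet[OF S _ s.barycenter_in] by simp
      qed
    qed
    also have "\<dots> = \<gamma> (opp T S) * height T S" using opp(1)[OF S] finite_verts by simp
    finally show "\<gamma> (opp T S) * (LINT x|lebesgue_on T. G x \<bullet> (x - opp T S) + DIM('a) * \<phi> x)
      = flux T w S * (LINT x|facet_measure S. \<phi> x)"
      using s.cone_divergence[OF G cG] by simp
  qed
  finally show ?thesis .
qed

text \<open>Test with the constant function one.\<close>
lemma RT_div_eq:
  fixes c :: real
  assumes w: "\<And>x. x \<in> T \<Longrightarrow> w x = a + c *\<^sub>R x"
  shows "RT_div T w = DIM('a) * c"
proof -
  have "DIM('a) * c * vol T = (\<Sum>S | S facet_of T. flux T w S * (LINT x|facet_measure S. 1))"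
    using element_divergence_aux[OF w, of "\<lambda>_. 1" "\<lambda>_. 0"] by (simp add: GDERIV_const)
  also have "\<dots> = (\<Sum>S | S facet_of T. area S * flux T w S)"
  proof (intro sum.cong refl)
    fix S assume "S \<in> {S. S facet_of T}"
    then interpret s: simplex_facet T S by unfold_locales simp
    show "flux T w S * (LINT x|facet_measure S. 1) = area S * flux T w S"
      using s.integral_const[of 1] by simp
  qed
  finally show ?thesis unfolding RT_div_def using measure_pos by (simp add: field_simps)
qed

lemma element_divergence:
  fixes \<phi> :: "'a \<Rightarrow> real"
  assumes w: "RT_field T w"
    and G: "\<And>x. GDERIV \<phi> x :> G x" and cG: "continuous_on UNIV G"
  shows "(LINT x|lebesgue_on T. G x \<bullet> w x) + RT_div T w * (LINT x|lebesgue_on T. \<phi> x) =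
    (\<Sum>S | S facet_of T. flux T w S * (LINT x|facet_measure S. \<phi> x))"
proof -
  obtain a c where ac: "\<And>x. x \<in> T \<Longrightarrow> w x = a + c *\<^sub>R x" using w unfolding RT_field_def by blast
  show ?thesis using element_divergence_aux[OF ac G cG] RT_div_eq[OF ac] by simp
qed

lemma element_divergence_affine:
  assumes w: "RT_field T w" and q: "\<And>x. x \<in> T \<Longrightarrow> q x = k + g \<bullet> x"
  shows "vol T * (g \<bullet> elem_mean T w) + vol T * (RT_div T w * elem_mean T q) =
    (\<Sum>S | S facet_of T. area S * (flux T w S * q (barycenter S)))"
proof -
  obtain a c where ac: "\<And>x. x \<in> T \<Longrightarrow> w x = a + c *\<^sub>R x" using w unfolding RT_field_def by blast
  have "GDERIV (\<lambda>x. k + g \<bullet> x) x :> g" for x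
    unfolding gderiv_def by (auto intro!: derivative_eq_intros simp: inner_commute)
  from element_divergence[OF w this]
  have "(LINT x|lebesgue_on T. g \<bullet> w x) + RT_div T w * (LINT x|lebesgue_on T. k + g \<bullet> x) =
    (\<Sum>S | S facet_of T. flux T w S * (LINT x|facet_measure S. k + g \<bullet> x))" by simp
  moreover have "(LINT x|lebesgue_on T. g \<bullet> w x) = vol T * (g \<bullet> elem_mean T w)"
  proof -
    have "(LINT x|lebesgue_on T. g \<bullet> w x) = (LINT x|lebesgue_on T. g \<bullet> a + (c *\<^sub>R g) \<bullet> x)"
      by (intro Bochner_Integration.integral_cong refl) (simp add: ac inner_add_right)
    also have "\<dots> = vol T * (g \<bullet> a + (c *\<^sub>R g) \<bullet> barycenter T)" by (rule integral_affine)
    finally show ?thesis using elem_mean_RT[OF ac] by (simp add: inner_add_right)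
  qed
  moreover have "(LINT x|lebesgue_on T. k + g \<bullet> x) = vol T * elem_mean T q"
    using elem_mean_affine[OF q] by (simp add: integral_affine)
  moreover have "(\<Sum>S | S facet_of T. flux T w S * (LINT x|facet_measure S. k + g \<bullet> x))
     = (\<Sum>S | S facet_of T. area S * (flux T w S * q (barycenter S)))"
  proof (intro sum.cong refl)
    fix S assume "S \<in> {S. S facet_of T}"
    then have S: "S facet_of T" by simp
    then interpret s: simplex_facet T S by unfold_locales
    show "flux T w S * (LINT x|facet_measure S. k + g \<bullet> x) = area S * (flux T w S * q (barycenter S))"
      using q[of "barycenter S"] s.barycenter_in facet_subset[OF S] by (auto simp: s.facet_integral_affine)
  qed
  ultimately show ?thesis by (simp add: mult.left_commute)
qed

text \<open>The shape function of the facet \<open>S\<close>: unit flux density through \<open>S\<close>, none through the facets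
  that contain the opposite vertex.\<close>
definition shape :: "'a set \<Rightarrow> 'a \<Rightarrow> 'a" where
  "shape S x = (1 / height T S) *\<^sub>R (x - opp T S)"

lemma RT_field_shape: "RT_field T (shape S)"
  unfolding RT_field_def shape_def
  by (intro exI[of _ "- (1 / height T S) *\<^sub>R opp T S"] exI[of _ "1 / height T S"]) (simp add: algebra_simps)

lemma flux_shape:
  assumes "S facet_of T" "S' facet_of T"
  shows "flux T (shape S) S' = (if S' = S then 1 else 0)"
proof -
  interpret s': simplex_facet T S' by unfold_locales (rule assms(2))
  show ?thesis
  proof (cases "S' = S")
    case True
    then show ?thesis using outer_normal_opp[OF assms(1), of "barycenter S"] s'.barycenter_in height_pos[OF assms(1)]
      by (simp add: flux_def shape_def)
  next
    case False
    have "(barycenter S' - opp T S) \<bullet> outer_normal T S' = 0"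
      using outer_normal_facet[OF assms(2) opp_in_other_facet[OF assms False] s'.barycenter_in] .
    then show ?thesis using False by (simp add: flux_def shape_def)
  qed
qed

end

context mesh
begin

abbreviation "adj S \<equiv> {T. T \<in> \<T> \<and> S facet_of T}"
abbreviation "wdiv v \<equiv> weak_div \<Omega> (glue \<T> v)"
abbreviation "ediv v \<equiv> glue0 \<T> (\<lambda>T. RT_div T (v T))"

text \<open>The total flux density out of the elements adjacent to \<open>S\<close>. If two elements meet in \<open>S\<close>, their
  outer normals are opposite and this is the jump of the normal component.\<close>
definition jump :: "((real^'n) set \<Rightarrow> real^'n \<Rightarrow> real^'n) \<Rightarrow> (real^'n) set \<Rightarrow> real" where
  "jump v S = (\<Sum>T\<in>adj S. flux T (v T) S)"

lemma sum_facets_swap: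
  "(\<Sum>T\<in>\<T>. \<Sum>S | S facet_of T. f T S) = (\<Sum>S\<in>facets \<T>. \<Sum>T\<in>adj S. f T S)"
proof -
  have "(\<Sum>T\<in>\<T>. \<Sum>S | S facet_of T. f T S) = (\<Sum>T\<in>\<T>. \<Sum>S | S \<in> facets \<T> \<and> S facet_of T. f T S)"
    by (intro sum.cong refl) (auto simp: facets_def)
  also have "\<dots> = (\<Sum>S\<in>facets \<T>. \<Sum>T\<in>adj S. f T S)"
    by (rule sum.swap_restrict[OF finite_\<T> finite_facets])
  finally show ?thesis .
qed

lemma RT_field_continuous: "RT_field T w \<Longrightarrow> continuous_on T w"
  unfolding RT_field_def
  by (auto intro!: continuous_on_eq[of T "\<lambda>x. _ + _ *\<^sub>R x" w] continuous_intros)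

lemma test_fun_integral_zero:
  assumes "test_fun U \<phi>" "S \<inter> U = {}" "T \<in> \<T>" "S facet_of T"
  shows "(LINT x|facet_measure S. \<phi> x) = 0"
proof -
  interpret s: simplex_facet T S by (rule facetI[OF assms(3,4)])
  have out: "\<phi> x = 0" if "x \<notin> U" for x
    using assms(1) that closure_subset[of "{x. \<phi> x \<noteq> 0}"] unfolding test_fun_def by blast
  have "AE x in facet_measure S. \<phi> x = 0"
    using s.AE_facet_rel_interior by eventually_elim (use assms(2) rel_interior_subset out in blast)
  then have "(LINT x|facet_measure S. \<phi> x) = (LINT x|facet_measure S. 0)"
    by (rule s.integral_AE_cong) simp
  then show ?thesis by simp
qed

text \<open>Summing the element identities: every facet contributes its jump of the normal component.\<close>
lemma piecewise_divergence:
  assumes v: "\<And>T. T \<in> \<T> \<Longrightarrow> RT_field T (v T)" and \<phi>: "smooth \<phi>"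
  shows "L2_inner \<Omega> (glue \<T> v) (grad \<phi>) =
    - L2_inner \<Omega> (ediv v) \<phi> + (\<Sum>S\<in>facets \<T>. jump v S * (LINT x|facet_measure S. \<phi> x))"
proof -
  note s = smooth_GDERIV[OF \<phi>]
  have "L2_inner \<Omega> (glue \<T> v) (grad \<phi>) = (\<Sum>T\<in>\<T>. LINT x|lebesgue_on T. v T x \<bullet> grad \<phi> x)"
    by (rule L2_inner_pieces)
       (auto simp: glue_interior intro: RT_field_continuous v continuous_on_subset[OF s(2)])
  also have "\<dots> = (\<Sum>T\<in>\<T>. (\<Sum>S | S facet_of T. flux T (v T) S * (LINT x|facet_measure S. \<phi> x))
      - RT_div T (v T) * (LINT x|lebesgue_on T. \<phi> x))"
    using full_simplex.element_divergence[OF simplexI v s(1,2)]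
    by (intro sum.cong refl) (simp add: inner_commute eq_diff_eq)
  also have "\<dots> = (\<Sum>S\<in>facets \<T>. jump v S * (LINT x|facet_measure S. \<phi> x))
      - (\<Sum>T\<in>\<T>. LINT x|lebesgue_on T. RT_div T (v T) * \<phi> x)"
    by (simp add: sum_subtractf sum_facets_swap jump_def sum_distrib_right)
  also have "(\<Sum>T\<in>\<T>. LINT x|lebesgue_on T. RT_div T (v T) * \<phi> x) = L2_inner \<Omega> (ediv v) \<phi>"
    by (subst L2_inner_pieces[where v'="\<lambda>T x. RT_div T (v T)" and w'="\<lambda>T. \<phi>"])
       (auto simp: glue_interior intro: continuous_on_subset[OF s(3)])
  finally show ?thesis by simp
qed

lemma bd_facets_cases: "S \<in> facets \<T> \<Longrightarrow> S \<subseteq> frontier \<Omega> \<longleftrightarrow> S \<in> bd_facets \<Omega> \<T>"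
  by (simp add: bd_facets_def)

lemma bd_facets_subset: "bd_facets \<Omega> \<T> \<subseteq> facets \<T>" by (auto simp: bd_facets_def)

lemma L2_pieces:
  fixes F :: "real^'n \<Rightarrow> 'b::euclidean_space"
  assumes F: "\<And>T x. T \<in> \<T> \<Longrightarrow> x \<in> interior T \<Longrightarrow> F x = w T x"
    and w: "\<And>T. T \<in> \<T> \<Longrightarrow> continuous_on T (w T)"
  shows "F \<in> L2 (lebesgue_on \<Omega>)"
proof -
  have "integrable (lebesgue_on \<Omega>) F"
    by (rule integral_pieces(1)[of _ w])
       (auto simp: F intro!: lebesgue_on_integral_compact(1) full_simplex.compact simplexI w)
  moreover have "integrable (lebesgue_on \<Omega>) (\<lambda>x. (norm (F x))\<^sup>2)"
    by (rule integral_pieces(1)[of _ "\<lambda>T x. (norm (w T x))\<^sup>2"])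
       (auto simp: F intro!: lebesgue_on_integral_compact(1) full_simplex.compact simplexI w continuous_intros)
  ultimately show ?thesis unfolding L2_def by auto
qed

text \<open>Test functions vanish on the boundary, so boundary facets impose no condition.\<close>
lemma RT0I:
  assumes v: "\<And>T. T \<in> \<T> \<Longrightarrow> RT_field T (v T)"
    and j: "\<And>S. S \<in> facets \<T> - bd_facets \<Omega> \<T> \<Longrightarrow> jump v S = 0"
  shows "v \<in> RT0 \<Omega> \<T>"
proof -
  have "has_weak_div \<Omega> (glue \<T> v) (ediv v)"
    unfolding has_weak_div_def
  proof (intro allI impI)
    fix \<phi> assume \<phi>: "test_fun \<Omega> \<phi>"
    have "jump v S * (LINT x|facet_measure S. \<phi> x) = 0" if S: "S \<in> facets \<T>" for S
    proof (cases "S \<in> bd_facets \<Omega> \<T>")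
      case True
      obtain T where "T \<in> \<T>" "S facet_of T" using S unfolding facets_def by blast
      moreover have "S \<inter> \<Omega> = {}" using True frontier_disjoint unfolding bd_facets_def by blast
      ultimately show ?thesis using test_fun_integral_zero[OF \<phi>] by simp
    qed (use j S in simp)
    then have "(\<Sum>S\<in>facets \<T>. jump v S * (LINT x|facet_measure S. \<phi> x)) = 0" by (intro sum.neutral) blast
    moreover have "smooth \<phi>" using \<phi> by (simp add: test_fun_def)
    ultimately show "L2_inner \<Omega> (glue \<T> v) (grad \<phi>) = - L2_inner \<Omega> (ediv v) \<phi>"
      using piecewise_divergence[OF v, of \<phi>] by simp
  qed
  moreover have "glue \<T> v \<in> L2 (lebesgue_on \<Omega>)"
    by (rule L2_pieces[of _ v]) (auto simp: glue_interior intro: RT_field_continuous v)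
  moreover have "ediv v \<in> L2 (lebesgue_on \<Omega>)"
    by (rule L2_pieces[of _ "\<lambda>T x. RT_div T (v T)"]) (auto simp: glue_interior)
  ultimately have "glue \<T> v \<in> H_div \<Omega>" unfolding H_div_def by blast
  then show ?thesis using v unfolding RT0_def RT_field_def by blast
qed

lemma RT0_field: "v \<in> RT0 \<Omega> \<T> \<Longrightarrow> T \<in> \<T> \<Longrightarrow> RT_field T (v T)"
  unfolding RT0_def RT_field_def by blast

lemma weak_div:
  assumes "v \<in> RT0 \<Omega> \<T>"
  shows "wdiv v \<in> L2 (lebesgue_on \<Omega>)" "has_weak_div \<Omega> (glue \<T> v) (wdiv v)"
proof -
  have "\<exists>g. g \<in> L2 (lebesgue_on \<Omega>) \<and> has_weak_div \<Omega> (glue \<T> v) g"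
    using assms unfolding RT0_def H_div_def by blast
  from someI_ex[OF this] show "wdiv v \<in> L2 (lebesgue_on \<Omega>)"
    "has_weak_div \<Omega> (glue \<T> v) (wdiv v)" unfolding weak_div_def by auto
qed

lemma L2_integrable: 
  fixes g :: "real^'n \<Rightarrow> real"
  assumes "g \<in> L2 (lebesgue_on \<Omega>)"
  shows "integrable (lebesgue_on \<Omega>) g"
proof -
  have "\<Omega> \<in> lmeasurable" using open_\<Omega> bounded_\<Omega> by (rule lmeasurable_open[rotated])
  then have "integrable (lebesgue_on \<Omega>) (\<lambda>x. 1 + (norm (g x))\<^sup>2)"
    using assms finite_measure_lebesgue_on[of \<Omega>] unfolding L2_def
    by (auto intro!: Bochner_Integration.integrable_add finite_measure.integrable_const)
  then show ?thesis
  proof (rule Bochner_Integration.integrable_bound)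
    show "g \<in> borel_measurable (lebesgue_on \<Omega>)" using assms by (simp add: L2_def)
    have "norm r \<le> norm (1 + (norm r)\<^sup>2)" for r :: real
    proof -
      have "0 \<le> (norm r - 1)\<^sup>2 + (norm r)\<^sup>2 + 1" by simp
      then have "2 * norm r \<le> 2 * (1 + (norm r)\<^sup>2)" unfolding power2_diff by simp
      then show ?thesis by simp
    qed
    then show "AE x in lebesgue_on \<Omega>. norm (g x) \<le> norm (1 + (norm (g x))\<^sup>2)" by blast
  qed
qed

lemma interior_facet_disjoint:
  assumes "T \<in> \<T>" "S \<in> facets \<T>"
  shows "S \<inter> interior T = {}"
proof -
  obtain T' where T': "T' \<in> \<T>" "S facet_of T'" using assms(2) unfolding facets_def by blast
  show ?thesis
  proof (cases "T' = T")
    case False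
    then show ?thesis using interior_disjoint[OF assms(1) T'(1)] facet_of_imp_subset[OF T'(2)] by blast
  next
    case True
    interpret t: full_simplex T by (rule simplexI[OF assms(1)])
    show ?thesis using t.interior_iff t.facet_mem_iff[of S] t.opp(1)[of S] T'(2) True by fastforce
  qed
qed

text \<open>Test functions supported inside one element do not see the facets.\<close>
lemma weak_div_AE:
  assumes v: "v \<in> RT0 \<Omega> \<T>"
  shows "AE x in lebesgue_on \<Omega>. wdiv v x = ediv v x"
proof -
  define g where "g x = wdiv v x - ediv v x" for x
  have i1: "integrable (lebesgue_on \<Omega>) (wdiv v)" by (rule L2_integrable[OF weak_div(1)[OF v]])
  have i2: "integrable (lebesgue_on \<Omega>) (ediv v)"
    by (rule L2_integrable, rule L2_pieces[of _ "\<lambda>T x. RT_div T (v T)"]) (auto simp: glue_interior)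
  have ig: "integrable (lebesgue_on \<Omega>) g" unfolding g_def using i1 i2 by simp
  have \<Omega>L: "\<Omega> \<inter> space lebesgue \<in> sets lebesgue" using open_\<Omega> by auto
  have AE_T: "AE x in lebesgue. x \<in> interior T \<longrightarrow> g x = 0" if T: "T \<in> \<T>" for T
  proof -
    have iT: "interior T \<inter> space lebesgue \<in> sets lebesgue" by auto
    have sub: "interior T \<subseteq> \<Omega>" by (rule interior_subset_\<Omega>[OF T])
    have "integrable lebesgue (\<lambda>x. indicator \<Omega> x *\<^sub>R g x)"
      using ig \<Omega>L by (simp add: integrable_restrict_space)
    then have "integrable lebesgue (\<lambda>x. indicator (interior T) x *\<^sub>R (indicator \<Omega> x *\<^sub>R g x))"
      by (rule integrable_mult_indicator[rotated]) auto
    also have "(\<lambda>x. indicator (interior T) x *\<^sub>R (indicator \<Omega> x *\<^sub>R g x)) = (\<lambda>x. indicator (interior T) x *\<^sub>R g x)"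
      by (intro ext) (use sub in \<open>auto simp: indicator_def\<close>)
    finally have gT: "integrable (lebesgue_on (interior T)) g" using iT by (simp add: integrable_restrict_space)
    have "AE x in lebesgue_on (interior T). g x = 0"
    proof (rule fundamental_lemma[OF open_interior gT])
      fix \<phi> assume \<phi>T: "test_fun (interior T) \<phi>"
      then have \<phi>: "test_fun \<Omega> \<phi>" using sub unfolding test_fun_def by blast
      then have sm: "smooth \<phi>" by (simp add: test_fun_def)
      have c\<phi>: "continuous_on UNIV \<phi>" by (rule smooth_GDERIV(3)[OF sm])
      have out: "\<phi> x = 0" if "x \<notin> interior T" for x
        using \<phi>T that closure_subset[of "{x. \<phi> x \<noteq> 0}"] unfolding test_fun_def by blast
      have "bounded (\<phi> ` closure {x. \<phi> x \<noteq> 0})"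
        using compact_continuous_image[OF continuous_on_subset[OF c\<phi>]] \<phi>
        by (auto simp: test_fun_def intro!: compact_imp_bounded)
      then obtain B where "\<And>x. x \<in> closure {x. \<phi> x \<noteq> 0} \<Longrightarrow> norm (\<phi> x) \<le> B" by (auto simp: bounded_iff)
      then have "norm (\<phi> x) \<le> max B 0" for x
        using closure_subset[of "{x. \<phi> x \<noteq> 0}"] by (cases "\<phi> x = 0") (auto simp: le_max_iff_disj)
      then have bd: "integrable (lebesgue_on \<Omega>) (\<lambda>x. f x * \<phi> x)" if f: "integrable (lebesgue_on \<Omega>) f" for f
      proof -
        assume B: "\<And>x. norm (\<phi> x) \<le> max B 0"
        have m: "\<phi> \<in> borel_measurable (lebesgue_on \<Omega>)"
          using continuous_imp_measurable_on_sets_lebesgue[of \<Omega> \<phi>] continuous_on_subset[OF c\<phi>] open_\<Omega> by auto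
        show ?thesis
          by (rule Bochner_Integration.integrable_bound[of _ "\<lambda>x. max B 0 * f x"])
             (use f m B in \<open>auto simp: abs_mult mult.commute[of _ "\<bar>\<phi> _\<bar>"] intro!: mult_right_mono\<close>)
      qed
      have "(LINT x|lebesgue_on (interior T). g x * \<phi> x) = (LINT x|lebesgue_on \<Omega>. g x * \<phi> x)"
      proof -
        have "indicator (interior T) x *\<^sub>R (g x * \<phi> x) = indicator \<Omega> x *\<^sub>R (g x * \<phi> x)" for x
          using out[of x] sub by (auto simp: indicator_def)
        then show ?thesis by (simp only: integral_restrict_space[OF iT] integral_restrict_space[OF \<Omega>L])
      qed
      also have "\<dots> = L2_inner \<Omega> (wdiv v) \<phi> - L2_inner \<Omega> (ediv v) \<phi>"
        unfolding g_def L2_inner_def left_diff_distrib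
        by (subst Bochner_Integration.integral_diff) (auto intro!: bd i1 i2)
      also have "\<dots> = - L2_inner \<Omega> (glue \<T> v) (grad \<phi>) - L2_inner \<Omega> (ediv v) \<phi>"
        using weak_div(2)[OF v] \<phi> unfolding has_weak_div_def by simp
      also have "\<dots> = - (\<Sum>S\<in>facets \<T>. jump v S * (LINT x|facet_measure S. \<phi> x))"
        using piecewise_divergence[OF RT0_field[OF v] sm] by simp
      also have "\<dots> = 0"
      proof -
        have "(LINT x|facet_measure S. \<phi> x) = 0" if S: "S \<in> facets \<T>" for S
        proof -
          obtain T' where "T' \<in> \<T>" "S facet_of T'" using S unfolding facets_def by blast
          then show ?thesis using test_fun_integral_zero[OF \<phi>T interior_facet_disjoint[OF T S]] by blast
        qed
        then show ?thesis by simp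
      qed
      finally show "(LINT x|lebesgue_on (interior T). g x * \<phi> x) = 0" .
    qed
    then show ?thesis using iT by (simp add: AE_restrict_space_iff)
  qed
  have "AE x in lebesgue. \<forall>T\<in>\<T>. x \<in> interior T \<longrightarrow> g x = 0"
    using AE_T finite_\<T> by (intro AE_finite_allI)
  moreover have "AE x in lebesgue. x \<notin> (\<Union>T\<in>\<T>. T - interior T)"
    using negligible_skeleton by (intro AE_not_in) (simp add: negligible_iff_null_sets)
  ultimately have "AE x in lebesgue. x \<in> \<Omega> \<longrightarrow> g x = 0"
  proof eventually_elim
    fix x assume a: "\<forall>T\<in>\<T>. x \<in> interior T \<longrightarrow> g x = 0" "x \<notin> (\<Union>T\<in>\<T>. T - interior T)"
    show "x \<in> \<Omega> \<longrightarrow> g x = 0"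
      using a Union_\<T> closure_subset[of \<Omega>] by blast
  qed
  then show ?thesis using \<Omega>L by (simp add: AE_restrict_space_iff g_def)
qed

lemma L2_inner_weak_div:
  assumes v: "v \<in> RT0 \<Omega> \<T>"
  shows "L2_inner \<Omega> (glue0 \<T> p) (wdiv v) = (\<Sum>T\<in>\<T>. vol T * (p T * RT_div T (v T)))"
    and "L2_inner \<Omega> (wdiv v) (glue0 \<T> p) = (\<Sum>T\<in>\<T>. vol T * (p T * RT_div T (v T)))"
proof -
  let ?c = "ediv v"
  have m: "glue0 \<T> c \<in> borel_measurable (lebesgue_on \<Omega>)" for c :: "(real^'n) set \<Rightarrow> real"
    using L2_pieces[of "glue0 \<T> c" "\<lambda>T x. c T"] by (simp add: glue_interior L2_def)
  have mw: "wdiv v \<in> borel_measurable (lebesgue_on \<Omega>)"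
    using weak_div(1)[OF v] by (simp add: L2_def)
  have "L2_inner \<Omega> (glue0 \<T> p) (wdiv v) = L2_inner \<Omega> (glue0 \<T> p) ?c"
    unfolding L2_inner_def
    using weak_div_AE[OF v] by (intro integral_cong_AE borel_measurable_inner m mw) (auto elim: eventually_mono)
  also have "\<dots> = (\<Sum>T\<in>\<T>. vol T * (p T * RT_div T (v T)))"
    unfolding L2_inner_glue0 by simp
  finally show "L2_inner \<Omega> (glue0 \<T> p) (wdiv v) = (\<Sum>T\<in>\<T>. vol T * (p T * RT_div T (v T)))" .
  moreover have "L2_inner \<Omega> (wdiv v) (glue0 \<T> p) = L2_inner \<Omega> (glue0 \<T> p) (wdiv v)"
    unfolding L2_inner_def by (rule Bochner_Integration.integral_cong[OF refl inner_commute])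
  ultimately show "L2_inner \<Omega> (wdiv v) (glue0 \<T> p) = (\<Sum>T\<in>\<T>. vol T * (p T * RT_div T (v T)))"
    by simp
qed

text \<open>Conversely, a field with square integrable divergence has no normal jumps: test with a bump
  that is positive at a relative interior point of the facet and vanishes near all other facets.\<close>
lemma RT0_jump:
  assumes v: "v \<in> RT0 \<Omega> \<T>" and S: "S \<in> facets \<T> - bd_facets \<Omega> \<T>"
  shows "jump v S = 0"
proof -
  obtain T where T: "T \<in> \<T>" "S facet_of T" using S unfolding facets_def by blast
  interpret s: simplex_facet T S by (rule facetI[OF T])
  have nb: "\<not> S \<subseteq> frontier \<Omega>" using S bd_facets_cases by blast
  obtain x where x: "x \<in> rel_interior S" "x \<in> \<Omega>" by (rule interior_facet_point[OF T nb])
  define W where "W = \<Omega> \<inter> (\<Inter>S'\<in>facets \<T> - {S}. - S')"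
  have "closed S'" if "S' \<in> facets \<T>" for S'
    using that full_simplex.facet_compact_convex(1)[OF simplexI] compact_imp_closed unfolding facets_def by blast
  then have "open W" unfolding W_def using open_\<Omega> finite_facets by (intro open_Int open_INT) auto
  moreover have "x \<in> W"
  proof -
    have "x \<notin> S'" if S': "S' \<in> facets \<T>" "S' \<noteq> S" for S'
    proof
      assume "x \<in> S'"
      obtain T' where T': "T' \<in> \<T>" "S' facet_of T'" using S'(1) unfolding facets_def by blast
      show False using facet_eq[OF T T' x(1) \<open>x \<in> S'\<close>] S'(2) by blast
    qed
    then show ?thesis unfolding W_def using x by blast
  qed
  ultimately obtain c d where cd: "cbox c d \<subseteq> W" "x \<in> box c d"
    using open_contains_cbox by metis
  define \<phi> where "\<phi> = box_bump c d 0"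
  have "test_fun W \<phi>" unfolding \<phi>_def using cd by (intro box_bump_test_fun) auto
  then have \<phi>: "test_fun W \<phi>" "test_fun \<Omega> \<phi>" "smooth \<phi>" unfolding test_fun_def W_def by blast+
  have "- L2_inner \<Omega> (wdiv v) \<phi> = L2_inner \<Omega> (glue \<T> v) (grad \<phi>)"
    using weak_div(2)[OF v] \<phi>(2) unfolding has_weak_div_def by simp
  also have "\<dots> = - L2_inner \<Omega> (ediv v) \<phi> + (\<Sum>S\<in>facets \<T>. jump v S * (LINT x|facet_measure S. \<phi> x))"
    by (rule piecewise_divergence[OF RT0_field[OF v] \<phi>(3)])
  also have "L2_inner \<Omega> (ediv v) \<phi> = L2_inner \<Omega> (wdiv v) \<phi>"
    unfolding L2_inner_def
  proof (rule integral_cong_AE)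
    have m: "\<phi> \<in> borel_measurable (lebesgue_on \<Omega>)"
      using continuous_imp_measurable_on_sets_lebesgue[of \<Omega> \<phi>] continuous_on_subset[OF smooth_GDERIV(3)[OF \<phi>(3)]] open_\<Omega> by auto
    show "(\<lambda>x. ediv v x \<bullet> \<phi> x) \<in> borel_measurable (lebesgue_on \<Omega>)"
      using L2_pieces[of "ediv v" "\<lambda>T x. RT_div T (v T)"] m
      by (intro borel_measurable_inner m) (simp add: glue_interior L2_def)
    show "(\<lambda>x. wdiv v x \<bullet> \<phi> x) \<in> borel_measurable (lebesgue_on \<Omega>)"
      using weak_div(1)[OF v] by (intro borel_measurable_inner m) (simp add: L2_def)
    show "AE x in lebesgue_on \<Omega>. ediv v x \<bullet> \<phi> x = wdiv v x \<bullet> \<phi> x"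
      using weak_div_AE[OF v] by eventually_elim simp
  qed
  finally have "(\<Sum>S\<in>facets \<T>. jump v S * (LINT x|facet_measure S. \<phi> x)) = 0" by simp
  moreover have "(\<Sum>S\<in>facets \<T>. jump v S * (LINT x|facet_measure S. \<phi> x)) =
      (\<Sum>S'\<in>facets \<T>. if S' = S then jump v S * (LINT x|facet_measure S. \<phi> x) else 0)"
  proof (intro sum.cong refl)
    fix S' assume S': "S' \<in> facets \<T>"
    then obtain T' where T': "T' \<in> \<T>" "S' facet_of T'" unfolding facets_def by blast
    show "jump v S' * (LINT x|facet_measure S'. \<phi> x) = (if S' = S then jump v S * (LINT x|facet_measure S. \<phi> x) else 0)"
    proof (cases "S' = S")
      case False
      then have "S' \<inter> W = {}" unfolding W_def using S' by blast
      then show ?thesis using test_fun_integral_zero[OF \<phi>(1) _ T'] False by simp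
    qed simp
  qed
  moreover have "0 < (LINT x|facet_measure S. \<phi> x)"
    using x(1) smooth_GDERIV(3)[OF \<phi>(3)] box_bump_pos[OF cd(2)]
    by (intro s.facet_integral_pos[where x=x]) (auto simp: \<phi>_def box_bump_bounds)
  ultimately show ?thesis using S finite_facets by simp
qed

text \<open>Almost every point of a boundary facet is a relative interior point, where the outward normal of
  the domain is that of the adjacent element.\<close>
lemma flux_normal_trace:
  assumes v: "RT_field T (v T)" and T: "T \<in> \<T>" "S facet_of T" and bd: "S \<subseteq> frontier \<Omega>"
  shows "AE x in facet_measure S. normal_trace \<Omega> \<T> v S x = flux T (v T) S"
proof -
  interpret s: simplex_facet T S by (rule facetI[OF T])
  obtain a c where ac: "\<And>x. x \<in> T \<Longrightarrow> v T x = a + c *\<^sub>R x" using v unfolding RT_field_def by blast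
  show ?thesis using s.AE_facet_rel_interior
  proof eventually_elim
    fix x assume x: "x \<in> rel_interior S"
    then have "x \<in> S" using rel_interior_subset by blast
    then show "normal_trace \<Omega> \<T> v S x = flux T (v T) S"
      unfolding normal_trace_def outward_normal_bd_facet[OF T bd x] bd_value_facet[OF T bd]
      using s.flux_const[OF T(2), of "v T" a c x] ac by blast
  qed
qed

end

section \<open>Symmetric positive definite matrices\<close>

lemma transpose_inner: "(transpose A *v x) \<bullet> y = x \<bullet> (A *v (y :: real^'n))"
  by (simp add: transpose_matrix_vector dot_lmul_matrix)

text \<open>A maximiser of the quadratic form on the unit sphere of an invariant subspace is an
  eigenvector, and its orthogonal complement is again invariant.\<close>
lemma symmetric_eigenbasis:
  fixes A :: "real^'n^'n"
  assumes A: "transpose A = A"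
  shows "subspace V \<Longrightarrow> (\<And>v. v \<in> V \<Longrightarrow> A *v v \<in> V) \<Longrightarrow>
    \<exists>B. finite B \<and> B \<subseteq> V \<and> (\<forall>c\<in>B. norm c = 1 \<and> A *v c = (c \<bullet> (A *v c)) *\<^sub>R c) \<and>
      (\<forall>c\<in>B. \<forall>d\<in>B. c \<noteq> d \<longrightarrow> c \<bullet> d = 0) \<and> (\<forall>v\<in>V. v = (\<Sum>c\<in>B. (v \<bullet> c) *\<^sub>R c))"
proof (induction "dim V" arbitrary: V rule: less_induct)
  case less
  note V = less.prems(1) and inv = less.prems(2)
  have sym: "(A *v x) \<bullet> y = x \<bullet> (A *v y)" for x y using transpose_inner[of A x y] A by simp
  show ?case
  proof (cases "V \<subseteq> {0}")
    case True
    then show ?thesis by (intro exI[of _ "{}"]) auto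
  next
    case False
    then obtain v0 where v0: "v0 \<in> V" "v0 \<noteq> 0" by blast
    let ?K = "V \<inter> sphere 0 1"
    have "compact ?K" using closed_subspace[OF V] by (intro closed_Int_compact) auto
    moreover have "(1 / norm v0) *\<^sub>R v0 \<in> ?K" using v0 V by (auto intro: subspace_scale)
    moreover have "continuous_on ?K (\<lambda>x. x \<bullet> (A *v x))"
      by (intro continuous_intros linear_continuous_on) (simp add: linear_linear)
    ultimately obtain b where b: "b \<in> ?K" "\<And>x. x \<in> ?K \<Longrightarrow> x \<bullet> (A *v x) \<le> b \<bullet> (A *v b)"
      using continuous_attains_sup[of ?K "\<lambda>x. x \<bullet> (A *v x)"] by (metis empty_iff)
    define \<mu> where "\<mu> = b \<bullet> (A *v b)"
    have bV: "b \<in> V" and nb: "norm b = 1" using b(1) by auto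
    have bb: "b \<bullet> b = 1" using nb by (simp add: dot_square_norm)
    have quad: "x \<bullet> (A *v x) \<le> \<mu> * (x \<bullet> x)" if x: "x \<in> V" for x
    proof (cases "x = 0")
      case False
      have "(1 / norm x) *\<^sub>R x \<in> ?K" using x V False by (auto intro: subspace_scale)
      from b(2)[OF this] have "(x \<bullet> (A *v x)) / (norm x)\<^sup>2 \<le> \<mu>"
        by (simp add: \<mu>_def matrix_vector_mult_scaleR power2_eq_square)
      then show ?thesis using False by (simp add: dot_square_norm divide_le_eq)
    qed simp
    have orth: "(A *v b) \<bullet> w = 0" if w: "w \<in> V" "b \<bullet> w = 0" for w
    proof (rule ccontr)
      assume ne: "(A *v b) \<bullet> w \<noteq> 0"
      define s where "s = (A *v b) \<bullet> w"
      define k where "k = \<mu> * (w \<bullet> w) - w \<bullet> (A *v w)"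
      have ineq: "2 * t * s \<le> t\<^sup>2 * k" for t
      proof -
        have "b + t *\<^sub>R w \<in> V" using bV w V by (intro subspace_add subspace_scale)
        moreover have "(b + t *\<^sub>R w) \<bullet> (A *v (b + t *\<^sub>R w)) = \<mu> + 2 * t * s + t\<^sup>2 * (w \<bullet> (A *v w))"
        proof -
          have "A *v (b + t *\<^sub>R w) = A *v b + t *\<^sub>R (A *v w)"
            by (simp add: matrix_vector_right_distrib matrix_vector_mult_scaleR)
          moreover have "b \<bullet> (A *v w) = s" "w \<bullet> (A *v b) = s"
            using sym[of b w] by (simp_all add: s_def inner_commute)
          ultimately show ?thesis
            by (simp add: inner_add_left inner_add_right \<mu>_def[symmetric] power2_eq_square algebra_simps)
        qed
        moreover have "(b + t *\<^sub>R w) \<bullet> (b + t *\<^sub>R w) = 1 + t\<^sup>2 * (w \<bullet> w)"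
          using w(2) inner_commute[of w b] by (simp add: inner_add_left inner_add_right bb power2_eq_square)
        ultimately have "\<mu> + 2 * t * s + t\<^sup>2 * (w \<bullet> (A *v w)) \<le> \<mu> * (1 + t\<^sup>2 * (w \<bullet> w))"
          using quad[of "b + t *\<^sub>R w"] by simp
        then show ?thesis by (simp add: k_def algebra_simps)
      qed
      have "0 \<le> k" using ineq[of 1] ineq[of "-1"] by simp
      then have k: "0 < k + 1" by simp
      (* For small t the linear term dominates; t = s / (k + 1) is small enough. *)
      have "2 * (s / (k + 1)) * s \<le> (s / (k + 1))\<^sup>2 * k" by (rule ineq)
      also have "\<dots> \<le> (s / (k + 1))\<^sup>2 * (k + 1)" by (intro mult_left_mono) auto
      also have "\<dots> = (s / (k + 1)) * s" using k by (simp add: power2_eq_square)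
      finally have "(s * s) / (k + 1) \<le> 0" by simp
      then have "s * s \<le> 0" using k by (simp add: divide_le_0_iff)
      then have "s * s = 0" using zero_le_square[of s] by linarith
      then show False using ne by (simp add: s_def)
    qed
    have eig: "A *v b = \<mu> *\<^sub>R b"
    proof -
      define w where "w = A *v b - \<mu> *\<^sub>R b"
      have "w \<in> V" unfolding w_def using inv[OF bV] bV V by (intro subspace_diff subspace_scale)
      moreover have bw: "b \<bullet> w = 0" by (simp add: w_def \<mu>_def inner_diff_right bb)
      ultimately have "(A *v b) \<bullet> w = 0" by (rule orth)
      then have "w \<bullet> w = 0" using bw by (simp add: w_def inner_diff_left)
      then show ?thesis by (simp add: w_def)
    qed
    let ?W = "V \<inter> {x. b \<bullet> x = 0}"
    have W: "subspace ?W" by (rule subspace_inter[OF V subspace_hyperplane])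
    have "b \<notin> ?W" using bb by simp
    then have "?W \<subset> V" using bV by blast
    moreover have "span ?W = ?W" "span V = V" using W V by (simp_all only: span_eq_iff)
    ultimately have "dim ?W < dim V" using dim_psubset[of ?W V] by (simp only: simp_thms)
    moreover have "A *v v \<in> ?W" if "v \<in> ?W" for v
      using that inv sym[of b v] eig by auto
    ultimately obtain B where B: "finite B" "B \<subseteq> ?W" "\<forall>c\<in>B. norm c = 1 \<and> A *v c = (c \<bullet> (A *v c)) *\<^sub>R c"
        "\<forall>c\<in>B. \<forall>d\<in>B. c \<noteq> d \<longrightarrow> c \<bullet> d = 0" "\<forall>v\<in>?W. v = (\<Sum>c\<in>B. (v \<bullet> c) *\<^sub>R c)"
      using less.hyps[of ?W] W by blast
    have bB: "b \<notin> B" using B(2) bb by auto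
    have ob: "b \<bullet> c = 0" "c \<bullet> b = 0" if "c \<in> B" for c using B(2) that by (auto simp: inner_commute)
    show ?thesis
    proof (intro exI[of _ "insert b B"] conjI ballI impI)
      fix v assume v: "v \<in> V"
      have "v - (v \<bullet> b) *\<^sub>R b \<in> ?W"
        using v bV V by (auto intro!: subspace_diff subspace_scale simp: inner_diff_right bb inner_commute)
      then have "v - (v \<bullet> b) *\<^sub>R b = (\<Sum>c\<in>B. ((v - (v \<bullet> b) *\<^sub>R b) \<bullet> c) *\<^sub>R c)" using B(5) by blast
      also have "\<dots> = (\<Sum>c\<in>B. (v \<bullet> c) *\<^sub>R c)"
        by (intro sum.cong refl) (simp add: inner_diff_left ob)
      finally show "v = (\<Sum>c\<in>insert b B. (v \<bullet> c) *\<^sub>R c)" using B(1) bB by (simp add: algebra_simps)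
    qed (use B bV nb eig \<mu>_def ob in auto)
  qed
qed

text \<open>Take square roots of the eigenvalues in an orthonormal eigenbasis.\<close>
lemma psd_sqrt_exists:
  fixes A :: "real^'n^'n"
  assumes A: "transpose A = A" and psd: "\<And>\<xi>. 0 \<le> \<xi> \<bullet> (A *v \<xi>)"
  shows "\<exists>R. transpose R = R \<and> (\<forall>\<xi>. 0 \<le> \<xi> \<bullet> (R *v \<xi>)) \<and> R ** R = A"
proof -
  obtain B where B: "finite B" "\<forall>c\<in>B. norm c = 1 \<and> A *v c = (c \<bullet> (A *v c)) *\<^sub>R c"
      "\<forall>c\<in>B. \<forall>d\<in>B. c \<noteq> d \<longrightarrow> c \<bullet> d = 0" "\<forall>v. v = (\<Sum>c\<in>B. (v \<bullet> c) *\<^sub>R c)"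
    using symmetric_eigenbasis[OF A, of UNIV] by auto
  define m where "m c = c \<bullet> (A *v c)" for c
  define f where "f x = (\<Sum>c\<in>B. (sqrt (m c) * (x \<bullet> c)) *\<^sub>R c)" for x
  have "linear f" unfolding f_def
    by (intro linearI) (auto simp: inner_add_left algebra_simps sum.distrib scaleR_sum_right)
  then have R: "matrix f *v x = f x" for x by (simp add: matrix_works)
  have fs: "f x \<bullet> y = x \<bullet> f y" for x y
    unfolding f_def by (simp add: inner_sum_left inner_sum_right inner_commute algebra_simps)
  have "transpose (matrix f) = matrix f"
  proof -
    have "(transpose (matrix f) *v x) \<bullet> y = (matrix f *v x) \<bullet> y" for x y
      unfolding transpose_inner R fs ..
    then have "transpose (matrix f) *v x = matrix f *v x" for x using vector_eq_rdot by blast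
    then show ?thesis by (simp add: matrix_eq)
  qed
  moreover have "0 \<le> \<xi> \<bullet> (matrix f *v \<xi>)" for \<xi>
    unfolding R f_def inner_sum_right using psd
    by (intro sum_nonneg) (auto simp: m_def mult.assoc[symmetric] zero_le_mult_iff inner_commute mult_le_0_iff)
  moreover have "matrix f ** matrix f = A"
  proof -
    have fc: "f c = sqrt (m c) *\<^sub>R c" if c: "c \<in> B" for c
    proof -
      have "f c = (\<Sum>d\<in>B. if d = c then sqrt (m c) *\<^sub>R c else 0)"
        unfolding f_def using B(2,3) c by (intro sum.cong refl) (auto simp: dot_square_norm)
      then show ?thesis using c B(1) by simp
    qed
    have "(matrix f ** matrix f) *v x = A *v x" for x
    proof -
      have "(matrix f ** matrix f) *v x = f (f x)" by (simp add: matrix_vector_mul_assoc[symmetric] R)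
      also have "\<dots> = (\<Sum>c\<in>B. (sqrt (m c) * (x \<bullet> c)) *\<^sub>R f c)"
        unfolding f_def[of x] using \<open>linear f\<close> by (simp add: linear_sum linear_scale)
      also have "\<dots> = (\<Sum>c\<in>B. (x \<bullet> c) *\<^sub>R (A *v c))"
      proof (intro sum.cong refl)
        fix c assume c: "c \<in> B"
        have "A *v c = m c *\<^sub>R c" using B(2) c by (simp add: m_def)
        moreover have "sqrt (m c) * sqrt (m c) = m c" using psd[of c] by (simp add: m_def)
        ultimately show "(sqrt (m c) * (x \<bullet> c)) *\<^sub>R f c = (x \<bullet> c) *\<^sub>R (A *v c)"
          unfolding fc[OF c] by (metis (no_types, lifting) mult.commute mult.left_commute scaleR_scaleR)
      qed
      also have "\<dots> = A *v (\<Sum>c\<in>B. (x \<bullet> c) *\<^sub>R c)"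
        by (simp add: linear_sum[OF matrix_vector_mul_linear] matrix_vector_mult_scaleR)
      also have "\<dots> = A *v x" using B(4) by metis
      finally show ?thesis .
    qed
    then show ?thesis by (simp add: matrix_eq)
  qed
  ultimately show ?thesis by blast
qed

lemma mat_sqrt_inner:
  fixes A :: "real^'n^'n"
  assumes A: "transpose A = A" and psd: "\<And>\<xi>. 0 \<le> \<xi> \<bullet> (A *v \<xi>)"
  shows "(mat_sqrt A *v \<xi>) \<bullet> (mat_sqrt A *v \<xi>) = \<xi> \<bullet> (A *v \<xi>)"
proof -
  have R: "transpose (mat_sqrt A) = mat_sqrt A \<and> (\<forall>\<xi>. 0 \<le> \<xi> \<bullet> (mat_sqrt A *v \<xi>)) \<and> mat_sqrt A ** mat_sqrt A = A"
    unfolding mat_sqrt_def by (rule someI_ex[OF psd_sqrt_exists[OF assms]])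
  have "(mat_sqrt A *v \<xi>) \<bullet> (mat_sqrt A *v \<xi>) = \<xi> \<bullet> (mat_sqrt A *v (mat_sqrt A *v \<xi>))"
    using transpose_inner[of "mat_sqrt A" \<xi> "mat_sqrt A *v \<xi>"] R by simp
  then show ?thesis using R by (simp add: matrix_vector_mul_assoc)
qed

lemma pd_matrix_inv:
  fixes A :: "real^'n^'n"
  assumes "\<And>\<xi>. \<xi> \<noteq> 0 \<Longrightarrow> 0 < \<xi> \<bullet> (A *v \<xi>)"
  shows "A *v (matrix_inv A *v x) = x"
proof -
  have "x = 0" if "A *v x = 0" for x using assms[of x] that by force
  then have "invertible A"
    by (simp add: invertible_left_inverse matrix_left_invertible_ker)
  then have "A ** matrix_inv A = mat 1 \<and> matrix_inv A ** A = mat 1"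
    unfolding invertible_def matrix_inv_def by (rule someI_ex)
  then show ?thesis by (simp add: matrix_vector_mul_assoc)
qed

context mesh
begin

lemma AE_element_in_\<Omega>:
  assumes "T \<in> \<T>" shows "AE x in lebesgue. x \<in> T \<longrightarrow> x \<in> interior T"
proof -
  have "AE x in lebesgue. x \<notin> (\<Union>T\<in>\<T>. T - interior T)"
    using negligible_skeleton by (intro AE_not_in) (simp add: negligible_iff_null_sets)
  then show ?thesis by eventually_elim (use assms in blast)
qed

lemma integrable_element:
  fixes K :: "real^'n \<Rightarrow> 'b::euclidean_space"
  assumes T: "T \<in> \<T>" and K: "integrable (lebesgue_on \<Omega>) K"
  shows "integrable (lebesgue_on T) K"
proof -
  have \<Omega>L: "\<Omega> \<inter> space lebesgue \<in> sets lebesgue" using open_\<Omega> by auto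
  have TL: "T \<inter> space lebesgue \<in> sets lebesgue"
    using full_simplex.lmeasurable[OF simplexI[OF T]] by (simp add: fmeasurable_def)
  have "integrable lebesgue (\<lambda>x. indicator \<Omega> x *\<^sub>R K x)"
    using K \<Omega>L by (simp add: integrable_restrict_space)
  then have i: "integrable lebesgue (\<lambda>x. indicator (interior T) x *\<^sub>R (indicator \<Omega> x *\<^sub>R K x))"
    by (rule integrable_mult_indicator[rotated]) auto
  have ae: "AE x in lebesgue. indicator T x *\<^sub>R K x = indicator (interior T) x *\<^sub>R (indicator \<Omega> x *\<^sub>R K x)"
    using AE_element_in_\<Omega>[OF T]
    by eventually_elim (use interior_subset[of T] interior_subset_\<Omega>[OF T] in \<open>auto simp: indicator_def\<close>)
  have m: "(\<lambda>x. indicator T x *\<^sub>R K x) \<in> borel_measurable lebesgue"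
    by (rule borel_measurable_AE_completion[OF ae]) (use i in auto)
  have "integrable lebesgue (\<lambda>x. indicator T x *\<^sub>R K x)"
    by (subst integrable_cong_AE[OF m _ ae]) (use i in auto)
  then show ?thesis using TL by (simp add: integrable_restrict_space)
qed

text \<open>The part of an element outside the open domain lies on the frontier of the element.\<close>
lemma AE_element:
  assumes T: "T \<in> \<T>" and P: "\<And>x. x \<in> \<Omega> \<Longrightarrow> P x"
  shows "AE x in lebesgue_on T. P x"
proof -
  have TL: "T \<inter> space lebesgue \<in> sets lebesgue"
    using full_simplex.lmeasurable[OF simplexI[OF T]] by (simp add: fmeasurable_def)
  have "AE x in lebesgue. x \<in> T \<longrightarrow> P x"
    using AE_element_in_\<Omega>[OF T] by eventually_elim (use P interior_subset_\<Omega>[OF T] in blast)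
  then show ?thesis using TL by (simp add: AE_restrict_space_iff)
qed

text \<open>By polarisation, bounds on the quadratic form bound the entries of a symmetric matrix.\<close>
lemma coefficient_integrable:
  fixes K :: "real^'n \<Rightarrow> real^'n^'n"
  assumes meas: "K \<in> borel_measurable (lebesgue_on \<Omega>)" and sym: "\<forall>x\<in>\<Omega>. transpose (K x) = K x"
    and k0: "0 < k0"
    and bounds: "\<forall>x\<in>\<Omega>. \<forall>\<xi>. k0 * (norm \<xi>)\<^sup>2 \<le> \<xi> \<bullet> (K x *v \<xi>) \<and> \<xi> \<bullet> (K x *v \<xi>) \<le> k1 * (norm \<xi>)\<^sup>2"
  shows "integrable (lebesgue_on \<Omega>) K"
proof -
  have entry: "\<bar>K x $ i $ j\<bar> \<le> \<bar>k1\<bar>" if x: "x \<in> \<Omega>" for x i j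
  proof -
    let ?e = "\<lambda>i. axis i 1 :: real^'n"
    let ?Q = "\<lambda>\<xi>. \<xi> \<bullet> (K x *v \<xi>)"
    have s: "?e j \<bullet> (K x *v ?e i) = ?e i \<bullet> (K x *v ?e j)"
      using transpose_inner[of "K x" "?e j" "?e i"] sym x by (simp add: inner_commute)
    have "?Q (?e i + ?e j) - ?Q (?e i - ?e j) = 4 * (?e i \<bullet> (K x *v ?e j))"
      using s by (simp add: matrix_vector_right_distrib matrix_vector_mult_diff_distrib inner_add_left inner_add_right inner_diff_left inner_diff_right)
    moreover have "0 \<le> ?Q \<xi> \<and> ?Q \<xi> \<le> \<bar>k1\<bar> * 4" if "norm \<xi> \<le> 2" for \<xi>
    proof -
      have "(norm \<xi>)\<^sup>2 \<le> 2\<^sup>2" using that by (intro power_mono) auto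
      then have "k1 * (norm \<xi>)\<^sup>2 \<le> \<bar>k1\<bar> * 4" by (intro mult_mono) auto
      moreover have "0 \<le> k0 * (norm \<xi>)\<^sup>2" using k0 by simp
      moreover have "k0 * (norm \<xi>)\<^sup>2 \<le> ?Q \<xi> \<and> ?Q \<xi> \<le> k1 * (norm \<xi>)\<^sup>2" using bounds x by blast
      ultimately show ?thesis by linarith
    qed
    moreover have "norm (?e i + ?e j) \<le> 2" "norm (?e i - ?e j) \<le> 2"
      using norm_triangle_ineq[of "?e i" "?e j"] norm_triangle_ineq4[of "?e i" "?e j"] by simp_all
    ultimately have "\<bar>4 * (?e i \<bullet> (K x *v ?e j))\<bar> \<le> \<bar>k1\<bar> * 4" by (smt (verit))
    moreover have "?e i \<bullet> (K x *v ?e j) = K x $ i $ j"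
      by (simp add: inner_axis' matrix_vector_mul_component inner_axis)
    ultimately show ?thesis by simp
  qed
  have nb: "norm (K x) \<le> (\<Sum>i\<in>(UNIV::'n set). \<Sum>j\<in>(UNIV::'n set). \<bar>k1\<bar>)" if x: "x \<in> \<Omega>" for x
  proof -
    have "norm (K x) \<le> (\<Sum>i\<in>UNIV. norm (K x $ i))"
      unfolding norm_vec_def[of "K x"] by (rule L2_set_le_sum) simp
    also have "\<dots> \<le> (\<Sum>i\<in>UNIV. \<Sum>j\<in>UNIV. \<bar>K x $ i $ j\<bar>)" by (intro sum_mono norm_le_l1_cart)
    also have "\<dots> \<le> (\<Sum>i\<in>(UNIV::'n set). \<Sum>j\<in>(UNIV::'n set). \<bar>k1\<bar>)" by (intro sum_mono entry x)
    finally show ?thesis .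
  qed
  have "\<Omega> \<in> lmeasurable" using open_\<Omega> bounded_\<Omega> by (rule lmeasurable_open[rotated])
  then have "finite_measure (lebesgue_on \<Omega>)" by (rule finite_measure_lebesgue_on)
  moreover have "AE x in lebesgue_on \<Omega>. norm (K x) \<le> (\<Sum>i\<in>(UNIV::'n set). \<Sum>j\<in>(UNIV::'n set). \<bar>k1\<bar>)"
    using nb by (intro AE_I2) auto
  ultimately show ?thesis using meas finite_measure.integrable_const_bound by blast
qed

text \<open>Symmetry and the lower bound are conditions on linear functionals of the matrix, and these commute
  with taking the mean.\<close>
lemma coefficient_mean:
  fixes K :: "real^'n \<Rightarrow> real^'n^'n"
  assumes T: "T \<in> \<T>"
    and meas: "K \<in> borel_measurable (lebesgue_on \<Omega>)" and sym: "\<forall>x\<in>\<Omega>. transpose (K x) = K x"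
    and k0: "0 < k0"
    and bounds: "\<forall>x\<in>\<Omega>. \<forall>\<xi>. k0 * (norm \<xi>)\<^sup>2 \<le> \<xi> \<bullet> (K x *v \<xi>) \<and> \<xi> \<bullet> (K x *v \<xi>) \<le> k1 * (norm \<xi>)\<^sup>2"
  shows "transpose (elem_mean T K) = elem_mean T K"
    and "k0 * (norm \<xi>)\<^sup>2 \<le> \<xi> \<bullet> (elem_mean T K *v \<xi>)"
proof -
  interpret t: full_simplex T by (rule simplexI[OF T])
  have i: "integrable (lebesgue_on T) K"
    by (rule integrable_element[OF T coefficient_integrable[OF meas sym k0 bounds]])
  have bl: "(LINT x|lebesgue_on T. L (K x)) = vol T * L (elem_mean T K) \<and> integrable (lebesgue_on T) (\<lambda>x. L (K x))"
    if L: "linear L" for L :: "real^'n^'n \<Rightarrow> real"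
  proof -
    have b: "bounded_linear L" using L by (simp add: linear_conv_bounded_linear)
    have "L (elem_mean T K) = inverse (vol T) * L (LINT x|lebesgue_on T. K x)"
      unfolding elem_mean_def using L by (simp add: linear_scale)
    then show ?thesis
      using integral_bounded_linear[OF b i] integrable_bounded_linear[OF b i] t.measure_pos by simp
  qed
  have "elem_mean T K $ i $ j = elem_mean T K $ j $ i" for i j
  proof -
    let ?L = "\<lambda>A :: real^'n^'n. A $ i $ j - A $ j $ i"
    have "linear ?L" by (intro linearI) (auto simp: algebra_simps)
    note B = bl[OF this]
    have z: "?L (K x) = 0" if "x \<in> \<Omega>" for x
      using arg_cong[OF bspec[OF sym that], of "\<lambda>A. A $ i $ j"] by (simp add: transpose_def)
    have "(LINT x|lebesgue_on T. ?L (K x)) = 0"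
      by (rule integral_eq_zero_AE) (rule AE_element[OF T z])
    then show ?thesis using B t.measure_pos by simp
  qed
  then show "transpose (elem_mean T K) = elem_mean T K" by (simp add: transpose_def vec_eq_iff)
  let ?L = "\<lambda>A :: real^'n^'n. \<xi> \<bullet> (A *v \<xi>)"
  have "linear ?L"
    by (intro linearI) (auto simp: matrix_vector_mult_add_rdistrib inner_add_right scaleR_matrix_vector_assoc[symmetric])
  note B = bl[OF this]
  have "vol T * (k0 * (norm \<xi>)\<^sup>2) = (LINT x|lebesgue_on T. k0 * (norm \<xi>)\<^sup>2)"
    using t.integral_one[of "k0 * (norm \<xi>)\<^sup>2"] by simp
  also have "\<dots> \<le> (LINT x|lebesgue_on T. ?L (K x))"
    using B bounds by (intro integral_mono_AE t.integrable_affine AE_element[OF T]) auto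
  finally show "k0 * (norm \<xi>)\<^sup>2 \<le> ?L (elem_mean T K)" using B t.measure_pos by simp
qed

end

section \<open>Crouzeix-Raviart functions and the discrete flux equation\<close>

definition affine_on :: "'a::real_inner set \<Rightarrow> ('a \<Rightarrow> real) \<Rightarrow> bool" where
  "affine_on A q \<longleftrightarrow> (\<exists>k g. \<forall>x \<in> A. q x = k + g \<bullet> x)"

lemma affine_on_const: "affine_on A (\<lambda>x. c)"
  unfolding affine_on_def by (intro exI[of _ c] exI[of _ 0]) simp

lemma affine_on_diff:
  assumes "affine_on A q" "affine_on A r"
  shows "affine_on A (\<lambda>x. q x - r x)"
proof -
  obtain k g k' g' where "\<forall>x\<in>A. q x = k + g \<bullet> x" "\<forall>x\<in>A. r x = k' + g' \<bullet> x"
    using assms unfolding affine_on_def by blast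
  then show ?thesis unfolding affine_on_def
    by (intro exI[of _ "k - k'"] exI[of _ "g - g'"]) (simp add: inner_diff_left)
qed

lemma affine_on_sum:
  assumes "finite I" "\<And>i. i \<in> I \<Longrightarrow> affine_on A (f i)"
  shows "affine_on A (\<lambda>x. \<Sum>i\<in>I. c i * f i x)"
proof -
  obtain k g where kg: "\<And>i x. i \<in> I \<Longrightarrow> x \<in> A \<Longrightarrow> f i x = k i + g i \<bullet> x"
    using assms(2) unfolding affine_on_def by metis
  show ?thesis unfolding affine_on_def
    by (intro exI[of _ "\<Sum>i\<in>I. c i * k i"] exI[of _ "\<Sum>i\<in>I. c i *\<^sub>R g i"])
       (simp add: kg inner_sum_left sum.distrib distrib_left)
qed

context mesh
begin

lemma CR_affine: "q \<in> CR \<Omega> \<T> \<Longrightarrow> T \<in> \<T> \<Longrightarrow> affine_on T (q T)"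
  unfolding CR_def affine_on_def by blast

lemma CR_continuous:
  "q \<in> CR \<Omega> \<T> \<Longrightarrow> S \<in> facets \<T> - bd_facets \<Omega> \<T> \<Longrightarrow> T \<in> \<T> \<Longrightarrow> S facet_of T \<Longrightarrow> T' \<in> \<T> \<Longrightarrow> S facet_of T' \<Longrightarrow>
    q T (barycenter S) = q T' (barycenter S)"
  unfolding CR_def by blast

text \<open>On an element with facet \<open>S\<close> the basis function of \<open>S\<close> is \<open>1 - d * \<lambda>\<close>, where \<open>\<lambda>\<close> is the
  barycentric coordinate of the opposite vertex.\<close>
lemma cr_basis_CR: "cr_basis \<Omega> \<T> S \<in> CR \<Omega> \<T>"
proof -
  define \<phi> where "\<phi> T x = (if S facet_of T then 1 - CARD('n) * bcoord T (opp T S) x else 0)" for T x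
  have val: "\<phi> T (barycenter S') = (if S' = S then 1 else 0)" if T: "T \<in> \<T>" and S': "S' facet_of T" for T S'
  proof (cases "S facet_of T")
    case True
    interpret s': simplex_facet T S' by (rule facetI[OF T S'])
    have "opp T S = opp T S' \<longleftrightarrow> S' = S" using s'.opp(2)[OF True] s'.opp(2)[OF S'] by metis
    then show ?thesis
      using s'.bcoord_barycenter[OF s'.opp(1)[OF True]] True by (simp add: \<phi>_def)
  next
    case False
    then show ?thesis using S' by (auto simp: \<phi>_def)
  qed
  have aff: "\<exists>a b. \<forall>x\<in>T. \<phi> T x = a + b \<bullet> x" if "T \<in> \<T>" for T
  proof (cases "S facet_of T")
    case True
    then show ?thesis
      by (intro exI[of _ "1 - CARD('n) * (1 - bgrad T (opp T S) \<bullet> opp T S)"] exI[of _ "- (real CARD('n) *\<^sub>R bgrad T (opp T S))"])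
         (simp add: \<phi>_def bcoord_def algebra_simps)
  next
    case False
    then show ?thesis by (intro exI[of _ 0]) (simp add: \<phi>_def)
  qed
  have "\<phi> \<in> CR \<Omega> \<T>" unfolding CR_def using aff val by auto
  then have "\<exists>\<phi>. \<phi> \<in> CR \<Omega> \<T> \<and> (\<forall>T\<in>\<T>. \<forall>S'. S' facet_of T \<longrightarrow> \<phi> T (barycenter S') = (if S' = S then 1 else 0))"
    using val by blast
  from someI_ex[OF this] show ?thesis unfolding cr_basis_def by blast
qed

lemma cr_interp_affine: "T \<in> \<T> \<Longrightarrow> affine_on T (cr_interp \<Omega> \<T> q T)"
  using affine_on_sum[OF finite_facets, of T "\<lambda>S. cr_basis \<Omega> \<T> S T" "\<lambda>S. facet_mean S (facet_trace \<Omega> S q)"]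
    CR_affine[OF cr_basis_CR]
  unfolding cr_interp_def[abs_def] by blast

text \<open>Discrete integration by parts: facets contribute the fluxes of their adjacent elements,
  weighted with the barycenter values seen from these elements.\<close>
lemma discrete_parts:
  assumes v: "\<And>T. T \<in> \<T> \<Longrightarrow> RT_field T (v T)" and q: "\<And>T x. T \<in> \<T> \<Longrightarrow> x \<in> T \<Longrightarrow> q T x = k T + g T \<bullet> x"
  shows "(\<Sum>T\<in>\<T>. vol T * (g T \<bullet> elem_mean T (v T))) + (\<Sum>T\<in>\<T>. vol T * (RT_div T (v T) * elem_mean T (q T)))
    = (\<Sum>S\<in>facets \<T>. area S * (\<Sum>T\<in>adj S. flux T (v T) S * q T (barycenter S)))"
proof -
  have "(\<Sum>T\<in>\<T>. vol T * (g T \<bullet> elem_mean T (v T))) + (\<Sum>T\<in>\<T>. vol T * (RT_div T (v T) * elem_mean T (q T)))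
    = (\<Sum>T\<in>\<T>. \<Sum>S | S facet_of T. area S * (flux T (v T) S * q T (barycenter S)))"
    unfolding sum.distrib[symmetric]
  proof (intro sum.cong refl)
    fix T assume T: "T \<in> \<T>"
    show "vol T * (g T \<bullet> elem_mean T (v T)) + vol T * (RT_div T (v T) * elem_mean T (q T))
        = (\<Sum>S | S facet_of T. area S * (flux T (v T) S * q T (barycenter S)))"
      by (rule full_simplex.element_divergence_affine[OF simplexI[OF T] v[OF T], of "q T" "k T" "g T"]) (rule q[OF T])
  qed
  then show ?thesis unfolding sum_facets_swap sum_distrib_left .
qed

lemma adjacent_bd:
  assumes "T \<in> \<T>" "S facet_of T" "S \<subseteq> frontier \<Omega>"
  shows "{T'. T' \<in> \<T> \<and> S facet_of T'} = {T}"
  using assms bd_facet_unique by blast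

lemma jump_bd: "T \<in> \<T> \<Longrightarrow> S facet_of T \<Longrightarrow> S \<subseteq> frontier \<Omega> \<Longrightarrow> jump v S = flux T (v T) S"
  unfolding jump_def using adjacent_bd by simp

lemma bd_facetE:
  assumes "S \<in> bd_facets \<Omega> \<T>"
  obtains T where "T \<in> \<T>" "S facet_of T" "S \<subseteq> frontier \<Omega>"
  using assms unfolding bd_facets_def facets_def by blast

lemma bd_inner_normal_trace:
  assumes v: "\<And>T. T \<in> \<T> \<Longrightarrow> RT_field T (v T)" and SS: "\<S> \<subseteq> bd_facets \<Omega> \<T>"
    and g: "\<And>S. S \<in> \<S> \<Longrightarrow> affine_on S (g S)"
  shows "bd_inner \<S> g (normal_trace \<Omega> \<T> v) = (\<Sum>S\<in>\<S>. area S * (jump v S * g S (barycenter S)))"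
  unfolding bd_inner_def
proof (intro sum.cong refl)
  fix S assume S: "S \<in> \<S>"
  obtain T where T: "T \<in> \<T>" "S facet_of T" "S \<subseteq> frontier \<Omega>" using SS S bd_facetE by blast
  interpret s: simplex_facet T S by (rule facetI[OF T(1,2)])
  obtain k d where kd: "\<And>x. x \<in> S \<Longrightarrow> g S x = k + d \<bullet> x" using g[OF S] unfolding affine_on_def by blast
  let ?f = "flux T (v T) S"
  have "(LINT x|facet_measure S. g S x * normal_trace \<Omega> \<T> v S x) = (LINT x|facet_measure S. k * ?f + (?f *\<^sub>R d) \<bullet> x)"
  proof (rule s.integral_AE_cong)
    show "AE x in facet_measure S. g S x * normal_trace \<Omega> \<T> v S x = k * ?f + (?f *\<^sub>R d) \<bullet> x"
      using flux_normal_trace[where v=v, OF v[OF T(1)] T] s.AE_facet_rel_interior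
    proof eventually_elim
      fix x assume "normal_trace \<Omega> \<T> v S x = ?f" "x \<in> rel_interior S"
      then show "g S x * normal_trace \<Omega> \<T> v S x = k * ?f + (?f *\<^sub>R d) \<bullet> x"
        using kd[of x] rel_interior_subset[of S] by (auto simp: algebra_simps)
    qed
  qed (intro borel_measurable_continuous_onI continuous_intros)
  also have "\<dots> = area S * (jump v S * g S (barycenter S))"
    unfolding s.facet_integral_affine jump_bd[OF T] kd[OF s.barycenter_in] by (simp add: algebra_simps)
  finally show "(LINT x|facet_measure S. g S x * normal_trace \<Omega> \<T> v S x) = area S * (jump v S * g S (barycenter S))" .
qed

text \<open>A test field that carries flux through \<open>S\<close> only; \<open>\<sigma>\<close> is the flux density out of each adjacent
  element.\<close>
definition facet_field :: "(real^'n) set \<Rightarrow> ((real^'n) set \<Rightarrow> real) \<Rightarrow> (real^'n) set \<Rightarrow> real^'n \<Rightarrow> real^'n" where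
  "facet_field S \<sigma> T x = (if S facet_of T then \<sigma> T *\<^sub>R full_simplex.shape T S x else 0)"

lemma facet_field_RT: "T \<in> \<T> \<Longrightarrow> RT_field T (facet_field S \<sigma> T)"
proof (cases "S facet_of T")
  case True
  assume T: "T \<in> \<T>"
  obtain a b where "\<forall>x\<in>T. full_simplex.shape T S x = a + b *\<^sub>R x"
    using full_simplex.RT_field_shape[OF simplexI[OF T]] unfolding RT_field_def by blast
  then show ?thesis unfolding RT_field_def using True
    by (intro exI[of _ "\<sigma> T *\<^sub>R a"] exI[of _ "\<sigma> T * b"]) (simp add: facet_field_def algebra_simps)
next
  case False
  then show ?thesis unfolding RT_field_def
    by (intro exI[of _ 0]) (simp add: facet_field_def)
qed

lemma flux_facet_field:
  assumes T: "T \<in> \<T>" "S' facet_of T"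
  shows "flux T (facet_field S \<sigma> T) S' = (if S' = S then \<sigma> T else 0)"
proof (cases "S facet_of T")
  case True
  have "flux T (facet_field S \<sigma> T) S' = \<sigma> T * flux T (full_simplex.shape T S) S'"
    using True by (simp add: flux_def facet_field_def)
  then show ?thesis using full_simplex.flux_shape[OF simplexI[OF T(1)] True T(2)] by simp
next
  case False
  then show ?thesis using T by (auto simp: flux_def facet_field_def)
qed

lemma jump_facet_field:
  "jump (facet_field S \<sigma>) S' = (if S' = S then \<Sum>T\<in>adj S. \<sigma> T else 0)"
proof -
  have "jump (facet_field S \<sigma>) S' = (\<Sum>T\<in>adj S'. if S' = S then \<sigma> T else 0)"
    unfolding jump_def by (intro sum.cong refl) (simp add: flux_facet_field)
  then show ?thesis by simp
qed

lemma facet_field_RT0: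
  assumes "S \<in> bd_facets \<Omega> \<T> \<or> (\<Sum>T\<in>adj S. \<sigma> T) = 0"
  shows "facet_field S \<sigma> \<in> RT0 \<Omega> \<T>"
  by (rule RT0I) (use assms in \<open>auto simp: facet_field_RT jump_facet_field\<close>)

end

text \<open>The potential reconstructed from a discrete flux, with the flux equation of the discrete
  optimality system; \<open>w\<close> stands for the elementwise constant field \<open>K\<^sup>-\<^sup>1 u\<close>.\<close>
locale flux_equation = mesh \<Omega> \<T> for \<Omega> :: "(real^'n) set" and \<T> +
  fixes C D :: "(real^'n) set set" and w :: "(real^'n) set \<Rightarrow> real^'n"
    and p l :: "(real^'n) set \<Rightarrow> real" and pD :: "(real^'n) set \<Rightarrow> real^'n \<Rightarrow> real"
  assumes CD: "C \<subseteq> bd_facets \<Omega> \<T>" "D \<subseteq> bd_facets \<Omega> \<T>" "C \<inter> D = {}" "bd_facets \<Omega> \<T> \<subseteq> C \<union> D"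
    and pD: "\<And>T. T \<in> \<T> \<Longrightarrow> affine_on T (pD T)"
    and flux_eq: "\<And>v. v \<in> RT0 \<Omega> \<T> \<Longrightarrow>
        L2_inner \<Omega> (glue0 \<T> w) (glue0 \<T> (\<lambda>T. elem_mean T (v T)))
        - L2_inner \<Omega> (glue0 \<T> p) (weak_div \<Omega> (glue \<T> v))
        + bd_inner C (\<lambda>S x. l S) (normal_trace \<Omega> \<T> v)
        = - bd_inner D (bd_value \<T> pD) (normal_trace \<Omega> \<T> v)"
begin

definition recon :: "(real^'n) set \<Rightarrow> real^'n \<Rightarrow> real" where
  "recon T x = p T - w T \<bullet> (x - barycenter T)"

lemma recon_affine: "recon T x = (p T + w T \<bullet> barycenter T) + (- w T) \<bullet> x"
  by (simp add: recon_def inner_diff_right)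

lemma finite_CD: "finite C" "finite D"
  using CD(1,2) finite_facets bd_facets_subset finite_subset by metis+

lemma pD_affine: "S \<in> bd_facets \<Omega> \<T> \<Longrightarrow> affine_on S (bd_value \<T> pD S)"
proof -
  assume "S \<in> bd_facets \<Omega> \<T>"
  then obtain T where T: "T \<in> \<T>" "S facet_of T" "S \<subseteq> frontier \<Omega>" by (rule bd_facetE)
  show ?thesis unfolding bd_value_facet[OF T]
    using pD[OF T(1)] facet_of_imp_subset[OF T(2)] unfolding affine_on_def by blast
qed

text \<open>Since \<open>- w\<close> is the gradient of the reconstruction and \<open>p\<close> its elementwise mean, the first two terms
  of the flux equation are minus the left side of the discrete integration by parts.\<close>
lemma flux_balance:
  assumes v: "v \<in> RT0 \<Omega> \<T>"
  shows "(\<Sum>S\<in>facets \<T>. area S * (\<Sum>T\<in>adj S. flux T (v T) S * recon T (barycenter S)))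
    = (\<Sum>S\<in>C. area S * (jump v S * l S)) + (\<Sum>S\<in>D. area S * (jump v S * bd_value \<T> pD S (barycenter S)))"
proof -
  have f: "RT_field T (v T)" if "T \<in> \<T>" for T by (rule RT0_field[OF v that])
  have "elem_mean T (recon T) = p T" if "T \<in> \<T>" for T
    using full_simplex.elem_mean_affine[OF simplexI[OF that] recon_affine[of T]] by simp
  then have "(\<Sum>S\<in>facets \<T>. area S * (\<Sum>T\<in>adj S. flux T (v T) S * recon T (barycenter S)))
     = (\<Sum>T\<in>\<T>. vol T * ((- w T) \<bullet> elem_mean T (v T))) + (\<Sum>T\<in>\<T>. vol T * (RT_div T (v T) * p T))"
    using discrete_parts[where v=v and q=recon and k="\<lambda>T. p T + w T \<bullet> barycenter T" and g="\<lambda>T. - w T", OF f recon_affine]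
    by simp
  also have "\<dots> = - (L2_inner \<Omega> (glue0 \<T> w) (glue0 \<T> (\<lambda>T. elem_mean T (v T))) - L2_inner \<Omega> (glue0 \<T> p) (weak_div \<Omega> (glue \<T> v)))"
    unfolding L2_inner_glue0 L2_inner_weak_div(1)[OF v] by (simp add: sum_negf mult.commute)
  also have "\<dots> = bd_inner C (\<lambda>S x. l S) (normal_trace \<Omega> \<T> v) + bd_inner D (bd_value \<T> pD) (normal_trace \<Omega> \<T> v)"
    using flux_eq[OF v] by simp
  also have "bd_inner C (\<lambda>S x. l S) (normal_trace \<Omega> \<T> v) = (\<Sum>S\<in>C. area S * (jump v S * l S))"
    by (rule bd_inner_normal_trace[OF f CD(1)]) (auto simp: affine_on_const)
  also have "bd_inner D (bd_value \<T> pD) (normal_trace \<Omega> \<T> v) = (\<Sum>S\<in>D. area S * (jump v S * bd_value \<T> pD S (barycenter S)))"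
    by (rule bd_inner_normal_trace[OF f CD(2)]) (use pD_affine CD(2) in blast)+
  finally show ?thesis .
qed

text \<open>Testing with fields concentrated at one facet isolates the barycenter values.\<close>
lemma facet_balance:
  assumes S: "S \<in> facets \<T>" and \<sigma>: "S \<in> bd_facets \<Omega> \<T> \<or> (\<Sum>T\<in>adj S. \<sigma> T) = 0"
  shows "(\<Sum>T\<in>adj S. \<sigma> T * recon T (barycenter S)) =
    (\<Sum>T\<in>adj S. \<sigma> T) * ((if S \<in> C then l S else 0) + (if S \<in> D then bd_value \<T> pD S (barycenter S) else 0))"
proof -
  let ?v = "facet_field S \<sigma>" and ?s = "\<Sum>T\<in>adj S. \<sigma> T"
  obtain T where T: "T \<in> \<T>" "S facet_of T" using S unfolding facets_def by blast
  have "(\<Sum>S'\<in>facets \<T>. area S' * (\<Sum>T\<in>adj S'. flux T (?v T) S' * recon T (barycenter S')))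
     = (\<Sum>S'\<in>facets \<T>. if S' = S then area S * (\<Sum>T\<in>adj S. \<sigma> T * recon T (barycenter S)) else 0)"
    by (intro sum.cong refl) (auto simp: flux_facet_field intro!: sum.cong)
  then have L: "(\<Sum>S'\<in>facets \<T>. area S' * (\<Sum>T\<in>adj S'. flux T (?v T) S' * recon T (barycenter S')))
     = area S * (\<Sum>T\<in>adj S. \<sigma> T * recon T (barycenter S))"
    using S finite_facets by simp
  have "(\<Sum>S'\<in>C. area S' * (jump ?v S' * l S')) = (\<Sum>S'\<in>C. if S' = S then area S * (?s * l S) else 0)"
    by (intro sum.cong refl) (simp add: jump_facet_field)
  then have RC: "(\<Sum>S'\<in>C. area S' * (jump ?v S' * l S')) = area S * (?s * (if S \<in> C then l S else 0))"
    using finite_CD(1) by simp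
  have "(\<Sum>S'\<in>D. area S' * (jump ?v S' * bd_value \<T> pD S' (barycenter S')))
      = (\<Sum>S'\<in>D. if S' = S then area S * (?s * bd_value \<T> pD S (barycenter S)) else 0)"
    by (intro sum.cong refl) (simp add: jump_facet_field)
  then have RD: "(\<Sum>S'\<in>D. area S' * (jump ?v S' * bd_value \<T> pD S' (barycenter S')))
      = area S * (?s * (if S \<in> D then bd_value \<T> pD S (barycenter S) else 0))"
    using finite_CD(2) by simp
  have "area S * (\<Sum>T\<in>adj S. \<sigma> T * recon T (barycenter S)) =
     area S * (?s * ((if S \<in> C then l S else 0) + (if S \<in> D then bd_value \<T> pD S (barycenter S) else 0)))"
    using flux_balance[OF facet_field_RT0[OF \<sigma>]] unfolding L RC RD by (simp add: distrib_left)
  then show ?thesis using simplex_facet.area_pos[OF facetI[OF T]] by simp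
qed

text \<open>Test with a unit flux density out of \<open>T\<close> through \<open>S\<close> into \<open>T'\<close>.\<close>
lemma recon_continuous:
  assumes S: "S \<in> facets \<T> - bd_facets \<Omega> \<T>" and T: "T \<in> \<T>" "S facet_of T" and T': "T' \<in> \<T>" "S facet_of T'"
  shows "recon T (barycenter S) = recon T' (barycenter S)"
proof -
  define \<sigma> :: "(real^'n) set \<Rightarrow> real" where "\<sigma> U = of_bool (U = T) - of_bool (U = T')" for U
  let ?A = "{U. U \<in> \<T> \<and> S facet_of U}"
  have fin: "finite ?A" using finite_\<T> by simp
  have pick: "(\<Sum>U\<in>?A. \<sigma> U * f U) = f T - f T'" for f :: "(real^'n) set \<Rightarrow> real"
  proof -
    have "(\<Sum>U\<in>?A. \<sigma> U * f U) = (\<Sum>U\<in>?A. (if U = T then f T else 0) - (if U = T' then f T' else 0))"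
      by (intro sum.cong refl) (auto simp: \<sigma>_def)
    also have "\<dots> = (\<Sum>U\<in>?A. if U = T then f T else 0) - (\<Sum>U\<in>?A. if U = T' then f T' else 0)"
      by (rule sum_subtractf)
    also have "\<dots> = f T - f T'" using fin T T' by simp
    finally show ?thesis .
  qed
  have "(\<Sum>U\<in>?A. \<sigma> U) = 0" using pick[of "\<lambda>_. 1"] by simp
  then show ?thesis using facet_balance[of S \<sigma>] S pick[of "\<lambda>U. recon U (barycenter S)"] by simp
qed

lemma recon_bd:
  assumes T: "T \<in> \<T>" "S facet_of T" and bd: "S \<in> bd_facets \<Omega> \<T>"
  shows "recon T (barycenter S) = (if S \<in> C then l S else bd_value \<T> pD S (barycenter S))"
proof -
  have "S \<subseteq> frontier \<Omega>" "S \<in> facets \<T>" using bd by (auto simp: bd_facets_def)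
  then show ?thesis
    using facet_balance[of S "\<lambda>_. 1"] bd CD adjacent_bd[OF T] by auto
qed

lemma recon_boundary_value:
  assumes "S \<in> bd_facets \<Omega> \<T>"
  shows "bd_value \<T> recon S (barycenter S) = (if S \<in> C then l S else bd_value \<T> pD S (barycenter S))"
proof -
  obtain T where T: "T \<in> \<T>" "S facet_of T" "S \<subseteq> frontier \<Omega>" using assms by (rule bd_facetE)
  show ?thesis using bd_value_facet[OF T, of recon] recon_bd[OF T(1,2) assms] by simp
qed

end

section \<open>The energy and its minimiser\<close>

context mesh
begin

text \<open>On an interior facet a Crouzeix-Raviart function has one barycenter value and the jump of the flux
  is zero, so only boundary facets contribute.\<close>
lemma sum_CR_bd:
  assumes q: "q \<in> CR \<Omega> \<T>" and v: "v \<in> RT0 \<Omega> \<T>"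
  shows "(\<Sum>S\<in>facets \<T>. area S * (\<Sum>T\<in>adj S. flux T (v T) S * q T (barycenter S)))
     = (\<Sum>S\<in>bd_facets \<Omega> \<T>. area S * (jump v S * bd_value \<T> q S (barycenter S)))"
proof (rule sum.mono_neutral_cong_right[OF finite_facets bd_facets_subset])
  show "\<forall>S\<in>facets \<T> - bd_facets \<Omega> \<T>. area S * (\<Sum>T\<in>adj S. flux T (v T) S * q T (barycenter S)) = 0"
  proof
    fix S assume S: "S \<in> facets \<T> - bd_facets \<Omega> \<T>"
    then obtain T0 where T0: "T0 \<in> \<T>" "S facet_of T0" unfolding facets_def by blast
    have "(\<Sum>T\<in>adj S. flux T (v T) S * q T (barycenter S)) = jump v S * q T0 (barycenter S)"
      unfolding jump_def sum_distrib_right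
      using CR_continuous[OF q S _ _ T0] by (intro sum.cong refl) auto
    then show "area S * (\<Sum>T\<in>adj S. flux T (v T) S * q T (barycenter S)) = 0"
      using RT0_jump[OF v S] by simp
  qed
  fix S assume "S \<in> bd_facets \<Omega> \<T>"
  then obtain T where T: "T \<in> \<T>" "S facet_of T" "S \<subseteq> frontier \<Omega>" by (rule bd_facetE)
  show "area S * (\<Sum>T\<in>adj S. flux T (v T) S * q T (barycenter S)) = area S * (jump v S * bd_value \<T> q S (barycenter S))"
    unfolding adjacent_bd[OF T] jump_bd[OF T] bd_value_facet[OF T] by simp
qed

lemma I_cr_eq:
  assumes q: "\<And>T x. T \<in> \<T> \<Longrightarrow> x \<in> T \<Longrightarrow> q T x = k T + g T \<bullet> x"
    and sym: "\<And>T. T \<in> \<T> \<Longrightarrow> transpose (Kh T) = Kh T"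
    and psd: "\<And>T \<xi>. T \<in> \<T> \<Longrightarrow> 0 \<le> \<xi> \<bullet> (Kh T *v \<xi>)"
    and C: "facets_on \<Omega> \<T> \<Gamma>C \<subseteq> bd_facets \<Omega> \<T>"
  shows "I_cr \<Omega> \<T> \<Gamma>C Kh fh \<alpha>h \<beta>h q =
     (\<Sum>T\<in>\<T>. vol T * (1/2 * (g T \<bullet> (Kh T *v g T)) - fh T * elem_mean T (q T)))
     + (\<Sum>S\<in>facets_on \<Omega> \<T> \<Gamma>C. area S * (\<beta>h S * pos_part (bd_value \<T> q S (barycenter S)) - \<alpha>h S * neg_part (bd_value \<T> q S (barycenter S))))"
proof -
  let ?F = "glue \<T> (\<lambda>T x. mat_sqrt (Kh T) *v grad (q T) x)"
  have gr: "grad (q T) x = g T" if T: "T \<in> \<T>" "x \<in> interior T" for T x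
  proof (rule grad_transform[OF _ open_interior T(2)])
    show "GDERIV (\<lambda>x. k T + g T \<bullet> x) x :> g T"
      unfolding gderiv_def by (auto intro!: derivative_eq_intros simp: inner_commute)
    show "q T y = k T + g T \<bullet> y" if "y \<in> interior T" for y using q[OF T(1)] that interior_subset by blast
  qed
  have "L2_inner \<Omega> ?F ?F = (\<Sum>T\<in>\<T>. LINT x|lebesgue_on T. (mat_sqrt (Kh T) *v g T) \<bullet> (mat_sqrt (Kh T) *v g T))"
    by (subst L2_inner_pieces[where v'="\<lambda>T x. mat_sqrt (Kh T) *v g T" and w'="\<lambda>T x. mat_sqrt (Kh T) *v g T"])
       (auto simp: glue_interior gr)
  also have "\<dots> = (\<Sum>T\<in>\<T>. vol T * (g T \<bullet> (Kh T *v g T)))"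
    by (intro sum.cong refl)
       (simp add: mat_sqrt_inner[OF sym psd] full_simplex.measure_lebesgue_on[OF simplexI])
  finally have e: "L2_inner \<Omega> ?F ?F = (\<Sum>T\<in>\<T>. vol T * (g T \<bullet> (Kh T *v g T)))" .
  moreover have "0 \<le> L2_inner \<Omega> ?F ?F" unfolding e using psd by (intro sum_nonneg) simp
  ultimately have norm: "(L2_norm \<Omega> ?F)\<^sup>2 = (\<Sum>T\<in>\<T>. vol T * (g T \<bullet> (Kh T *v g T)))"
    unfolding L2_norm_def by simp
  have bd: "bd_inner (facets_on \<Omega> \<T> \<Gamma>C) (\<lambda>S x. c S) (\<lambda>S x. P (facet_mean S (bd_value \<T> q S)))
     = (\<Sum>S\<in>facets_on \<Omega> \<T> \<Gamma>C. area S * (c S * P (bd_value \<T> q S (barycenter S))))" for c and P :: "real \<Rightarrow> real"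
    unfolding bd_inner_def
  proof (intro sum.cong refl)
    fix S assume "S \<in> facets_on \<Omega> \<T> \<Gamma>C"
    then obtain T where T: "T \<in> \<T>" "S facet_of T" "S \<subseteq> frontier \<Omega>" using C bd_facetE by blast
    interpret s: simplex_facet T S by (rule facetI[OF T(1,2)])
    have "facet_mean S (q T) = q T (barycenter S)"
      using q[OF T(1)] facet_of_imp_subset[OF T(2)] by (intro s.facet_mean_affine(2)) blast
    then show "(LINT x|facet_measure S. c S * P (facet_mean S (bd_value \<T> q S))) = area S * (c S * P (bd_value \<T> q S (barycenter S)))"
      unfolding bd_value_facet[OF T] by (simp only: s.integral_const)
  qed
  show ?thesis unfolding I_cr_def norm L2_inner_glue0 bd
    by (simp add: right_diff_distrib sum_subtractf sum_distrib_left algebra_simps)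
qed

end

lemma quadratic_convex:
  fixes A :: "real^'n^'n"
  assumes sym: "transpose A = A" and psd: "\<And>\<xi>. 0 \<le> \<xi> \<bullet> (A *v \<xi>)"
  shows "(A *v g) \<bullet> (g' - g) \<le> 1/2 * (g' \<bullet> (A *v g')) - 1/2 * (g \<bullet> (A *v g))"
proof -
  have "g' \<bullet> (A *v g) = g \<bullet> (A *v g')"
    using transpose_inner[of A g g'] sym by (simp add: inner_commute)
  then show ?thesis using psd[of "g' - g"]
    by (simp add: matrix_vector_mult_diff_distrib inner_diff_left inner_diff_right inner_commute[of "A *v g"])
qed

text \<open>The complementarity conditions say that \<open>c\<close> is a subgradient at \<open>la - lb\<close> of the convex
  function with slopes \<open>\<alpha>\<close> and \<open>\<beta>\<close>.\<close>
lemma contact_subgradient: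
  fixes \<alpha> \<beta> c la lb q :: real
  assumes "\<alpha> \<le> c" "c \<le> \<beta>" "la \<le> 0" "lb \<le> 0" "la * (c - \<alpha>) = 0" "lb * (\<beta> - c) = 0"
  shows "c * (q - (la - lb)) \<le> (\<beta> * pos_part q - \<alpha> * neg_part q) - (\<beta> * pos_part (la - lb) - \<alpha> * neg_part (la - lb))"
proof -
  have q: "c * q \<le> \<beta> * pos_part q - \<alpha> * neg_part q"
    using assms(1,2) mult_right_mono[of c \<beta> q] mult_right_mono_neg[of \<alpha> c q]
    by (cases "0 \<le> q") (auto simp: pos_part_def neg_part_def)
  have "\<beta> * pos_part (la - lb) - \<alpha> * neg_part (la - lb) = c * (la - lb)"
  proof -
    consider "la = lb" | "lb < la" | "la < lb" by linarith
    then show ?thesis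
    proof cases
      case 2 then have "\<beta> = c" using assms by auto
      then show ?thesis using 2 by (simp add: pos_part_def neg_part_def)
    next
      case 3 then have "\<alpha> = c" using assms by auto
      then show ?thesis using 3 by (simp add: pos_part_def neg_part_def algebra_simps)
    qed (simp add: pos_part_def neg_part_def)
  qed
  then show ?thesis using q by (simp add: algebra_simps)
qed

theorem lemma7p2:
  fixes \<Omega> \<Gamma>D \<Gamma>C :: "(real^'n) set"
    and f pD pD_ext \<alpha> \<beta> :: "real^'n \<Rightarrow> real"
    and K :: "real^'n \<Rightarrow> real^'n^'n"
    and k0 k1 :: real
    and \<T> :: "(real^'n) set set"
    and Kh :: "(real^'n) set \<Rightarrow> real^'n^'n"
    and fh \<alpha>h \<beta>h :: "(real^'n) set \<Rightarrow> real"
    and pDh p_hat :: "(real^'n) set \<Rightarrow> real^'n \<Rightarrow> real"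
    and u :: "(real^'n) set \<Rightarrow> real^'n \<Rightarrow> real^'n"
    and p lam_a lam_b :: "(real^'n) set \<Rightarrow> real"
  assumes dim: "CARD('n) \<in> {2, 3}"
    and domain: "polyhedral_lipschitz_domain \<Omega>"
    and boundary: "frontier \<Omega> = closure \<Gamma>D \<union> closure \<Gamma>C"
      "openin (top_of_set (frontier \<Omega>)) \<Gamma>D" "openin (top_of_set (frontier \<Omega>)) \<Gamma>C"
      "\<Gamma>D \<inter> \<Gamma>C = {}"
    and mesh: "conforming_mesh \<Omega> \<T>"
    and mesh_boundary: "\<forall>S \<in> bd_facets \<Omega> \<T>. (S \<subseteq> closure \<Gamma>D) \<noteq> (S \<subseteq> closure \<Gamma>C)"
    and f: "f \<in> L2 (lebesgue_on \<Omega>)"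
    and K_meas: "K \<in> borel_measurable (lebesgue_on \<Omega>)"
    and K_sym: "\<forall>x \<in> \<Omega>. transpose (K x) = K x"
    and k0k1: "0 < k0" "k0 < k1"
    and K_bounds: "\<forall>x \<in> \<Omega>. \<forall>\<xi>. k0 * (norm \<xi>)\<^sup>2 \<le> \<xi> \<bullet> (K x *v \<xi>) \<and> \<xi> \<bullet> (K x *v \<xi>) \<le> k1 * (norm \<xi>)\<^sup>2"
    and pD: "pD \<in> H_half \<Omega> (facets_on \<Omega> \<T> \<Gamma>D)"
    and pD_ext: "pD_ext \<in> H1 \<Omega>" "has_trace \<Omega> (facets_on \<Omega> \<T> \<Gamma>D) pD_ext pD"
    and \<alpha>\<beta>: "\<forall>S \<in> facets_on \<Omega> \<T> \<Gamma>C. \<alpha> \<in> L2 (facet_measure S) \<and> \<beta> \<in> L2 (facet_measure S) \<and>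
              (AE x in facet_measure S. \<alpha> x \<le> \<beta> x)"
    and compat: "\<Gamma>D = {} \<Longrightarrow>
        (\<Sum>S \<in> facets_on \<Omega> \<T> \<Gamma>C. LINT x|facet_measure S. \<alpha> x) \<le> (LINT x|lebesgue_on \<Omega>. f x) \<and>
        (LINT x|lebesgue_on \<Omega>. f x) \<le> (\<Sum>S \<in> facets_on \<Omega> \<T> \<Gamma>C. LINT x|facet_measure S. \<beta> x)"
    and Kh: "Kh = (\<lambda>T. elem_mean T K)"
    and fh: "fh = (\<lambda>T. elem_mean T f)"
    and \<alpha>h: "\<alpha>h = (\<lambda>S. facet_mean S \<alpha>)"
    and \<beta>h: "\<beta>h = (\<lambda>S. facet_mean S \<beta>)"
    and pDh: "pDh = cr_interp \<Omega> \<T> pD_ext"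
    and u: "u \<in> RT0 \<Omega> \<T>"
    and kkt_flux: "\<And>v. v \<in> RT0 \<Omega> \<T> \<Longrightarrow>
        L2_inner \<Omega> (glue0 \<T> (\<lambda>T. matrix_inv (Kh T) *v elem_mean T (u T)))
                    (glue0 \<T> (\<lambda>T. elem_mean T (v T)))
        - L2_inner \<Omega> (glue0 \<T> p) (weak_div \<Omega> (glue \<T> v))
        + bd_inner (facets_on \<Omega> \<T> \<Gamma>C) (\<lambda>S x. lam_a S - lam_b S) (normal_trace \<Omega> \<T> v)
        = - bd_inner (facets_on \<Omega> \<T> \<Gamma>D) (bd_value \<T> pDh) (normal_trace \<Omega> \<T> v)"
    and kkt_div: "\<And>q :: (real^'n) set \<Rightarrow> real.
        L2_inner \<Omega> (weak_div \<Omega> (glue \<T> u)) (glue0 \<T> q) = L2_inner \<Omega> (glue0 \<T> fh) (glue0 \<T> q)"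
    and kkt_contact: "\<And>S. S \<in> facets_on \<Omega> \<T> \<Gamma>C \<Longrightarrow>
        lam_a S \<le> 0 \<and> lam_b S \<le> 0 \<and>
        (AE x in facet_measure S.
           \<alpha>h S \<le> normal_trace \<Omega> \<T> u S x \<and> normal_trace \<Omega> \<T> u S x \<le> \<beta>h S \<and>
           lam_a S * (normal_trace \<Omega> \<T> u S x - \<alpha>h S) = 0 \<and>
           lam_b S * (\<beta>h S - normal_trace \<Omega> \<T> u S x) = 0)"
    and p_hat: "p_hat = (\<lambda>T x. p T - (matrix_inv (Kh T) *v elem_mean T (u T)) \<bullet> (x - elem_mean T (\<lambda>y. y)))"
  shows "p_hat \<in> K_adm \<Omega> \<T> \<Gamma>D pDh \<and>
         (\<forall>q \<in> K_adm \<Omega> \<T> \<Gamma>D pDh. I_cr \<Omega> \<T> \<Gamma>C Kh fh \<alpha>h \<beta>h p_hat \<le> I_cr \<Omega> \<T> \<Gamma>C Kh fh \<alpha>h \<beta>h q)"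
proof -
  interpret m: mesh \<Omega> \<T> by unfold_locales (rule domain, rule mesh)
  let ?C = "facets_on \<Omega> \<T> \<Gamma>C" and ?D = "facets_on \<Omega> \<T> \<Gamma>D"
  define w where "w T = matrix_inv (Kh T) *v elem_mean T (u T)" for T
  define l where "l S = lam_a S - lam_b S" for S
  have Ksym: "transpose (Kh T) = Kh T" and Kpos: "k0 * (norm \<xi>)\<^sup>2 \<le> \<xi> \<bullet> (Kh T *v \<xi>)" if "T \<in> \<T>" for T \<xi>
    unfolding Kh using m.coefficient_mean[OF that K_meas K_sym k0k1(1) K_bounds] by auto
  have Kpsd: "0 \<le> \<xi> \<bullet> (Kh T *v \<xi>)" if "T \<in> \<T>" for T \<xi>
    using Kpos[OF that, of \<xi>] k0k1(1) by (meson order_trans mult_nonneg_nonneg less_imp_le zero_le_power2)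
  have Kw: "Kh T *v w T = elem_mean T (u T)" if "T \<in> \<T>" for T
    unfolding w_def
  proof (rule pd_matrix_inv)
    fix \<xi> :: "real^'n" assume "\<xi> \<noteq> 0"
    then have "0 < k0 * (norm \<xi>)\<^sup>2" using k0k1(1) by simp
    then show "0 < \<xi> \<bullet> (Kh T *v \<xi>)" using Kpos[OF that, of \<xi>] by linarith
  qed
  interpret fe: flux_equation \<Omega> \<T> ?C ?D w p l pDh
  proof unfold_locales
    show "?C \<subseteq> bd_facets \<Omega> \<T>" "?D \<subseteq> bd_facets \<Omega> \<T>" by (auto simp: facets_on_def)
    show "?C \<inter> ?D = {}" "bd_facets \<Omega> \<T> \<subseteq> ?C \<union> ?D" using mesh_boundary by (auto simp: facets_on_def)
    show "affine_on T (pDh T)" if "T \<in> \<T>" for T unfolding pDh by (rule m.cr_interp_affine[OF that])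
    show "L2_inner \<Omega> (glue0 \<T> w) (glue0 \<T> (\<lambda>T. elem_mean T (v T)))
        - L2_inner \<Omega> (glue0 \<T> p) (weak_div \<Omega> (glue \<T> v))
        + bd_inner ?C (\<lambda>S x. l S) (normal_trace \<Omega> \<T> v)
        = - bd_inner ?D (bd_value \<T> pDh) (normal_trace \<Omega> \<T> v)" if "v \<in> RT0 \<Omega> \<T>" for v
      using kkt_flux[OF that] unfolding w_def l_def .
  qed
  have bary: "elem_mean T (\<lambda>y. y) = barycenter T" if "T \<in> \<T>" for T
    using full_simplex.elem_mean_RT[OF m.simplexI[OF that], of "\<lambda>y. y" 0 1] by simp
  have eq: "p_hat T = fe.recon T" if "T \<in> \<T>" for T
    by (rule ext) (simp only: fe.recon_def, simp only: p_hat w_def bary[OF that])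
  have aff: "p_hat T x = (p T + w T \<bullet> barycenter T) + (- w T) \<bullet> x" if "T \<in> \<T>" for T x
    using eq[OF that] fe.recon_affine by simp
  have bdv: "bd_value \<T> p_hat S = bd_value \<T> fe.recon S" if S: "S \<in> bd_facets \<Omega> \<T>" for S
  proof -
    obtain T where T: "T \<in> \<T>" "S facet_of T" "S \<subseteq> frontier \<Omega>" using S by (rule m.bd_facetE)
    show ?thesis unfolding m.bd_value_facet[OF T] by (rule eq[OF T(1)])
  qed
  have pCR: "p_hat \<in> CR \<Omega> \<T>" unfolding CR_def mem_Collect_eq
  proof (intro conjI ballI impI)
    show "\<exists>a b. \<forall>x\<in>T. p_hat T x = a + b \<bullet> x" if "T \<in> \<T>" for T using aff[OF that] by blast
    fix S T T' assume S: "S \<in> facets \<T> - bd_facets \<Omega> \<T>" and T: "T \<in> \<T>" "T' \<in> \<T>" "S facet_of T \<and> S facet_of T'"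
    show "p_hat T (barycenter S) = p_hat T' (barycenter S)"
      unfolding eq[OF T(1)] eq[OF T(2)] using fe.recon_continuous[OF S] T by blast
  qed
  have C_val: "bd_value \<T> p_hat S (barycenter S) = lam_a S - lam_b S" if "S \<in> ?C" for S
  proof -
    have S: "S \<in> bd_facets \<Omega> \<T>" using that fe.CD(1) by blast
    show ?thesis unfolding bdv[OF S] fe.recon_boundary_value[OF S] using that by (simp add: l_def)
  qed
  have D_val: "bd_value \<T> p_hat S (barycenter S) = bd_value \<T> pDh S (barycenter S)" if "S \<in> ?D" for S
  proof -
    have S: "S \<in> bd_facets \<Omega> \<T>" "S \<notin> ?C" using that fe.CD(2,3) by blast+
    show ?thesis unfolding bdv[OF S(1)] fe.recon_boundary_value[OF S(1)] using S(2) by simp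
  qed
  have adm: "p_hat \<in> K_adm \<Omega> \<T> \<Gamma>D pDh" unfolding K_adm_def using pCR D_val by blast
  (* Test the divergence equation with the indicator of one element. *)
  have div_u: "RT_div T (u T) = fh T" if T: "T \<in> \<T>" for T
  proof -
    have "(\<Sum>T'\<in>\<T>. vol T' * (of_bool (T' = T) * RT_div T' (u T'))) = (\<Sum>T'\<in>\<T>. vol T' * (fh T' \<bullet> of_bool (T' = T)))"
      using kkt_div[of "\<lambda>T'. of_bool (T' = T)"] unfolding m.L2_inner_weak_div(2)[OF u] m.L2_inner_glue0 .
    then have "(\<Sum>T'\<in>\<T>. if T' = T then vol T * RT_div T (u T) else 0) = (\<Sum>T'\<in>\<T>. if T' = T then vol T * fh T else 0)"
      by (simp add: of_bool_def if_distrib[of "\<lambda>x. x * _"] if_distrib[of "\<lambda>x. _ * x"] cong: if_cong)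
    then show ?thesis using m.finite_\<T> T full_simplex.measure_pos[OF m.simplexI[OF T]] by simp
  qed
  have contact: "\<alpha>h S \<le> m.jump u S \<and> m.jump u S \<le> \<beta>h S \<and> lam_a S * (m.jump u S - \<alpha>h S) = 0 \<and> lam_b S * (\<beta>h S - m.jump u S) = 0"
    if S: "S \<in> ?C" for S
  proof -
    obtain T where T: "T \<in> \<T>" "S facet_of T" "S \<subseteq> frontier \<Omega>" using S fe.CD(1) m.bd_facetE by blast
    interpret s: simplex_facet T S by (rule m.facetI[OF T(1,2)])
    have "AE x in facet_measure S. \<alpha>h S \<le> m.jump u S \<and> m.jump u S \<le> \<beta>h S \<and> lam_a S * (m.jump u S - \<alpha>h S) = 0 \<and> lam_b S * (\<beta>h S - m.jump u S) = 0"
      using conjunct2[OF conjunct2[OF kkt_contact[OF S]]] m.flux_normal_trace[where v=u, OF m.RT0_field[OF u T(1)] T]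
      by eventually_elim (simp add: m.jump_bd[OF T])
    then show ?thesis using s.AE_facet_ex by blast
  qed
  have "I_cr \<Omega> \<T> \<Gamma>C Kh fh \<alpha>h \<beta>h p_hat \<le> I_cr \<Omega> \<T> \<Gamma>C Kh fh \<alpha>h \<beta>h q" if q: "q \<in> K_adm \<Omega> \<T> \<Gamma>D pDh" for q
  proof -
    have qCR: "q \<in> CR \<Omega> \<T>" using q by (simp add: K_adm_def)
    then obtain k g where kg: "\<And>T x. T \<in> \<T> \<Longrightarrow> x \<in> T \<Longrightarrow> q T x = k T + g T \<bullet> x"
      unfolding CR_def by (simp, metis)
    let ?E = "\<lambda>g r T. vol T * (1/2 * (g T \<bullet> (Kh T *v g T)) - fh T * elem_mean T (r T))"
    let ?B = "\<lambda>r S. \<beta>h S * pos_part (bd_value \<T> r S (barycenter S)) - \<alpha>h S * neg_part (bd_value \<T> r S (barycenter S))"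
    (* Integrating the difference e by parts against u turns the first variation of the energy at
       p_hat into a sum over the contact facets, which the subgradient inequality bounds. *)
    define e where "e T x = q T x - p_hat T x" for T x
    let ?G = "\<lambda>T. vol T * ((g T + w T) \<bullet> elem_mean T (u T))"
    let ?F = "\<lambda>T. vol T * (RT_div T (u T) * elem_mean T (e T))"
    let ?J = "\<lambda>S. area S * (m.jump u S * bd_value \<T> e S (barycenter S))"
    have eCR: "e \<in> CR \<Omega> \<T>"
      unfolding CR_def mem_Collect_eq
    proof (intro conjI ballI impI)
      show "\<exists>a b. \<forall>x\<in>T. e T x = a + b \<bullet> x" if "T \<in> \<T>" for T
        using affine_on_diff[OF m.CR_affine[OF qCR that] m.CR_affine[OF pCR that]] unfolding affine_on_def e_def .
      fix S T T' assume S: "S \<in> facets \<T> - bd_facets \<Omega> \<T>" and T: "T \<in> \<T>" "T' \<in> \<T>" "S facet_of T \<and> S facet_of T'"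
      note st = S T(1) conjunct1[OF T(3)] T(2) conjunct2[OF T(3)]
      show "e T (barycenter S) = e T' (barycenter S)"
        unfolding e_def m.CR_continuous[OF qCR st] m.CR_continuous[OF pCR st] ..
    qed
    have e_aff: "e T x = (k T - (p T + w T \<bullet> barycenter T)) + (g T + w T) \<bullet> x" if "T \<in> \<T>" "x \<in> T" for T x
      unfolding e_def kg[OF that] aff[OF that(1)] by (simp add: algebra_simps)
    have e_mean: "elem_mean T (e T) = elem_mean T (q T) - elem_mean T (p_hat T)" if T: "T \<in> \<T>" for T
    proof -
      interpret t: full_simplex T by (rule m.simplexI[OF T])
      have "elem_mean T (e T) = (k T - (p T + w T \<bullet> barycenter T)) + (g T + w T) \<bullet> barycenter T"
        by (rule t.elem_mean_affine) (rule e_aff[OF T])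
      moreover have "elem_mean T (q T) = k T + g T \<bullet> barycenter T"
        by (rule t.elem_mean_affine) (rule kg[OF T])
      moreover have "elem_mean T (p_hat T) = (p T + w T \<bullet> barycenter T) + (- w T) \<bullet> barycenter T"
        by (rule t.elem_mean_affine) (rule aff[OF T])
      ultimately show ?thesis by (simp add: algebra_simps)
    qed
    have bd_e: "bd_value \<T> e S (barycenter S) = bd_value \<T> q S (barycenter S) - bd_value \<T> p_hat S (barycenter S)" for S
      by (simp add: bd_value_def e_def)
    have "(\<Sum>T\<in>\<T>. ?G T) + (\<Sum>T\<in>\<T>. ?F T)
       = (\<Sum>S\<in>bd_facets \<Omega> \<T>. ?J S)"
      using m.discrete_parts[where v=u and q=e and k="\<lambda>T. k T - (p T + w T \<bullet> barycenter T)" and g="\<lambda>T. g T + w T",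
          OF m.RT0_field[OF u] e_aff] m.sum_CR_bd[OF eCR u] by simp
    also have "\<dots> = (\<Sum>S\<in>?C. ?J S)"
    proof (rule sum.mono_neutral_right)
      show "finite (bd_facets \<Omega> \<T>)" using m.finite_facets m.bd_facets_subset finite_subset by blast
      show "\<forall>S\<in>bd_facets \<Omega> \<T> - ?C. ?J S = 0"
      proof
        fix S assume "S \<in> bd_facets \<Omega> \<T> - ?C"
        then have S: "S \<in> ?D" using fe.CD(4) by blast
        have "bd_value \<T> q S (barycenter S) = bd_value \<T> pDh S (barycenter S)" using q S by (simp add: K_adm_def)
        then show "?J S = 0"
          unfolding bd_e using D_val[OF S] by simp
      qed
    qed (rule fe.CD(1))
    also have "\<dots> \<le> (\<Sum>S\<in>?C. area S * (?B q S - ?B p_hat S))"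
    proof (rule sum_mono)
      fix S assume S: "S \<in> ?C"
      obtain T where T: "T \<in> \<T>" "S facet_of T" "S \<subseteq> frontier \<Omega>" using S fe.CD(1) m.bd_facetE by blast
      have "m.jump u S * bd_value \<T> e S (barycenter S) \<le> ?B q S - ?B p_hat S"
        unfolding bd_e C_val[OF S] using contact[OF S] kkt_contact[OF S] by (intro contact_subgradient) auto
      then show "?J S \<le> area S * (?B q S - ?B p_hat S)"
        using simplex_facet.area_pos[OF m.facetI[OF T(1,2)]] by (intro mult_left_mono) auto
    qed
    finally have bdry: "(\<Sum>T\<in>\<T>. ?G T) + (\<Sum>T\<in>\<T>. ?F T)
       \<le> (\<Sum>S\<in>?C. area S * ?B q S) - (\<Sum>S\<in>?C. area S * ?B p_hat S)"
      by (simp add: right_diff_distrib sum_subtractf)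
    have "(\<Sum>T\<in>\<T>. ?E (\<lambda>T. - w T) p_hat T)
       \<le> (\<Sum>T\<in>\<T>. ?E g q T + (?G T + ?F T))"
    proof (rule sum_mono)
      fix T assume T: "T \<in> \<T>"
      have "(Kh T *v (- w T)) \<bullet> (g T - (- w T)) \<le> 1/2 * (g T \<bullet> (Kh T *v g T)) - 1/2 * ((- w T) \<bullet> (Kh T *v (- w T)))"
        by (rule quadratic_convex[OF Ksym[OF T] Kpsd[OF T]])
      moreover have "Kh T *v (- w T) = - elem_mean T (u T)"
        using Kw[OF T] matrix_vector_mult_scaleR[of "Kh T" "-1" "w T"] by simp
      ultimately have "1/2 * ((- w T) \<bullet> (Kh T *v (- w T))) \<le> 1/2 * (g T \<bullet> (Kh T *v g T)) + (g T + w T) \<bullet> elem_mean T (u T)"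
        by (simp add: inner_commute)
      then have "1/2 * ((- w T) \<bullet> (Kh T *v (- w T))) - fh T * elem_mean T (p_hat T)
          \<le> (1/2 * (g T \<bullet> (Kh T *v g T)) - fh T * elem_mean T (q T)) + ((g T + w T) \<bullet> elem_mean T (u T) + RT_div T (u T) * elem_mean T (e T))"
        unfolding div_u[OF T] e_mean[OF T] by (simp add: right_diff_distrib)
      from mult_left_mono[OF this, of "vol T"]
      show "?E (\<lambda>T. - w T) p_hat T
       \<le> ?E g q T + (?G T + ?F T)"
        by (simp only: distrib_left) simp
    qed
    moreover have "I_cr \<Omega> \<T> \<Gamma>C Kh fh \<alpha>h \<beta>h q =
        (\<Sum>T\<in>\<T>. ?E g q T) + (\<Sum>S\<in>?C. area S * ?B q S)"
      by (rule m.I_cr_eq[where k=k]) (use kg Ksym Kpsd fe.CD(1) in blast)+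
    moreover have "I_cr \<Omega> \<T> \<Gamma>C Kh fh \<alpha>h \<beta>h p_hat =
        (\<Sum>T\<in>\<T>. ?E (\<lambda>T. - w T) p_hat T) + (\<Sum>S\<in>?C. area S * ?B p_hat S)"
      by (rule m.I_cr_eq[where k="\<lambda>T. p T + w T \<bullet> barycenter T"]) (use aff Ksym Kpsd fe.CD(1) in blast)+
    ultimately show ?thesis
      using bdry unfolding sum.distrib by linarith
  qed
  then show ?thesis using adm by blast
qed

end
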